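(* Consider the bi-level Problem P and its barrier approximation described in the context, with all functions defining $\Sigma(\theta)$ three-times continuously differentiable and $\ell$, $R_i$ twice continuously differentiable. Let $\theta^*$ be such that for every $\theta$ in a neighborhood of $\theta^*$ the conditions (i) second-order sufficient condition for $\Sigma(\theta)$, (ii) linear independence of the gradients of all binding constraints of $B(\theta)$ at $\xi_\theta$, and (iii) strict complementarity for $\Sigma(\theta)$, all hold. Suppose that $\theta^*$ satisfies the second-order sufficient condition for a local isolated minimizer of Problem P, that the gradients $\nabla_\theta R_i(\xi_{\theta^*},\theta^* )$ of all binding constraints $R_i(\xi_{\theta^*},\theta^* )=0$ are linearly independent, and that strict complementarity holds at $\theta^*$. Then for any sufficiently small $\epsilon>0$ and any sufficiently small $\gamma>0$, for the problem $\theta^*(\epsilon,\gamma)=\arg\min_\theta\ \ell(\xi_{(\theta,\gamma)},\theta)-\epsilon\sum_{i=1}^l\ln\big(-R_i(\xi_{(\theta,\gamma)},\theta)\big)$ (Problem $SP(\epsilon,\gamma)$): (a) there exists a local isolated minimizer $\theta^*(\epsilon,\gamma)$ of $SP(\epsilon,\gamma)$, and $R_i\big(\xi_{(\theta^*(\epsilon,\gamma),\gamma)},\theta^*(\epsilon,\gamma)\big)<0$ for all $i=1,\dots,l$; (b) $\theta^*(\epsilon,\gamma)$ is once continuously differentiable with respect to $(\epsilon,\gamma)$, and $\theta^*(\epsilon,\gamma)\to\theta^*$ as $(\epsilon,\gamma)\to(0,0)$; (c) for every $\theta$ sufficiently near $\theta^*(\epsilon,\gamma)$, $R_i(\xi_{(\theta,\gamma)},\theta)<0$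 for all $i=1,\dots,l$.
   Context: Inner problem. $\theta\in\mathbb{R}^r$, horizon $T$, states $x_t\in\mathbb{R}^n$, inputs $u_t\in\mathbb{R}^m$; data $c_t(x,u,\theta)$, $c_T(x,\theta)$, $f(x,u,\theta)$, $x_0(\theta)$, $g_t(x,u,\theta)\in\mathbb{R}^{q_t}$, $h_t(x,u,\theta)\in\mathbb{R}^{s_t}$, $g_T(x,\theta)\in\mathbb{R}^{q_T}$, $h_T(x,\theta)\in\mathbb{R}^{s_T}$. Problem $B(\theta)$ / system $\Sigma(\theta)$: minimize $\sum_{t=0}^{T-1}c_t(x_t,u_t,\theta)+c_T(x_T,\theta)$ over trajectories $\xi=\{x_{0:T},u_{0:T-1}\}$ subject to $x_{t+1}=f(x_t,u_t,\theta)$, $x_0=x_0(\theta)$, $g_t\le0$, $h_t=0$, $g_T\le0$, $h_T=0$. With Hamiltonians $L_t=c_t+\lambda_{t+1}'f+v_t'g_t+w_t'h_t$, $L_T=c_T+v_T'g_T+w_T'h_T$, condition (i) means there are $\lambda_{1:T},v_{0:T},w_{0:T}$ with: dynamics and initial condition hold, $\lambda_t=L_t^x$, $\lambda_T=L_T^x$, $0=L_t^u$, all equality constraints hold, $g\le0$, $v\ge0$, $v_{t,i}g_{t,i}=0$, $v_{T,i}g_{T,i}=0$, and $\sum_{t=0}^{T-1}[x_t;u_t]'\begin{bmatrix}L_t^{xx}&L_t^{xu}\\L_t^{ux}&L_t^{uu}\end{bmatrix}[x_t;u_t]+x_T'L_T^{xx}x_T>0$ for all nonzero $\{x_{0:T},u_{0:T-1}\}$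 satisfying the linearized dynamics with $x_0=0$, linearized equality constraints $=0$, linearized inequality constraints with positive multiplier $=0$, and linearized active inequality constraints $\le0$ (derivatives at the trajectory and multipliers). Condition (iii): each active inequality constraint has positive multiplier. Under these, $\xi_\theta$ denotes the once continuously differentiable locally unique minimizing trajectory of $\Sigma(\theta)$ near $\theta^*$. Barrier inner system $\Sigma(\theta,\gamma)$, $\gamma>0$: minimize $\sum_{t=0}^{T-1}\big(c_t-\gamma\sum_{i=1}^{q_t}\ln(-g_{t,i})+\frac1{2\gamma}\sum_{i=1}^{s_t}h_{t,i}^2\big)+c_T-\gamma\sum_{i=1}^{q_T}\ln(-g_{T,i})+\frac1{2\gamma}\sum_{i=1}^{s_T}h_{T,i}^2$ subject only to $x_{t+1}=f(x_t,u_t,\theta)$, $x_0=x_0(\theta)$; $\xi_{(\theta,\gamma)}$ denotes its local isolated minimizing trajectory depending continuously differentiably on $(\theta,\gamma)$ near $(\theta^*,0)$ with $\xi_{(\theta,0)}=\xi_\theta$. Outer Problem P: given a task loss $\ell(\xi,\theta)$ and task constraints $R_i(\xi,\theta)$, $i=1,\dots,l$, minimize $\ell(\xi_\theta,\theta)$ over $\theta$ subject to $R_i(\xi_\theta,\theta)\le0$, $i=1,\dots,l$, where $\xi_\theta$ solves $B(\theta)$. The second-order sufficient condition for $\theta^*$ being a local isolated minimizer of P: there is $u^*\in\mathbb{R}^l$ with $\nabla_\theta\mathcal L(\theta^*,u^* )=0$ for $\mathcal L(\theta,u)=\ell(\xi_\theta,\theta)+\sum_iu_iR_i(\xi_\theta,\theta)$,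 $u_i^*R_i(\xi_{\theta^*},\theta^* )=0$, $R_i(\xi_{\theta^*},\theta^* )\le0$, $u_i^*\ge0$, and $y'\nabla^2_\theta\mathcal L(\theta^*,u^* )y>0$ for every $y\ne0$ with $y'\nabla_\theta R_i(\xi_{\theta^*},\theta^* )=0$ whenever $u_i^*>0$ and $y'\nabla_\theta R_i(\xi_{\theta^*},\theta^* )\le0$ for active $i$ with $u_i^*=0$ (gradients are total derivatives in $\theta$ of the composite maps $\theta\mapsto\ell(\xi_\theta,\theta)$, $\theta\mapsto R_i(\xi_\theta,\theta)$). Strict complementarity at $\theta^*$: $u_i^*>0$ whenever $R_i(\xi_{\theta^*},\theta^* )=0$. *)

theory Defs
  imports "HOL-Analysis.Analysis"
begin

text \<open>Directional derivative of F at p in direction d: the derivative at s = 0 of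
  s |-> F (p + s d).  For differentiable F this is the Frechet derivative applied to d;
  iterated, it gives the quadratic form of the Hessian.\<close>
definition dd :: "('a::real_normed_vector \<Rightarrow> 'b::real_normed_vector) \<Rightarrow> 'a \<Rightarrow> 'a \<Rightarrow> 'b" where
  "dd F p d = vector_derivative (\<lambda>s::real. F (p + s *\<^sub>R d)) (at 0)"

text \<open>k-times continuous differentiability of a real-valued map, expressed through a
  "line" structure lin p d s (the point p moved by s in direction d): all iterated
  directional derivatives up to order k exist and are continuous.  On a finite-dimensional
  space (or for maps depending on finitely many coordinates) this is the usual C^k.\<close>
fun gCk :: "('a \<Rightarrow> 'a \<Rightarrow> real \<Rightarrow> 'a) \<Rightarrow> nat \<Rightarrow> ('a::topological_space \<Rightarrow> real) \<Rightarrow> bool" where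
  "gCk lin 0 F = continuous_on UNIV F"
| "gCk lin (Suc k) F = (continuous_on UNIV F \<and>
      (\<forall>p d. (\<lambda>s. F (lin p d s)) differentiable (at 0)) \<and>
      (\<forall>d. gCk lin k (\<lambda>p. deriv (\<lambda>s. F (lin p d s)) 0)))"

definition vline :: "'a::real_vector \<Rightarrow> 'a \<Rightarrow> real \<Rightarrow> 'a" where
  "vline p d s = p + s *\<^sub>R d"

definition C1_on :: "'a::real_normed_vector set \<Rightarrow> ('a \<Rightarrow> 'b::real_normed_vector) \<Rightarrow> bool" where
  "C1_on S F \<longleftrightarrow> (\<exists>D. (\<forall>p\<in>S. (F has_derivative blinfun_apply (D p)) (at p)) \<and> continuous_on S D)"

definition local_min_on :: "('a::metric_space \<Rightarrow> real) \<Rightarrow> 'a set \<Rightarrow> 'a \<Rightarrow> bool" where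
  "local_min_on f S x \<longleftrightarrow> x \<in> S \<and> (\<exists>\<rho>>0. \<forall>y\<in>S. dist y x < \<rho> \<longrightarrow> f x \<le> f y)"

definition isolated_local_min_on :: "('a::metric_space \<Rightarrow> real) \<Rightarrow> 'a set \<Rightarrow> 'a \<Rightarrow> bool" where
  "isolated_local_min_on f S x \<longleftrightarrow> local_min_on f S x \<and>
     (\<exists>\<rho>>0. \<forall>y. dist y x < \<rho> \<and> local_min_on f S y \<longrightarrow> y = x)"

text \<open>A trajectory: states x_t (only t = 0..T relevant) and inputs u_t (only t = 0..T-1).\<close>
type_synonym ('n,'m) traj = "(nat \<Rightarrow> real^'n) \<times> (nat \<Rightarrow> real^'m)"

definition traj_eq :: "nat \<Rightarrow> ('n::finite,'m::finite) traj \<Rightarrow> ('n,'m) traj \<Rightarrow> bool" where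
  "traj_eq T \<xi> \<eta> \<longleftrightarrow> (\<forall>t\<le>T. fst \<xi> t = fst \<eta> t) \<and> (\<forall>t<T. snd \<xi> t = snd \<eta> t)"

definition traj_near :: "nat \<Rightarrow> ('n::finite,'m::finite) traj \<Rightarrow> ('n,'m) traj \<Rightarrow> real \<Rightarrow> bool" where
  "traj_near T \<xi> \<eta> \<rho> \<longleftrightarrow> (\<forall>t\<le>T. dist (fst \<xi> t) (fst \<eta> t) < \<rho>) \<and> (\<forall>t<T. dist (snd \<xi> t) (snd \<eta> t) < \<rho>)"

definition traj_nonzero :: "nat \<Rightarrow> ('n::finite,'m::finite) traj \<Rightarrow> bool" where
  "traj_nonzero T \<xi> \<longleftrightarrow> (\<exists>t\<le>T. fst \<xi> t \<noteq> 0) \<or> (\<exists>t<T. snd \<xi> t \<noteq> 0)"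

definition tline :: "(('n::finite,'m::finite) traj \<times> (real^'r::finite)) \<Rightarrow> (('n,'m) traj \<times> (real^'r)) \<Rightarrow> real \<Rightarrow> (('n,'m) traj \<times> (real^'r))" where
  "tline p d s = (((\<lambda>t. fst (fst p) t + s *\<^sub>R fst (fst d) t), (\<lambda>t. snd (fst p) t + s *\<^sub>R snd (fst d) t)),
                  snd p + s *\<^sub>R snd d)"

text \<open>Data of the parameterised constrained optimal control system Sigma(theta).
  g t x u theta i is the i-th inequality constraint at stage t (i < nq t), etc.;
  gT, hT are the terminal constraints.\<close>
record ('n::finite, 'm::finite, 'r::finite) ocp =
  hor  :: nat
  cst  :: "nat \<Rightarrow> real^'n \<Rightarrow> real^'m \<Rightarrow> real^'r \<Rightarrow> real"
  tcst :: "real^'n \<Rightarrow> real^'r \<Rightarrow> real"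
  dyn  :: "real^'n \<Rightarrow> real^'m \<Rightarrow> real^'r \<Rightarrow> real^'n"
  ini  :: "real^'r \<Rightarrow> real^'n"
  gc   :: "nat \<Rightarrow> real^'n \<Rightarrow> real^'m \<Rightarrow> real^'r \<Rightarrow> nat \<Rightarrow> real"
  nq   :: "nat \<Rightarrow> nat"
  hc   :: "nat \<Rightarrow> real^'n \<Rightarrow> real^'m \<Rightarrow> real^'r \<Rightarrow> nat \<Rightarrow> real"
  ns   :: "nat \<Rightarrow> nat"
  gTc  :: "real^'n \<Rightarrow> real^'r \<Rightarrow> nat \<Rightarrow> real"
  nqT  :: nat
  hTc  :: "real^'n \<Rightarrow> real^'r \<Rightarrow> nat \<Rightarrow> real"
  nsT  :: nat

definition ocp_C3 :: "('n::finite,'m::finite,'r::finite) ocp \<Rightarrow> bool" where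
  "ocp_C3 P \<longleftrightarrow>
     (\<forall>t<hor P. gCk vline 3 (\<lambda>((x,u),\<theta>). cst P t x u \<theta>)) \<and>
     gCk vline 3 (\<lambda>(x,\<theta>). tcst P x \<theta>) \<and>
     (\<forall>j. gCk vline 3 (\<lambda>((x,u),\<theta>). dyn P x u \<theta> $ j)) \<and>
     (\<forall>j. gCk vline 3 (\<lambda>\<theta>. ini P \<theta> $ j)) \<and>
     (\<forall>t<hor P. \<forall>i<nq P t. gCk vline 3 (\<lambda>((x,u),\<theta>). gc P t x u \<theta> i)) \<and>
     (\<forall>t<hor P. \<forall>i<ns P t. gCk vline 3 (\<lambda>((x,u),\<theta>). hc P t x u \<theta> i)) \<and>
     (\<forall>i<nqT P. gCk vline 3 (\<lambda>(x,\<theta>). gTc P x \<theta> i)) \<and>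
     (\<forall>i<nsT P. gCk vline 3 (\<lambda>(x,\<theta>). hTc P x \<theta> i))"

definition dyn_ok :: "('n::finite,'m::finite,'r::finite) ocp \<Rightarrow> real^'r \<Rightarrow> ('n,'m) traj \<Rightarrow> bool" where
  "dyn_ok P \<theta> \<xi> \<longleftrightarrow> (\<forall>t<hor P. fst \<xi> (Suc t) = dyn P (fst \<xi> t) (snd \<xi> t) \<theta>) \<and> fst \<xi> 0 = ini P \<theta>"

definition feasB :: "('n::finite,'m::finite,'r::finite) ocp \<Rightarrow> real^'r \<Rightarrow> ('n,'m) traj \<Rightarrow> bool" where
  "feasB P \<theta> \<xi> \<longleftrightarrow> dyn_ok P \<theta> \<xi> \<and>
     (\<forall>t<hor P. (\<forall>i<nq P t. gc P t (fst \<xi> t) (snd \<xi> t) \<theta> i \<le> 0) \<and>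
                 (\<forall>i<ns P t. hc P t (fst \<xi> t) (snd \<xi> t) \<theta> i = 0)) \<and>
     (\<forall>i<nqT P. gTc P (fst \<xi> (hor P)) \<theta> i \<le> 0) \<and>
     (\<forall>i<nsT P. hTc P (fst \<xi> (hor P)) \<theta> i = 0)"

text \<open>Hamiltonians L_t (as a function of z = (x,u)) and L_T; the terminal multipliers
  v_T, w_T are v T, w T with T = hor P.\<close>
definition stage_lag :: "('n::finite,'m::finite,'r::finite) ocp \<Rightarrow> real^'r \<Rightarrow> (nat \<Rightarrow> real^'n) \<Rightarrow>
    (nat \<Rightarrow> nat \<Rightarrow> real) \<Rightarrow> (nat \<Rightarrow> nat \<Rightarrow> real) \<Rightarrow> nat \<Rightarrow> (real^'n) \<times> (real^'m) \<Rightarrow> real" where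
  "stage_lag P \<theta> lam v w t z =
     cst P t (fst z) (snd z) \<theta> + lam (Suc t) \<bullet> dyn P (fst z) (snd z) \<theta>
     + (\<Sum>i<nq P t. v t i * gc P t (fst z) (snd z) \<theta> i)
     + (\<Sum>i<ns P t. w t i * hc P t (fst z) (snd z) \<theta> i)"

definition term_lag :: "('n::finite,'m::finite,'r::finite) ocp \<Rightarrow> real^'r \<Rightarrow>
    (nat \<Rightarrow> nat \<Rightarrow> real) \<Rightarrow> (nat \<Rightarrow> nat \<Rightarrow> real) \<Rightarrow> real^'n \<Rightarrow> real" where
  "term_lag P \<theta> v w x =
     tcst P x \<theta> + (\<Sum>i<nqT P. v (hor P) i * gTc P x \<theta> i) + (\<Sum>i<nsT P. w (hor P) i * hTc P x \<theta> i)"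

definition cond_i :: "('n::finite,'m::finite,'r::finite) ocp \<Rightarrow> real^'r \<Rightarrow> ('n,'m) traj \<Rightarrow>
    (nat \<Rightarrow> real^'n) \<Rightarrow> (nat \<Rightarrow> nat \<Rightarrow> real) \<Rightarrow> (nat \<Rightarrow> nat \<Rightarrow> real) \<Rightarrow> bool" where
  "cond_i P \<theta> \<xi> lam v w \<longleftrightarrow>
    (let T = hor P; X = fst \<xi>; U = snd \<xi>; L = stage_lag P \<theta> lam v w; LT = term_lag P \<theta> v w in
     feasB P \<theta> \<xi> \<and>
     (\<forall>t. 1 \<le> t \<and> t < T \<longrightarrow> (\<forall>d. lam t \<bullet> d = dd (L t) (X t, U t) (d, 0))) \<and>
     (\<forall>d. lam T \<bullet> d = dd LT (X T) d) \<and>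
     (\<forall>t<T. \<forall>e. dd (L t) (X t, U t) (0, e) = 0) \<and>
     (\<forall>t<T. \<forall>i<nq P t. v t i \<ge> 0 \<and> v t i * gc P t (X t) (U t) \<theta> i = 0) \<and>
     (\<forall>i<nqT P. v T i \<ge> 0 \<and> v T i * gTc P (X T) \<theta> i = 0) \<and>
     (\<forall>dX dU. traj_nonzero T (dX, dU) \<and>
        (\<forall>t<T. dX (Suc t) = dd (\<lambda>z. dyn P (fst z) (snd z) \<theta>) (X t, U t) (dX t, dU t)) \<and>
        dX 0 = 0 \<and>
        (\<forall>t<T. \<forall>i<ns P t. dd (\<lambda>z. hc P t (fst z) (snd z) \<theta> i) (X t, U t) (dX t, dU t) = 0) \<and>
        (\<forall>i<nsT P. dd (\<lambda>x. hTc P x \<theta> i) (X T) (dX T) = 0) \<and>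
        (\<forall>t<T. \<forall>i<nq P t. v t i > 0 \<longrightarrow>
             dd (\<lambda>z. gc P t (fst z) (snd z) \<theta> i) (X t, U t) (dX t, dU t) = 0) \<and>
        (\<forall>i<nqT P. v T i > 0 \<longrightarrow> dd (\<lambda>x. gTc P x \<theta> i) (X T) (dX T) = 0) \<and>
        (\<forall>t<T. \<forall>i<nq P t. gc P t (X t) (U t) \<theta> i = 0 \<longrightarrow>
             dd (\<lambda>z. gc P t (fst z) (snd z) \<theta> i) (X t, U t) (dX t, dU t) \<le> 0) \<and>
        (\<forall>i<nqT P. gTc P (X T) \<theta> i = 0 \<longrightarrow> dd (\<lambda>x. gTc P x \<theta> i) (X T) (dX T) \<le> 0)
      \<longrightarrow>
        (\<Sum>t<T. dd (\<lambda>z. dd (L t) z (dX t, dU t)) (X t, U t) (dX t, dU t))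
          + dd (\<lambda>x. dd LT x (dX T)) (X T) (dX T) > 0))"

text \<open>Condition (ii): the gradients (w.r.t. the whole trajectory) of all binding constraints
  of B(theta) at xi -- dynamics x_{t+1} - f(x_t,u_t) = 0, initial condition x_0 - x_0(theta) = 0,
  all equality constraints and all active inequality constraints -- are linearly independent.\<close>
definition cond_ii :: "('n::finite,'m::finite,'r::finite) ocp \<Rightarrow> real^'r \<Rightarrow> ('n,'m) traj \<Rightarrow> bool" where
  "cond_ii P \<theta> \<xi> \<longleftrightarrow>
    (let T = hor P; X = fst \<xi>; U = snd \<xi> in
     \<forall>(mu :: nat \<Rightarrow> real^'n) (a :: nat \<Rightarrow> nat \<Rightarrow> real) (b :: nat \<Rightarrow> nat \<Rightarrow> real).
       (\<forall>dX dU.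
          (\<Sum>t<T. mu (Suc t) \<bullet> (dX (Suc t) - dd (\<lambda>z. dyn P (fst z) (snd z) \<theta>) (X t, U t) (dX t, dU t)))
          + mu 0 \<bullet> dX 0
          + (\<Sum>t<T. \<Sum>i<ns P t. a t i * dd (\<lambda>z. hc P t (fst z) (snd z) \<theta> i) (X t, U t) (dX t, dU t))
          + (\<Sum>i<nsT P. a T i * dd (\<lambda>x. hTc P x \<theta> i) (X T) (dX T))
          + (\<Sum>t<T. \<Sum>i\<in>{i. i < nq P t \<and> gc P t (X t) (U t) \<theta> i = 0}.
                b t i * dd (\<lambda>z. gc P t (fst z) (snd z) \<theta> i) (X t, U t) (dX t, dU t))
          + (\<Sum>i\<in>{i. i < nqT P \<and> gTc P (X T) \<theta> i = 0}. b T i * dd (\<lambda>x. gTc P x \<theta> i) (X T) (dX T))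
          = 0)
       \<longrightarrow> (\<forall>t\<le>T. mu t = 0) \<and>
           (\<forall>t<T. \<forall>i<ns P t. a t i = 0) \<and> (\<forall>i<nsT P. a T i = 0) \<and>
           (\<forall>t<T. \<forall>i<nq P t. gc P t (X t) (U t) \<theta> i = 0 \<longrightarrow> b t i = 0) \<and>
           (\<forall>i<nqT P. gTc P (X T) \<theta> i = 0 \<longrightarrow> b T i = 0))"

definition cond_iii :: "('n::finite,'m::finite,'r::finite) ocp \<Rightarrow> real^'r \<Rightarrow> ('n,'m) traj \<Rightarrow>
    (nat \<Rightarrow> nat \<Rightarrow> real) \<Rightarrow> bool" where
  "cond_iii P \<theta> \<xi> v \<longleftrightarrow>
     (\<forall>t<hor P. \<forall>i<nq P t. gc P t (fst \<xi> t) (snd \<xi> t) \<theta> i = 0 \<longrightarrow> v t i > 0) \<and>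
     (\<forall>i<nqT P. gTc P (fst \<xi> (hor P)) \<theta> i = 0 \<longrightarrow> v (hor P) i > 0)"

definition inner_conds :: "('n::finite,'m::finite,'r::finite) ocp \<Rightarrow> real^'r \<Rightarrow> ('n,'m) traj \<Rightarrow> bool" where
  "inner_conds P \<theta> \<xi> \<longleftrightarrow>
     (\<exists>lam v w. cond_i P \<theta> \<xi> lam v w \<and> cond_iii P \<theta> \<xi> v) \<and> cond_ii P \<theta> \<xi>"

definition barrier_feas :: "('n::finite,'m::finite,'r::finite) ocp \<Rightarrow> real^'r \<Rightarrow> ('n,'m) traj \<Rightarrow> bool" where
  "barrier_feas P \<theta> \<xi> \<longleftrightarrow> dyn_ok P \<theta> \<xi> \<and>
     (\<forall>t<hor P. \<forall>i<nq P t. gc P t (fst \<xi> t) (snd \<xi> t) \<theta> i < 0) \<and>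
     (\<forall>i<nqT P. gTc P (fst \<xi> (hor P)) \<theta> i < 0)"

definition barrier_cost :: "('n::finite,'m::finite,'r::finite) ocp \<Rightarrow> real^'r \<Rightarrow> real \<Rightarrow> ('n,'m) traj \<Rightarrow> real" where
  "barrier_cost P \<theta> \<gamma> \<xi> =
     (let T = hor P; X = fst \<xi>; U = snd \<xi> in
      (\<Sum>t<T. cst P t (X t) (U t) \<theta>
              - \<gamma> * (\<Sum>i<nq P t. ln (- gc P t (X t) (U t) \<theta> i))
              + (1 / (2 * \<gamma>)) * (\<Sum>i<ns P t. (hc P t (X t) (U t) \<theta> i)\<^sup>2))
      + tcst P (X T) \<theta> - \<gamma> * (\<Sum>i<nqT P. ln (- gTc P (X T) \<theta> i))
      + (1 / (2 * \<gamma>)) * (\<Sum>i<nsT P. (hTc P (X T) \<theta> i)\<^sup>2))"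

definition barrier_locmin :: "('n::finite,'m::finite,'r::finite) ocp \<Rightarrow> real^'r \<Rightarrow> real \<Rightarrow> ('n,'m) traj \<Rightarrow> bool" where
  "barrier_locmin P \<theta> \<gamma> \<xi> \<longleftrightarrow> barrier_feas P \<theta> \<xi> \<and>
     (\<exists>\<rho>>0. \<forall>\<eta>. barrier_feas P \<theta> \<eta> \<and> traj_near (hor P) \<xi> \<eta> \<rho> \<longrightarrow>
                  barrier_cost P \<theta> \<gamma> \<xi> \<le> barrier_cost P \<theta> \<gamma> \<eta>)"

definition barrier_isolated_min :: "('n::finite,'m::finite,'r::finite) ocp \<Rightarrow> real^'r \<Rightarrow> real \<Rightarrow> ('n,'m) traj \<Rightarrow> bool" where
  "barrier_isolated_min P \<theta> \<gamma> \<xi> \<longleftrightarrow> barrier_locmin P \<theta> \<gamma> \<xi> \<and>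
     (\<exists>\<rho>>0. \<forall>\<eta>. barrier_locmin P \<theta> \<gamma> \<eta> \<and> traj_near (hor P) \<xi> \<eta> \<rho> \<longrightarrow> traj_eq (hor P) \<xi> \<eta>)"

text \<open>Second-order sufficient condition for theta* to be a local isolated minimizer of
  Problem P, together with strict complementarity at theta* (same multiplier u), for the
  composite maps Phi(theta) = ell(xi_theta, theta), Psi i theta = R_i(xi_theta, theta).\<close>
definition outer_SOSC_SC :: "(real^'r::finite \<Rightarrow> real) \<Rightarrow> (nat \<Rightarrow> real^'r \<Rightarrow> real) \<Rightarrow> nat \<Rightarrow> real^'r \<Rightarrow> bool" where
  "outer_SOSC_SC Phi Psi l \<theta>s \<longleftrightarrow>
    (\<exists>u::nat \<Rightarrow> real.
       (let Lag = (\<lambda>\<theta>. Phi \<theta> + (\<Sum>i<l. u i * Psi i \<theta>)) in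
        (\<forall>y. dd Lag \<theta>s y = 0) \<and>
        (\<forall>i<l. u i * Psi i \<theta>s = 0 \<and> Psi i \<theta>s \<le> 0 \<and> u i \<ge> 0) \<and>
        (\<forall>y. y \<noteq> 0 \<and>
             (\<forall>i<l. u i > 0 \<longrightarrow> dd (Psi i) \<theta>s y = 0) \<and>
             (\<forall>i<l. Psi i \<theta>s = 0 \<and> u i = 0 \<longrightarrow> dd (Psi i) \<theta>s y \<le> 0)
           \<longrightarrow> dd (\<lambda>\<theta>. dd Lag \<theta> y) \<theta>s y > 0) \<and>
        (\<forall>i<l. Psi i \<theta>s = 0 \<longrightarrow> u i > 0)))"

definition outer_LICQ :: "(nat \<Rightarrow> real^'r::finite \<Rightarrow> real) \<Rightarrow> nat \<Rightarrow> real^'r \<Rightarrow> bool" where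
  "outer_LICQ Psi l \<theta>s \<longleftrightarrow>
    (\<forall>a::nat \<Rightarrow> real.
       (\<forall>y. (\<Sum>i\<in>{i. i < l \<and> Psi i \<theta>s = 0}. a i * dd (Psi i) \<theta>s y) = 0)
       \<longrightarrow> (\<forall>i<l. Psi i \<theta>s = 0 \<longrightarrow> a i = 0))"

end

theory Submission
  imports Defs
begin

text \<open>The barrier trajectories are only assumed to be once continuously differentiable, whereas the
  outer problem needs their \<open>\<theta>\<close>-derivatives to be continuously differentiable as well, up to
  \<open>\<gamma> = 0\<close>.  For \<open>\<gamma> > 0\<close> a barrier minimizer satisfies a perturbed KKT system
  (\<open>v g = -\<gamma>\<close>, \<open>h = \<gamma> w\<close>).  By linear independence its multipliers solve a regular linear system with
  continuously differentiable coefficients, hence are continuously differentiable; differentiating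
  the KKT system then shows that the derivative of the trajectory solves such a system too, regular at
  \<open>(\<theta>\<^sup>*, 0)\<close> by the second-order condition.  So the derivative extends continuously
  differentiably across \<open>\<gamma> = 0\<close>, and no implicit function theorem is needed for the inner problem.

  For the outer problem the implicit function theorem is applied to the equations
  \<open>\<nabla>\<ell> + \<Sum> \<mu>\<^sub>i \<nabla>R\<^sub>i = 0\<close>, \<open>\<mu>\<^sub>i R\<^sub>i = -\<epsilon>\<close> at \<open>(\<epsilon>, \<gamma>) = (0, 0)\<close>.  On the resulting branch the barrier
  adds the term \<open>\<mu>\<^sub>i\<^sup>2 / \<epsilon>\<close> times the square of \<open>\<nabla>R\<^sub>i\<close> to the Hessian, which becomes positive definite for
  small \<open>\<epsilon>\<close> by Debreu's lemma.\<close>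

section \<open>Linear systems with coefficients in a class of functions\<close>

text \<open>The shaping obstacle is one-sidedness. The barrier trajectory is a C1 map on a full ball
  around \<open>(\<theta>s, 0)\<close>, but it is known to solve a problem only where \<gamma> > 0;
  for \<gamma> < 0 it is arbitrary. Hence the linear algebra claims uniqueness instead of existence:
  the coefficients are C1 on both sides of \<gamma> = 0, and any vector that solves the system at a
  nearby point must equal \<open>z\<close> there. Multipliers and trajectory derivatives supply such
  vectors for \<gamma> > 0, the resulting identities pass to \<gamma> = 0 by continuity, and for
  \<gamma> < 0 the function \<open>z\<close> is an artificial extension. The two-sided implicit
  function theorem of the outer problem acts on this extension. Three derivatives of the inner data
  are consumed because second derivatives enter the coefficients, which must be C1. Two derivatives
  of loss and task constraints suffice, since the chain rule differentiates them once. The outer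
  multipliers of active constraints are separate unknowns because the ratio of \<epsilon> to the
  constraint value is 0/0 at the origin. The class \<open>Q\<close> is abstract because the same
  elimination serves C1 functions and functions continuous at a point.\<close>

text \<open>Gaussian elimination with a pivot that does not vanish at \<open>p0\<close>.\<close>

lemma linear_solve_class:
  fixes Q :: "('p::t2_space \<Rightarrow> real) \<Rightarrow> bool" and a :: "'i \<Rightarrow> 'j \<Rightarrow> 'p \<Rightarrow> real"
  assumes const: "Q (\<lambda>_. 0)"
    and diff: "\<And>f g. Q f \<Longrightarrow> Q g \<Longrightarrow> Q (\<lambda>p. f p - g p)"
    and mult: "\<And>f g. Q f \<Longrightarrow> Q g \<Longrightarrow> Q (\<lambda>p. f p * g p)"
    and inv: "\<And>f. Q f \<Longrightarrow> f p0 \<noteq> 0 \<Longrightarrow> Q (\<lambda>p. inverse (f p))"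
    and cont: "\<And>f. Q f \<Longrightarrow> isCont f p0"
    and "finite J"
    and "\<And>i j. i \<in> I \<Longrightarrow> j \<in> J \<Longrightarrow> Q (a i j)"
    and "\<And>i. i \<in> I \<Longrightarrow> Q (b i)"
    and "\<And>x. (\<And>i. i \<in> I \<Longrightarrow> (\<Sum>j\<in>J. a i j p0 * x j) = 0) \<Longrightarrow> (\<forall>j\<in>J. x j = 0)"
  shows "\<exists>z. (\<forall>j\<in>J. Q (z j)) \<and>
     (\<forall>\<^sub>F p in nhds p0. \<forall>x. (\<forall>i\<in>I. (\<Sum>j\<in>J. a i j p * x j) = b i p) \<longrightarrow> (\<forall>j\<in>J. x j = z j p))"
  using assms(6-)
proof (induction J arbitrary: a b rule: finite_induct)
  case empty
  then show ?case by auto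
next
  case (insert j0 J)
  have add: "Q (\<lambda>p. f p + g p)" if "Q f" "Q g" for f g
  proof -
    have "Q (\<lambda>p. f p - (0 - g p))"
      using that by (intro diff const)
    then show ?thesis by simp
  qed
  have sums: "Q (\<lambda>p. \<Sum>j\<in>S. f j p)" if "finite S" "\<And>j. j \<in> S \<Longrightarrow> Q (f j)" for S and f :: "'j \<Rightarrow> 'p \<Rightarrow> real"
    using that by (induction S rule: finite_induct) (auto intro: const add)
  \<comment> \<open>Otherwise the unit vector of column \<open>j0\<close> would lie in the kernel at
    \<open>p0\<close>.\<close>
  have "\<exists>i0\<in>I. a i0 j0 p0 \<noteq> 0"
  proof (rule ccontr)
    assume "\<not> ?thesis"
    then have "\<forall>j\<in>insert j0 J. (if j = j0 then 1 else 0::real) = 0"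
      using insert.hyps by (intro insert.prems(3)) (auto intro!: sum.neutral)
    then show False by auto
  qed
  then obtain i0 where i0: "i0 \<in> I" "a i0 j0 p0 \<noteq> 0" by auto
  define r where "r = (\<lambda>p. inverse (a i0 j0 p))"
  have Qr: "Q r" unfolding r_def using i0 insert.prems(1) by (intro inv) auto
  \<comment> \<open>Column \<open>j0\<close> is cleared from every row, the pivot row included,
    whose coefficients become 0 near \<open>p0\<close>. Keeping that row leaves the index set
    \<open>I\<close> unchanged through the induction.\<close>
  define a' where "a' = (\<lambda>i j p. a i j p - a i j0 p * (r p * a i0 j p))"
  define b' where "b' = (\<lambda>i p. b i p - a i j0 p * (r p * b i0 p))"
  have key: "(\<Sum>j\<in>J. a' i j p * x j) = (\<Sum>j\<in>J. a i j p * x j) - a i j0 p * (r p * (\<Sum>j\<in>J. a i0 j p * x j))" for i p x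
    by (simp add: a'_def left_diff_distrib sum_subtractf sum_distrib_left mult.assoc)
  have "\<exists>z. (\<forall>j\<in>J. Q (z j)) \<and>
     (\<forall>\<^sub>F p in nhds p0. \<forall>x. (\<forall>i\<in>I. (\<Sum>j\<in>J. a' i j p * x j) = b' i p) \<longrightarrow> (\<forall>j\<in>J. x j = z j p))"
  proof (rule insert.IH)
    show "Q (a' i j)" if "i \<in> I" "j \<in> J" for i j
      unfolding a'_def using that insert.prems(1) i0 by (intro diff mult Qr) auto
    show "Q (b' i)" if "i \<in> I" for i
      unfolding b'_def using that insert.prems i0 by (intro diff mult Qr) auto
    show "\<forall>j\<in>J. x j = 0" if x: "\<And>i. i \<in> I \<Longrightarrow> (\<Sum>j\<in>J. a' i j p0 * x j) = 0" for x
    proof -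
      \<comment> \<open>Back substitution at \<open>p0\<close>: the new component annihilates the
        pivot row, so a kernel vector of the reduced system extends to one of the full
        system.\<close>
      define x' where "x' = x(j0 := - (r p0 * (\<Sum>j\<in>J. a i0 j p0 * x j)))"
      have "(\<Sum>j\<in>J. a i j p0 * x' j) = (\<Sum>j\<in>J. a i j p0 * x j)" for i
        using insert.hyps by (intro sum.cong) (auto simp: x'_def)
      then have "\<forall>j\<in>insert j0 J. x' j = 0"
        using x key[of _ p0 x] insert.hyps by (intro insert.prems(3)) (auto simp: x'_def)
      then show ?thesis using insert.hyps by (auto simp: x'_def split: if_splits)
    qed
  qed
  then obtain z where z: "\<forall>j\<in>J. Q (z j)" and
    ev: "\<forall>\<^sub>F p in nhds p0. \<forall>x. (\<forall>i\<in>I. (\<Sum>j\<in>J. a' i j p * x j) = b' i p) \<longrightarrow> (\<forall>j\<in>J. x j = z j p)" by auto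
  define z' where "z' = z(j0 := (\<lambda>p. r p * (b i0 p - (\<Sum>j\<in>J. a i0 j p * z j p))))"
  have "\<forall>j\<in>insert j0 J. Q (z' j)"
    using z insert i0 by (auto simp: z'_def intro!: diff mult Qr sums)
  moreover have "isCont (a i0 j0) p0" using i0 insert.prems(1) cont by auto
  then have "\<forall>\<^sub>F p in nhds p0. a i0 j0 p \<noteq> 0"
    using i0 by (metis isCont_def t1_space_nhds tendsto_at_iff_tendsto_nhds tendsto_imp_eventually_ne)
  then have "\<forall>\<^sub>F p in nhds p0. \<forall>x. (\<forall>i\<in>I. (\<Sum>j\<in>insert j0 J. a i j p * x j) = b i p) \<longrightarrow> (\<forall>j\<in>insert j0 J. x j = z' j p)"
    using ev
  proof eventually_elim
    case (elim p)
    show ?case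
    proof (intro allI impI)
      fix x assume x: "\<forall>i\<in>I. (\<Sum>j\<in>insert j0 J. a i j p * x j) = b i p"
      have b: "b i p = a i j0 p * x j0 + (\<Sum>j\<in>J. a i j p * x j)" if "i \<in> I" for i
        using x that insert.hyps by auto
      have rp: "r p * a i0 j0 p = 1" using elim(1) by (simp add: r_def)
      have x0: "x j0 = r p * (b i0 p - (\<Sum>j\<in>J. a i0 j p * x j))"
        using b[OF i0(1)] rp by (simp add: mult.assoc[symmetric])
      have "\<forall>i\<in>I. (\<Sum>j\<in>J. a' i j p * x j) = b' i p"
      proof
        fix i assume "i \<in> I"
        have "a i j0 p * x j0 = a i j0 p * (r p * b i0 p) - a i j0 p * (r p * (\<Sum>j\<in>J. a i0 j p * x j))"
          by (subst x0) (simp add: right_diff_distrib)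
        then show "(\<Sum>j\<in>J. a' i j p * x j) = b' i p"
          using b[OF \<open>i \<in> I\<close>] by (simp add: key b'_def)
      qed
      then have "\<forall>j\<in>J. x j = z j p" using elim(2) by auto
      then show "\<forall>j\<in>insert j0 J. x j = z' j p"
        using x0 insert.hyps by (auto simp: z'_def cong: sum.cong)
    qed
  qed
  ultimately show ?case by blast
qed

section \<open>Smooth functions of coordinates\<close>

text \<open>Functions of coordinates indexed by \<open>'i\<close>; the derivatives in \<^const>\<open>gCk\<close> are taken along
  the lines \<open>flin\<close>.\<close>

definition flin :: "('i \<Rightarrow> real) \<Rightarrow> ('i \<Rightarrow> real) \<Rightarrow> real \<Rightarrow> 'i \<Rightarrow> real" where
  "flin w d s = (\<lambda>i. w i + s * d i)"

definition Dd :: "(('i \<Rightarrow> real) \<Rightarrow> real) \<Rightarrow> ('i \<Rightarrow> real) \<Rightarrow> ('i \<Rightarrow> real) \<Rightarrow> real" where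
  "Dd F w d = deriv (\<lambda>s. F (flin w d s)) 0"

definition pd :: "'i \<Rightarrow> (('i \<Rightarrow> real) \<Rightarrow> real) \<Rightarrow> ('i \<Rightarrow> real) \<Rightarrow> real" where
  "pd i F w = Dd F w (\<lambda>j. if j = i then 1 else 0)"

lemma gCk_mono: "gCk lin (Suc k) F \<Longrightarrow> gCk lin k F"
  by (induction k arbitrary: F) auto

lemma gCk_le: "j \<le> k \<Longrightarrow> gCk lin k F \<Longrightarrow> gCk lin j F"
  by (induction k rule: dec_induct) (auto dest: gCk_mono simp del: gCk.simps)

lemma gCk_imp_continuous: "gCk lin k F \<Longrightarrow> continuous_on UNIV F"
  by (cases k) auto

text \<open>A map that sends lines to lines commutes with differentiation along lines, so smoothness
  transfers without a chain rule. This carries the problem data from \<open>vline\<close> and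
  \<open>tline\<close> to the coordinate lines \<open>flin\<close>.\<close>

lemma gCk_line_map:
  assumes "continuous_on UNIV \<delta>" and "\<And>p d s. \<delta> (lin1 p d s) = lin2 (\<delta> p) (\<delta> d) s"
  shows "gCk lin2 k F \<Longrightarrow> gCk lin1 k (\<lambda>x. F (\<delta> x))"
proof (induction k arbitrary: F)
  case 0
  then show ?case using assms(1) by (auto intro: continuous_on_compose2)
next
  case (Suc k)
  have "gCk lin1 k (\<lambda>p. deriv (\<lambda>s. F (lin2 (\<delta> p) (\<delta> d) s)) 0)" for d
    using Suc.prems Suc.IH[of "\<lambda>p. deriv (\<lambda>s. F (lin2 p (\<delta> d) s)) 0"] by simp
  then show ?case using assms Suc.prems by (auto intro: continuous_on_compose2)
qed

lemma gCk_const: "gCk lin k (\<lambda>_. c)"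
  by (induction k arbitrary: c) auto

lemma gCk_add: "gCk lin k F \<Longrightarrow> gCk lin k G \<Longrightarrow> gCk lin k (\<lambda>p. F p + G p)"
proof (induction k arbitrary: F G)
  case 0
  then show ?case by (auto intro: continuous_intros)
next
  case (Suc k)
  have "deriv (\<lambda>s. F (lin p d s) + G (lin p d s)) 0 = deriv (\<lambda>s. F (lin p d s)) 0 + deriv (\<lambda>s. G (lin p d s)) 0" for p d
    using Suc.prems by (intro deriv_add) (auto simp: field_differentiable_def real_differentiable_def)
  then show ?case
    using Suc by (auto intro: continuous_intros)
qed

lemma gCk_cmult: "gCk lin k F \<Longrightarrow> gCk lin k (\<lambda>p. c * F p)"
proof (induction k arbitrary: F)
  case 0
  then show ?case by (auto intro: continuous_intros)
next
  case (Suc k)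
  have "deriv (\<lambda>s. c * F (lin p d s)) 0 = c * deriv (\<lambda>s. F (lin p d s)) 0" for p d
    using Suc.prems by (intro deriv_cmult) (auto simp: field_differentiable_def real_differentiable_def)
  then show ?case
    using Suc by (auto intro: continuous_intros)
qed

lemma gCk_sum: "finite S \<Longrightarrow> (\<And>i. i \<in> S \<Longrightarrow> gCk lin k (F i)) \<Longrightarrow> gCk lin k (\<lambda>p. \<Sum>i\<in>S. F i p)"
  by (induction S rule: finite_induct) (auto intro: gCk_const gCk_add)

lemma gCk_coordinate: "gCk flin k (\<lambda>w. w i)"
proof (cases k)
  case (Suc m)
  have "deriv (\<lambda>s. flin w d s i) 0 = d i" for w d
    by (intro DERIV_imp_deriv) (auto simp: flin_def intro!: derivative_eq_intros)
  then show ?thesis using Suc by (auto simp: gCk_const flin_def)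
qed auto

lemma gCk_Dd: "gCk flin (Suc k) F \<Longrightarrow> gCk flin k (\<lambda>w. Dd F w d)"
  by (simp add: Dd_def)

lemma gCk_pd: "gCk flin (Suc k) F \<Longrightarrow> gCk flin k (pd i F)"
  using gCk_Dd[of k F "\<lambda>j. if j = i then 1 else 0"] by (simp add: pd_def[abs_def])

lemma DERIV_Dd:
  assumes "gCk flin (Suc k) F"
  shows "((\<lambda>s. F (flin w d s)) has_real_derivative Dd F w d) (at 0)"
proof -
  have "(\<lambda>s. F (flin w d s)) differentiable (at 0)"
    using assms by auto
  then show ?thesis unfolding Dd_def by (simp add: DERIV_deriv_iff_real_differentiable)
qed

lemma DERIV_pd:
  assumes "gCk flin (Suc k) F"
  shows "((\<lambda>s. F (w(i := s))) has_real_derivative pd i F (w(i := s0))) (at s0)"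
proof -
  have "flin (w(i := s0)) (\<lambda>j. if j = i then 1 else 0) s = w(i := s + s0)" for s
    by (auto simp: flin_def)
  then show ?thesis
    using DERIV_Dd[OF assms, of "w(i := s0)" "\<lambda>j. if j = i then 1 else 0"]
      DERIV_shift[of "\<lambda>s. F (w(i := s))" "pd i F (w(i := s0))" 0 s0]
    by (simp add: pd_def)
qed

lemma tendsto_coordinatewise:
  fixes f :: "'a \<Rightarrow> 'i \<Rightarrow> real"
  assumes "\<And>i. ((\<lambda>x. f x i) \<longlongrightarrow> l i) F"
  shows "(f \<longlongrightarrow> l) F"
  using assms limitin_componentwise[of "\<lambda>_. euclidean :: real topology" UNIV f l F]
  by (auto simp: euclidean_product_topology)

text \<open>\<open>gCk\<close> only provides derivatives along lines, on a space with possibly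
  infinitely many coordinates. The total derivative is built by adding one moving coordinate at a
  time: a function of two blocks is differentiable as soon as it is so in the old block and has a
  jointly continuous partial derivative in the new one.\<close>

lemma gCk_chain:
  fixes \<phi> :: "'i \<Rightarrow> 'a::real_normed_vector \<Rightarrow> real"
  assumes F: "gCk flin (Suc k) F" and "finite I"
    and "\<And>i. i \<in> I \<Longrightarrow> (\<phi> i has_derivative \<phi>' i) (at p)"
  shows "((\<lambda>p. F (\<lambda>i. if i \<in> I then \<phi> i p else c i)) has_derivative
          (\<lambda>e. \<Sum>i\<in>I. pd i F (\<lambda>i. if i \<in> I then \<phi> i p else c i) * \<phi>' i e)) (at p)"
  using assms(2,3)
proof (induction I arbitrary: c rule: finite_induct)
  case empty
  then show ?case by simp
next
  case (insert j I)
  \<comment> \<open>The value \<open>s\<close> of the new coordinate \<open>j\<close> is detached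
    from the point \<open>p\<close> that drives the coordinates in \<open>I\<close>.\<close>
  define W where "W = (\<lambda>p s i. if i \<in> I then \<phi> i p else if i = j then s else c i)"
  define W0 where "W0 = (\<lambda>i. if i \<in> insert j I then \<phi> i p else c i)"
  have W0: "W p (\<phi> j p) = W0" using insert.hyps by (auto simp: W_def W0_def)
  have upd: "W q s = (W q s')(j := s)" for q s s'
    using insert.hyps by (auto simp: W_def)
  have d1: "((\<lambda>q. F (W q (\<phi> j p))) has_derivative (\<lambda>e. \<Sum>i\<in>I. pd i F W0 * \<phi>' i e)) (at p)"
    using insert.IH[of "c(j := \<phi> j p)"] insert.prems insert.hyps
    by (simp add: W_def W0[symmetric] cong: if_cong)
  have d2: "((\<lambda>s. F (W q s)) has_derivative blinfun_apply (blinfun_scaleR_left (pd j F (W q s)))) (at s within UNIV)" for q s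
    using DERIV_pd[OF F, of "W q s" j s]
    by (subst upd[of _ _ s]) (auto simp: has_field_derivative_def upd[of q s s, symmetric] mult.commute[of _ "pd j F _"])
  have contpd: "continuous_on UNIV (pd j F)"
    using gCk_pd[OF F] gCk_imp_continuous by blast
  have contphi: "(\<phi> i \<longlongrightarrow> \<phi> i p) (nhds p)" if "i \<in> insert j I" for i
    using insert.prems[OF that] has_derivative_continuous isCont_def
    by (metis tendsto_at_iff_tendsto_nhds)
  have tW: "((\<lambda>x. W (fst x) (snd x)) \<longlongrightarrow> W p (\<phi> j p)) (at (p, \<phi> j p))"
  proof (rule tendsto_coordinatewise)
    fix i
    have a: "((\<lambda>x. \<phi> i (fst x)) \<longlongrightarrow> \<phi> i p) (at (p, \<phi> j p))" if "i \<in> I"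
    proof -
      have "(fst \<longlongrightarrow> p) (at (p, \<phi> j p))"
        using tendsto_fst[OF tendsto_ident_at, of "(p, \<phi> j p)" UNIV] by simp
      then show ?thesis using filterlim_compose contphi[of i] that by blast
    qed
    have b: "(snd \<longlongrightarrow> \<phi> j p) (at (p, \<phi> j p))"
      using tendsto_snd[OF tendsto_ident_at, of "(p, \<phi> j p)" UNIV] by simp
    show "((\<lambda>x. W (fst x) (snd x) i) \<longlongrightarrow> W p (\<phi> j p) i) (at (p, \<phi> j p))"
      using a b by (auto simp: W_def)
  qed
  have "((\<lambda>x. pd j F (W (fst x) (snd x))) \<longlongrightarrow> pd j F W0) (at (p, \<phi> j p))"
    using continuous_on_tendsto_compose[OF contpd tW] by (auto simp: W0)
  then have "((\<lambda>x. blinfun_scaleR_left (pd j F (W (fst x) (snd x)) :: real)) \<longlongrightarrow> blinfun_scaleR_left (pd j F W0)) (at (p, \<phi> j p))"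
    by (rule bounded_linear.tendsto[OF bounded_linear_blinfun_scaleR_left])
  then have c: "continuous (at (p, \<phi> j p) within UNIV \<times> UNIV) (\<lambda>(q, s). blinfun_scaleR_left (pd j F (W q s)) :: real \<Rightarrow>\<^sub>L real)"
    by (simp add: continuous_within case_prod_unfold W0 UNIV_Times_UNIV)
  have "((\<lambda>(q, s). F (W q s)) has_derivative
      (\<lambda>(tx, ty). (\<Sum>i\<in>I. pd i F W0 * \<phi>' i tx) + blinfun_scaleR_left (pd j F (W p (\<phi> j p))) ty)) (at (p, \<phi> j p) within UNIV \<times> UNIV)"
    by (rule has_derivative_partialsI[OF _ d2 c]) (use d1 in auto)
  then have h: "((\<lambda>(q, s). F (W q s)) has_derivative
      (\<lambda>(tx, ty). (\<Sum>i\<in>I. pd i F W0 * \<phi>' i tx) + pd j F W0 * ty)) (at (p, \<phi> j p))"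
    by (simp add: W0 UNIV_Times_UNIV mult.commute[of _ "pd j F W0"] case_prod_unfold)
  have "((\<lambda>q. (q, \<phi> j q)) has_derivative (\<lambda>e. (e, \<phi>' j e))) (at p)"
    using insert.prems[of j] by (auto intro!: derivative_eq_intros)
  from has_derivative_compose[OF this, of "\<lambda>(q, s). F (W q s)", OF h]
  have "((\<lambda>q. F (W q (\<phi> j q))) has_derivative
      (\<lambda>e. (\<Sum>i\<in>I. pd i F W0 * \<phi>' i e) + pd j F W0 * \<phi>' j e)) (at p)"
    by simp
  moreover have "W q (\<phi> j q) = (\<lambda>i. if i \<in> insert j I then \<phi> i q else c i)" for q
    using insert.hyps by (auto simp: W_def)
  ultimately show ?case
    using insert.hyps by (simp add: W0_def add.commute cong: if_cong)
qed

section \<open>Continuous differentiability near a point\<close>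

lemma gCk_chain':
  fixes \<omega> :: "'a::real_normed_vector \<Rightarrow> 'i \<Rightarrow> real"
  assumes F: "gCk flin (Suc k) F" and "finite I"
    and "\<And>i. i \<in> I \<Longrightarrow> ((\<lambda>q. \<omega> q i) has_derivative \<omega>' i) (at p)"
    and "\<And>q i. i \<notin> I \<Longrightarrow> \<omega> q i = c i"
  shows "((\<lambda>q. F (\<omega> q)) has_derivative (\<lambda>e. \<Sum>i\<in>I. pd i F (\<omega> p) * \<omega>' i e)) (at p)"
proof -
  have "(\<lambda>i. if i \<in> I then \<omega> q i else c i) = \<omega> q" for q
    using assms(4) by auto
  then show ?thesis
    using gCk_chain[OF F assms(2), of "\<lambda>i q. \<omega> q i" \<omega>' p c] assms(3) by simp
qed

text \<open>Linearity in the direction is not part of the definition of \<open>gCk\<close>; it comes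
  out of the chain rule applied to the line itself.\<close>

lemma Dd_eq_sum_pd:
  assumes F: "gCk flin (Suc k) F" and "finite I" and "\<And>i. i \<notin> I \<Longrightarrow> d i = 0"
  shows "Dd F w d = (\<Sum>i\<in>I. d i * pd i F w)"
proof -
  have "((\<lambda>s. F (flin w d s)) has_derivative (\<lambda>e. \<Sum>i\<in>I. pd i F (flin w d 0) * (e * d i))) (at 0)"
    by (rule gCk_chain'[OF F assms(2), where c = w])
      (use assms(3) in \<open>auto simp: flin_def intro!: derivative_eq_intros\<close>)
  moreover have "flin w d 0 = w" by (simp add: flin_def)
  moreover have "(\<lambda>e. \<Sum>i\<in>I. pd i F w * (e * d i)) = (*) (\<Sum>i\<in>I. d i * pd i F w)"
    by (auto simp: fun_eq_iff sum_distrib_left mult_ac)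
  ultimately have "((\<lambda>s. F (flin w d s)) has_real_derivative (\<Sum>i\<in>I. d i * pd i F w)) (at 0)"
    by (simp add: has_field_derivative_def)
  with DERIV_Dd[OF F, of w d] show ?thesis by (rule DERIV_unique)
qed

text \<open>Curved motion is needed for trajectories generated by the nonlinear dynamics; only the
  velocity at \<open>s0\<close> enters.\<close>

lemma gCk_curve:
  fixes \<omega> :: "real \<Rightarrow> 'i \<Rightarrow> real"
  assumes F: "gCk flin (Suc k) F" and "finite I"
    and "\<And>i. i \<in> I \<Longrightarrow> ((\<lambda>s. \<omega> s i) has_real_derivative d i) (at s0)"
    and "\<And>s i. i \<notin> I \<Longrightarrow> \<omega> s i = c i" and "\<And>i. i \<notin> I \<Longrightarrow> d i = 0"
  shows "((\<lambda>s. F (\<omega> s)) has_real_derivative Dd F (\<omega> s0) d) (at s0)"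
proof -
  have "((\<lambda>s. F (\<omega> s)) has_derivative (\<lambda>e. \<Sum>i\<in>I. pd i F (\<omega> s0) * (d i * e))) (at s0)"
    by (rule gCk_chain'[OF F assms(2)]) (use assms(3,4) in \<open>auto simp: has_field_derivative_def\<close>)
  moreover have "(\<lambda>e. \<Sum>i\<in>I. pd i F (\<omega> s0) * (d i * e)) = (*) (\<Sum>i\<in>I. d i * pd i F (\<omega> s0))"
    by (auto simp: fun_eq_iff sum_distrib_left mult_ac)
  ultimately show ?thesis
    by (simp add: has_field_derivative_def Dd_eq_sum_pd[OF F assms(2,5)])
qed

section \<open>Rules for directional derivatives, and the calculus of C1 germs\<close>

lemma Dd_cong_line: "(\<And>s. F (flin w d s) = G (flin w d s)) \<Longrightarrow> Dd F w d = Dd G w d"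
  by (simp add: Dd_def)

lemma Dd_add:
  assumes "gCk flin (Suc k) F" "gCk flin (Suc m) G"
  shows "Dd (\<lambda>w. F w + G w) w d = Dd F w d + Dd G w d"
  using DERIV_add[OF DERIV_Dd[OF assms(1)] DERIV_Dd[OF assms(2)], of w d w d]
  by (auto simp: Dd_def intro: DERIV_imp_deriv)

lemma Dd_cmult:
  assumes "gCk flin (Suc k) F"
  shows "Dd (\<lambda>w. c * F w) w d = c * Dd F w d"
  using DERIV_cmult[OF DERIV_Dd[OF assms], of c w d]
  by (auto simp: Dd_def intro: DERIV_imp_deriv)

lemma Dd_const [simp]: "Dd (\<lambda>w. c) w d = 0"
  by (simp add: Dd_def)

lemma Dd_sum:
  assumes "finite S" "\<And>i. i \<in> S \<Longrightarrow> gCk flin (Suc k) (F i)"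
  shows "Dd (\<lambda>w. \<Sum>i\<in>S. F i w) w d = (\<Sum>i\<in>S. Dd (F i) w d)"
  using assms
proof (induction S rule: finite_induct)
  case (insert i S)
  then have "Dd (\<lambda>w. F i w + (\<Sum>i\<in>S. F i w)) w d = Dd (F i) w d + Dd (\<lambda>w. \<Sum>i\<in>S. F i w) w d"
    by (intro Dd_add[of k _ k]) (auto intro!: gCk_sum simp del: gCk.simps)
  then show ?case using insert by simp
qed simp

lemma Dd_coordinate: "Dd (\<lambda>w. w i) w d = d i"
  unfolding Dd_def by (intro DERIV_imp_deriv) (auto simp: flin_def intro!: derivative_eq_intros)

text \<open>The derivative is represented by a gradient vector, so its continuity is ordinary
  continuity of a map into the Euclidean space. The open set makes the property spread to
  neighbouring points.\<close>

definition C1_at :: "('a::euclidean_space \<Rightarrow> real) \<Rightarrow> 'a \<Rightarrow> bool" where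
  "C1_at f p0 \<longleftrightarrow> (\<exists>U G. open U \<and> p0 \<in> U \<and>
     (\<forall>p\<in>U. (f has_derivative (\<lambda>e. G p \<bullet> e)) (at p)) \<and> continuous_on U G)"

lemma C1_atI:
  assumes "open U" "p0 \<in> U" "\<And>p. p \<in> U \<Longrightarrow> (f has_derivative (\<lambda>e. G p \<bullet> e)) (at p)" "continuous_on U G"
  shows "C1_at f p0"
  using assms unfolding C1_at_def by blast

lemma C1_atE:
  assumes "C1_at f p0"
  obtains U G where "open U" "p0 \<in> U" "\<And>p. p \<in> U \<Longrightarrow> (f has_derivative (\<lambda>e. G p \<bullet> e)) (at p)" "continuous_on U G"
  using assms unfolding C1_at_def by blast

lemma C1_at_isCont: "C1_at f p0 \<Longrightarrow> isCont f p0"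
  by (metis C1_atE has_derivative_continuous)

lemma C1_at_eventually: "C1_at f p0 \<Longrightarrow> \<forall>\<^sub>F p in nhds p0. C1_at f p"
  by (auto simp: C1_at_def eventually_nhds)

lemma C1_at_differentiable: "C1_at f p0 \<Longrightarrow> f differentiable (at p0)"
  by (auto simp: C1_at_def differentiable_def)

lemma C1_at_has_derivative: "C1_at f p0 \<Longrightarrow> (f has_derivative frechet_derivative f (at p0)) (at p0)"
  using C1_at_differentiable frechet_derivative_works by blast

lemma C1_at_isCont_frechet:
  assumes "C1_at f p0"
  shows "isCont (\<lambda>p. frechet_derivative f (at p) e) p0"
proof -
  obtain U G where U: "open U" "p0 \<in> U" "\<And>p. p \<in> U \<Longrightarrow> (f has_derivative (\<lambda>e. G p \<bullet> e)) (at p)" "continuous_on U G"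
    using assms unfolding C1_at_def by blast
  have "frechet_derivative f (at p) e = G p \<bullet> e" if "p \<in> U" for p
    using U(3)[OF that] frechet_derivative_at by metis
  then have "continuous_on U (\<lambda>p. frechet_derivative f (at p) e)"
    using U(4) by (auto intro!: continuous_intros cong: continuous_on_cong)
  then show ?thesis using U continuous_on_eq_continuous_at by blast
qed

lemma C1_at_const [simp]: "C1_at (\<lambda>_. c) p0"
  by (rule C1_atI[of UNIV _ _ "\<lambda>_. 0"]) auto

text \<open>Riesz representation with the representing vector written out in the basis.\<close>

lemma bounded_linear_eq_inner:
  fixes f :: "'a::euclidean_space \<Rightarrow> real"
  assumes "bounded_linear f"
  shows "(\<Sum>b\<in>Basis. f b *\<^sub>R b) \<bullet> e = f e"
proof -
  interpret bounded_linear f by fact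
  have "f e = f (\<Sum>b\<in>Basis. (e \<bullet> b) *\<^sub>R b)" by (simp add: euclidean_representation)
  also have "\<dots> = (\<Sum>b\<in>Basis. (e \<bullet> b) * f b)" by (simp add: sum scaleR)
  also have "\<dots> = (\<Sum>b\<in>Basis. f b *\<^sub>R b) \<bullet> e"
    unfolding inner_sum_left by (intro sum.cong) (auto simp: inner_commute)
  finally show ?thesis ..
qed

lemma C1_at_linear:
  assumes "bounded_linear f"
  shows "C1_at f p0"
proof (rule C1_atI[of UNIV])
  show "(f has_derivative (\<lambda>e. (\<Sum>b\<in>Basis. f b *\<^sub>R b) \<bullet> e)) (at p)" for p
    unfolding bounded_linear_eq_inner[OF assms] by (rule bounded_linear_imp_has_derivative[OF assms])
qed auto

text \<open>\<open>A\<close> and \<open>B\<close> are the partial derivatives of the operation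
  \<open>h\<close>; sums, differences and products are instances.\<close>

lemma C1_at_binop:
  fixes f g :: "'a::euclidean_space \<Rightarrow> real"
  assumes "C1_at f p0" "C1_at g p0"
    and h: "\<And>p f' g'. (f has_derivative f') (at p) \<Longrightarrow> (g has_derivative g') (at p) \<Longrightarrow> 
       ((\<lambda>p. h (f p) (g p)) has_derivative (\<lambda>e. A (f p) (g p) * f' e + B (f p) (g p) * g' e)) (at p)"
    and A: "continuous_on UNIV (\<lambda>z. A (fst z) (snd z))" and B: "continuous_on UNIV (\<lambda>z. B (fst z) (snd z))"
  shows "C1_at (\<lambda>p. h (f p) (g p)) p0"
proof -
  obtain U F where U: "open U" "p0 \<in> U" "\<And>p. p \<in> U \<Longrightarrow> (f has_derivative (\<lambda>e. F p \<bullet> e)) (at p)" "continuous_on U F"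
    using assms(1) unfolding C1_at_def by blast
  obtain V G where V: "open V" "p0 \<in> V" "\<And>p. p \<in> V \<Longrightarrow> (g has_derivative (\<lambda>e. G p \<bullet> e)) (at p)" "continuous_on V G"
    using assms(2) unfolding C1_at_def by blast
  have cf: "continuous_on U f" "continuous_on V g"
    using U V by (auto intro!: continuous_at_imp_continuous_on has_derivative_continuous)
  have [continuous_intros]: "continuous_on (U \<inter> V) f" "continuous_on (U \<inter> V) g" "continuous_on (U \<inter> V) F" "continuous_on (U \<inter> V) G"
    using cf U V by (auto intro: continuous_on_subset)
  have AB: "continuous_on (U \<inter> V) (\<lambda>p. A (f p) (g p))" "continuous_on (U \<inter> V) (\<lambda>p. B (f p) (g p))"
    using continuous_on_compose2[OF A, of "U \<inter> V" "\<lambda>p. (f p, g p)"]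
      continuous_on_compose2[OF B, of "U \<inter> V" "\<lambda>p. (f p, g p)"]
    by (auto intro!: continuous_intros)
  show ?thesis
  proof (rule C1_atI)
    show "((\<lambda>p. h (f p) (g p)) has_derivative (\<lambda>e. (A (f p) (g p) *\<^sub>R F p + B (f p) (g p) *\<^sub>R G p) \<bullet> e)) (at p)"
      if "p \<in> U \<inter> V" for p
      using h[OF U(3) V(3), of p] that by (auto simp: inner_add_left)
    show "continuous_on (U \<inter> V) (\<lambda>p. A (f p) (g p) *\<^sub>R F p + B (f p) (g p) *\<^sub>R G p)"
      using AB by (auto intro!: continuous_intros)
  qed (use U V in auto)
qed

lemma C1_at_add: "C1_at f p0 \<Longrightarrow> C1_at g p0 \<Longrightarrow> C1_at (\<lambda>p. f p + g p) p0"
  by (rule C1_at_binop[where A = "\<lambda>_ _. 1" and B = "\<lambda>_ _. 1"]) (auto intro!: derivative_eq_intros)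

lemma C1_at_diff: "C1_at f p0 \<Longrightarrow> C1_at g p0 \<Longrightarrow> C1_at (\<lambda>p. f p - g p) p0"
  by (rule C1_at_binop[where A = "\<lambda>_ _. 1" and B = "\<lambda>_ _. -1"]) (auto intro!: derivative_eq_intros)

lemma C1_at_mult: "C1_at f p0 \<Longrightarrow> C1_at g p0 \<Longrightarrow> C1_at (\<lambda>p. f p * g p) p0"
  by (rule C1_at_binop[where A = "\<lambda>x y. y" and B = "\<lambda>x y. x"]) (auto intro!: derivative_eq_intros continuous_intros)

lemma C1_at_minus: "C1_at f p0 \<Longrightarrow> C1_at (\<lambda>p. - f p) p0"
  using C1_at_diff[of "\<lambda>_. 0" p0 f] by simp

lemma C1_at_sum: "(\<And>i. i \<in> S \<Longrightarrow> C1_at (f i) p0) \<Longrightarrow> C1_at (\<lambda>p. \<Sum>i\<in>S. f i p) p0"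
  by (induction S rule: infinite_finite_induct) (auto intro: C1_at_add)

lemma C1_at_inverse:
  assumes "C1_at f p0" "f p0 \<noteq> 0"
  shows "C1_at (\<lambda>p. inverse (f p)) p0"
proof -
  obtain U F where U: "open U" "p0 \<in> U" "\<And>p. p \<in> U \<Longrightarrow> (f has_derivative (\<lambda>e. F p \<bullet> e)) (at p)" "continuous_on U F"
    using assms(1) unfolding C1_at_def by blast
  have cf: "continuous_on U f"
    using U by (auto intro!: continuous_at_imp_continuous_on has_derivative_continuous)
  have o: "open (U \<inter> f -` (- {0}))"
    using continuous_open_preimage[OF cf U(1), of "- {0}"] by auto
  show ?thesis
  proof (rule C1_atI[OF o])
    show "((\<lambda>p. inverse (f p)) has_derivative (\<lambda>e. (- (inverse (f p) * inverse (f p)) *\<^sub>R F p) \<bullet> e)) (at p)"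
      if "p \<in> U \<inter> f -` (- {0})" for p
      using that by (auto intro!: derivative_eq_intros U(3) simp: mult_ac)
    show "continuous_on (U \<inter> f -` (- {0})) (\<lambda>p. - (inverse (f p) * inverse (f p)) *\<^sub>R F p)"
      using continuous_on_subset[OF cf] continuous_on_subset[OF U(4)]
      by (auto intro!: continuous_intros)
  qed (use U assms in auto)
qed

lemma C1_at_divide: "C1_at f p0 \<Longrightarrow> C1_at g p0 \<Longrightarrow> g p0 \<noteq> 0 \<Longrightarrow> C1_at (\<lambda>p. f p / g p) p0"
  by (simp add: divide_inverse C1_at_mult C1_at_inverse)

text \<open>The gradient of the composite is the gradient of \<open>f\<close> pulled back by the
  adjoint of \<open>L\<close>.\<close>

lemma C1_at_compose_affine:
  assumes L: "bounded_linear L" and f: "C1_at f (L p0 + c)"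
  shows "C1_at (\<lambda>p. f (L p + c)) p0"
proof -
  obtain U F where U: "open U" "L p0 + c \<in> U" "\<And>p. p \<in> U \<Longrightarrow> (f has_derivative (\<lambda>e. F p \<bullet> e)) (at p)" "continuous_on U F"
    using f unfolding C1_at_def by blast
  have cL: "continuous_on UNIV (\<lambda>p. L p + c)" using L linear_continuous_on by (intro continuous_intros) blast
  have dL: "((\<lambda>p. L p + c) has_derivative L) (at p)" for p
    using bounded_linear_imp_has_derivative[OF L] by (auto intro!: derivative_eq_intros)
  show ?thesis
  proof (rule C1_atI)
    show "open ((\<lambda>p. L p + c) -` U)" using U(1) cL by (simp add: open_vimage)
    show "((\<lambda>p. f (L p + c)) has_derivative (\<lambda>e. adjoint L (F (L p + c)) \<bullet> e)) (at p)" if "p \<in> (\<lambda>p. L p + c) -` U" for p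
      using has_derivative_compose[OF dL U(3)[of "L p + c"]] that
      by (simp add: adjoint_works[OF bounded_linear.linear[OF L]] inner_commute)
    have "bounded_linear (adjoint L)"
      using L adjoint_linear bounded_linear.linear linear_conv_bounded_linear by blast
    then show "continuous_on ((\<lambda>p. L p + c) -` U) (\<lambda>p. adjoint L (F (L p + c)))"
      by (rule bounded_linear.continuous_on)
        (auto intro!: continuous_on_compose2[OF U(4)] continuous_on_subset[OF cL])
  qed (use U in auto)
qed

lemma C1_at_compose_linear:
  "bounded_linear L \<Longrightarrow> C1_at f (L p0) \<Longrightarrow> C1_at (\<lambda>p. f (L p)) p0"
  using C1_at_compose_affine[of L f p0 0] by simp

lemma C1_at_gCk:
  fixes \<omega> :: "'a::euclidean_space \<Rightarrow> 'i \<Rightarrow> real"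
  assumes F: "gCk flin (Suc k) F" and "finite I"
    and "\<And>i. i \<in> I \<Longrightarrow> C1_at (\<lambda>q. \<omega> q i) p0"
    and c: "\<And>q i. i \<notin> I \<Longrightarrow> \<omega> q i = c i"
  shows "C1_at (\<lambda>q. F (\<omega> q)) p0"
proof -
  have "\<forall>i\<in>I. \<exists>U G. open U \<and> p0 \<in> U \<and>
     (\<forall>p\<in>U. ((\<lambda>q. \<omega> q i) has_derivative (\<lambda>e. G p \<bullet> e)) (at p)) \<and> continuous_on U G"
    using assms(3) by (simp add: C1_at_def)
  then obtain U G where U: "\<And>i. i \<in> I \<Longrightarrow> open (U i) \<and> p0 \<in> U i \<and>
     (\<forall>p\<in>U i. ((\<lambda>q. \<omega> q i) has_derivative (\<lambda>e. G i p \<bullet> e)) (at p)) \<and> continuous_on (U i) (G i)"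
    unfolding bchoice_iff by blast
  define V where "V = (\<Inter>i\<in>I. U i)"
  have V: "open V" "p0 \<in> V" using U assms(2) by (auto simp: V_def)
  have der: "((\<lambda>q. \<omega> q i) has_derivative (\<lambda>e. G i p \<bullet> e)) (at p)" if "i \<in> I" "p \<in> V" for i p
    using U that by (auto simp: V_def)
  have contG: "continuous_on V (G i)" if "i \<in> I" for i
    using U[OF that] that by (auto simp: V_def intro: continuous_on_subset)
  have "continuous_on V (\<lambda>q. \<omega> q i)" for i
  proof (cases "i \<in> I")
    case True
    then show ?thesis
      using der by (intro continuous_at_imp_continuous_on ballI has_derivative_continuous) auto
  qed (simp add: c)
  then have cont: "continuous_on V \<omega>" by (rule continuous_on_coordinatewise_then_product)
  have contpd: "continuous_on V (\<lambda>p. pd i F (\<omega> p))" for i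
    by (rule continuous_on_compose2[OF _ cont]) (use gCk_pd[OF F] gCk_imp_continuous in auto)
  show ?thesis
  proof (rule C1_atI[OF V])
    show "((\<lambda>q. F (\<omega> q)) has_derivative (\<lambda>e. (\<Sum>i\<in>I. pd i F (\<omega> p) *\<^sub>R G i p) \<bullet> e)) (at p)"
      if "p \<in> V" for p
    proof -
      have "((\<lambda>q. F (\<omega> q)) has_derivative (\<lambda>e. \<Sum>i\<in>I. pd i F (\<omega> p) * (G i p \<bullet> e))) (at p)"
        by (rule gCk_chain'[OF F assms(2)]) (use der that c in auto)
      then show ?thesis by (simp add: inner_sum_left)
    qed
    show "continuous_on V (\<lambda>p. \<Sum>i\<in>I. pd i F (\<omega> p) *\<^sub>R G i p)"
      using contpd contG by (auto intro!: continuous_intros)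
  qed
qed

lemma C1_on_imp_C1_at:
  fixes f :: "'a::euclidean_space \<Rightarrow> 'b::euclidean_space"
  assumes "C1_on U f" "open U" "p0 \<in> U"
  shows "C1_at (\<lambda>p. f p \<bullet> b) p0"
proof -
  obtain D where D: "\<And>p. p \<in> U \<Longrightarrow> (f has_derivative blinfun_apply (D p)) (at p)" "continuous_on U D"
    using assms(1) by (auto simp: C1_on_def)
  show ?thesis
  proof (rule C1_atI[OF assms(2,3), where G = "\<lambda>p. \<Sum>a\<in>Basis. (D p a \<bullet> b) *\<^sub>R a"])
    fix p assume p: "p \<in> U"
    have "bounded_linear (\<lambda>e. D p e \<bullet> b)"
      by (intro bounded_linear_inner_left_comp blinfun.bounded_linear_right)
    then show "((\<lambda>p. f p \<bullet> b) has_derivative (\<lambda>e. (\<Sum>a\<in>Basis. (D p a \<bullet> b) *\<^sub>R a) \<bullet> e)) (at p)"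
      using has_derivative_inner_left[OF D(1)[OF p], of b] by (simp only: bounded_linear_eq_inner)
  next
    show "continuous_on U (\<lambda>p. \<Sum>a\<in>Basis. (D p a \<bullet> b) *\<^sub>R a)"
      using D(2) by (auto intro!: continuous_intros)
  qed
qed

lemma has_derivative_eventually_zero:
  assumes "(f has_derivative f') (at p)" "\<forall>\<^sub>F q in nhds p. f q = (0::real)"
  shows "f' e = 0"
proof -
  have "f p = 0" "\<forall>\<^sub>F q in at p. f q = 0"
    using assms(2) eventually_nhds_x_imp_x by (auto simp: eventually_at_filter elim: eventually_mono)
  then have "((\<lambda>_. 0) has_derivative f') (at p)"
    using has_derivative_transform_eventually[OF assms(1), of "\<lambda>_. 0"] by auto
  then have "f' = (\<lambda>_. 0)" using has_derivative_unique has_derivative_const by blast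
  then show ?thesis by simp
qed

text \<open>The system may be overdetermined, and nothing is said about its solvability away from
  \<open>p0\<close>: injectivity at \<open>p0\<close> alone forces every solution that exists nearby
  to be the value of a C1 function.\<close>

lemma C1_solve:
  fixes a :: "'i \<Rightarrow> 'j \<Rightarrow> 'p::euclidean_space \<Rightarrow> real"
  assumes "finite J"
    and "\<And>i j. i \<in> I \<Longrightarrow> j \<in> J \<Longrightarrow> C1_at (a i j) p0"
    and "\<And>i. i \<in> I \<Longrightarrow> C1_at (b i) p0"
    and "\<And>x. (\<And>i. i \<in> I \<Longrightarrow> (\<Sum>j\<in>J. a i j p0 * x j) = 0) \<Longrightarrow> (\<forall>j\<in>J. x j = 0)"
  obtains z where "\<And>j. j \<in> J \<Longrightarrow> C1_at (z j) p0"
    and "\<forall>\<^sub>F p in nhds p0. \<forall>x. (\<forall>i\<in>I. (\<Sum>j\<in>J. a i j p * x j) = b i p) \<longrightarrow> (\<forall>j\<in>J. x j = z j p)"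
proof -
  have "\<exists>z. (\<forall>j\<in>J. C1_at (z j) p0) \<and>
     (\<forall>\<^sub>F p in nhds p0. \<forall>x. (\<forall>i\<in>I. (\<Sum>j\<in>J. a i j p * x j) = b i p) \<longrightarrow> (\<forall>j\<in>J. x j = z j p))"
    by (rule linear_solve_class[where Q = "\<lambda>f. C1_at f p0"])
      (use assms in \<open>auto intro: C1_at_diff C1_at_mult C1_at_inverse C1_at_isCont\<close>)
  then show ?thesis using that by blast
qed

section \<open>Perturbed KKT systems\<close>

text \<open>A nonzero value would persist near \<open>p0\<close>, where points satisfying
  \<open>P\<close> still occur. It carries equations valid for \<gamma> > 0 to the boundary \<gamma>
  = 0.\<close>

lemma frequently_eq_at_isCont:
  fixes f :: "'a::t2_space \<Rightarrow> real"
  assumes "isCont f p0" "\<exists>\<^sub>F p in nhds p0. P p" "\<forall>\<^sub>F p in nhds p0. P p \<longrightarrow> f p = 0"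
  shows "f p0 = 0"
proof (rule ccontr)
  assume "f p0 \<noteq> 0"
  then have "\<forall>\<^sub>F p in nhds p0. f p \<noteq> 0"
    using assms(1) by (metis isCont_def t1_space_nhds tendsto_at_iff_tendsto_nhds tendsto_imp_eventually_ne)
  with assms(3) have "\<forall>\<^sub>F p in nhds p0. \<not> P p" by eventually_elim auto
  with assms(2) show False by (simp add: frequently_def)
qed

text \<open>In a nonlinear program with objective \<open>c0\<close> and unknowns in \<open>J\<close>, the constraints in \<open>KE\<close> are
  kept exactly, those in \<open>KH\<close> are penalised and those in \<open>KG\<close> carry a logarithmic barrier.\<close>

definition barrier_stationary ::
  "'i set \<Rightarrow> 'k set \<Rightarrow> 'k set \<Rightarrow> 'k set \<Rightarrow> (('i \<Rightarrow> real) \<Rightarrow> real) \<Rightarrow> ('k \<Rightarrow> ('i \<Rightarrow> real) \<Rightarrow> real) \<Rightarrow> real \<Rightarrow> ('i \<Rightarrow> real) \<Rightarrow> bool" where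
  "barrier_stationary J KE KH KG c0 c \<gamma> w \<longleftrightarrow> (\<forall>k\<in>KE. c k w = 0) \<and> (\<forall>k\<in>KG. c k w < 0) \<and>
     (\<exists>\<mu>. \<forall>j\<in>J. pd j c0 w + (\<Sum>k\<in>KE. \<mu> k * pd j (c k) w) + (\<Sum>k\<in>KH. c k w / \<gamma> * pd j (c k) w)
        + (\<Sum>k\<in>KG. - \<gamma> / c k w * pd j (c k) w) = 0)"

text \<open>By strict complementarity the critical cone of the second-order condition is a subspace.\<close>

definition strict_KKT ::
  "'i set \<Rightarrow> 'k set \<Rightarrow> 'k set \<Rightarrow> 'k set \<Rightarrow> (('i \<Rightarrow> real) \<Rightarrow> real) \<Rightarrow> ('k \<Rightarrow> ('i \<Rightarrow> real) \<Rightarrow> real) \<Rightarrow> ('i \<Rightarrow> real) \<Rightarrow> ('k \<Rightarrow> real) \<Rightarrow> bool" where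
  "strict_KKT J KE KH KG c0 c w y \<longleftrightarrow> (let K = KE \<union> KH \<union> KG; Ka = KE \<union> KH \<union> {k\<in>KG. c k w = 0} in
     (\<forall>j\<in>J. pd j c0 w + (\<Sum>k\<in>K. y k * pd j (c k) w) = 0) \<and>
     (\<forall>k\<in>KG. y k * c k w = 0) \<and> (\<forall>k\<in>KG. c k w = 0 \<longrightarrow> y k > 0) \<and>
     (\<forall>z. (\<forall>j\<in>J. (\<Sum>k\<in>Ka. z k * pd j (c k) w) = 0) \<longrightarrow> (\<forall>k\<in>Ka. z k = 0)) \<and>
     (\<forall>d. (\<exists>j\<in>J. d j \<noteq> 0) \<longrightarrow> (\<forall>k\<in>Ka. (\<Sum>j\<in>J. pd j (c k) w * d j) = 0) \<longrightarrow>
        (\<Sum>j\<in>J. d j * (\<Sum>i\<in>J. (pd i (pd j c0) w + (\<Sum>k\<in>K. y k * pd i (pd j (c k)) w)) * d i)) > 0))"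

text \<open>\<open>\<omega> p\<close> collects the unknowns (in \<open>J\<close>) and the parameters of the program (in \<open>\<Theta>\<close>).\<close>

locale perturbed_nlp =
  fixes J \<Theta> :: "'i set" and KE KH KG :: "'k set"
    and c0 :: "('i \<Rightarrow> real) \<Rightarrow> real" and c :: "'k \<Rightarrow> ('i \<Rightarrow> real) \<Rightarrow> real"
    and \<omega> :: "'p::euclidean_space \<Rightarrow> 'i \<Rightarrow> real" and \<gamma> :: "'p \<Rightarrow> real" and p0 :: 'p
    and y0 :: "'k \<Rightarrow> real" and cc :: "'i \<Rightarrow> real"
  assumes fin: "finite J" "finite \<Theta>" "finite KE" "finite KH" "finite KG"
    and disj: "J \<inter> \<Theta> = {}" "KE \<inter> KH = {}" "KE \<inter> KG = {}" "KH \<inter> KG = {}"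
    and c0_C3: "gCk flin 3 c0" and c_C3: "\<And>k. k \<in> KE \<union> KH \<union> KG \<Longrightarrow> gCk flin 3 (c k)"
    and \<omega>_C1: "\<And>i. i \<in> J \<union> \<Theta> \<Longrightarrow> C1_at (\<lambda>p. \<omega> p i) p0"
    and \<omega>_const: "\<And>p i. i \<notin> J \<union> \<Theta> \<Longrightarrow> \<omega> p i = cc i"
    and \<Theta>_C1: "\<And>i e. i \<in> \<Theta> \<Longrightarrow> C1_at (\<lambda>p. frechet_derivative (\<lambda>p. \<omega> p i) (at p) e) p0"
    and \<gamma>_C1: "C1_at \<gamma> p0" and \<gamma>'_C1: "\<And>e. C1_at (\<lambda>p. frechet_derivative \<gamma> (at p) e) p0"
    and \<gamma>0: "\<gamma> p0 = 0" and freq: "\<exists>\<^sub>F p in nhds p0. \<gamma> p > 0"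
    and barrier_KKT: "\<forall>\<^sub>F p in nhds p0. \<gamma> p > 0 \<longrightarrow> barrier_stationary J KE KH KG c0 c (\<gamma> p) (\<omega> p)"
    and strict_KKT: "strict_KKT J KE KH KG c0 c (\<omega> p0) y0"
begin

abbreviation "K \<equiv> KE \<union> KH \<union> KG"
abbreviation "Ka \<equiv> KE \<union> KH \<union> {k\<in>KG. c k (\<omega> p0) = 0}"
abbreviation "Ki \<equiv> {k\<in>KG. c k (\<omega> p0) \<noteq> 0}"

lemmas conditions = strict_KKT[unfolded strict_KKT_def Let_def]
lemmas KKT = conditions[THEN conjunct1, rule_format]
lemmas compl = conditions[THEN conjunct2, THEN conjunct1, rule_format]
lemmas strict = conditions[THEN conjunct2, THEN conjunct2, THEN conjunct1, rule_format]
lemmas LICQ = conditions[THEN conjunct2, THEN conjunct2, THEN conjunct2, THEN conjunct1, THEN spec, THEN mp]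
lemmas SOSC = conditions[THEN conjunct2, THEN conjunct2, THEN conjunct2, THEN conjunct2, THEN spec, THEN mp, THEN mp]

text \<open>Multiplying out the barrier and penalty multipliers leaves equations free of division by
  \<gamma> or by a constraint value, hence still meaningful and differentiable at \<gamma> =
  0.\<close>

definition KKT_system :: "('k \<Rightarrow> 'p \<Rightarrow> real) \<Rightarrow> 'p \<Rightarrow> bool" where
  "KKT_system Y p \<longleftrightarrow> (\<forall>j\<in>J. pd j c0 (\<omega> p) + (\<Sum>k\<in>K. Y k p * pd j (c k) (\<omega> p)) = 0) \<and>
     (\<forall>k\<in>KE. c k (\<omega> p) = 0) \<and> (\<forall>k\<in>KH. c k (\<omega> p) - \<gamma> p * Y k p = 0) \<and>
     (\<forall>k\<in>KG. Y k p * c k (\<omega> p) + \<gamma> p = 0)"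

lemma K_split: "(\<Sum>k\<in>K. f k) = (\<Sum>k\<in>Ka. f k) + (\<Sum>k\<in>Ki. (f k :: real))"
proof -
  have "K = Ka \<union> Ki" by auto
  then show ?thesis using fin disj by (simp only:) (subst sum.union_disjoint, auto)
qed

lemma K_split3: "(\<Sum>k\<in>K. f k) = (\<Sum>k\<in>KE. f k) + (\<Sum>k\<in>KH. f k) + (\<Sum>k\<in>KG. (f k :: real))"
  using fin disj by (subst sum.union_disjoint sum.union_disjoint, auto)+

lemma C1_at_\<omega>:
  assumes "gCk flin (Suc k) F"
  shows "C1_at (\<lambda>p. F (\<omega> p)) p0"
  by (rule C1_at_gCk[OF assms, of "J \<union> \<Theta>" \<omega> p0 cc]) (use fin \<omega>_C1 \<omega>_const in auto)

lemma C1_pd: "C1_at (\<lambda>p. pd j c0 (\<omega> p)) p0" "C1_at (\<lambda>p. pd i (pd j c0) (\<omega> p)) p0"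
  "k \<in> K \<Longrightarrow> C1_at (\<lambda>p. c k (\<omega> p)) p0" "k \<in> K \<Longrightarrow> C1_at (\<lambda>p. pd j (c k) (\<omega> p)) p0"
  "k \<in> K \<Longrightarrow> C1_at (\<lambda>p. pd i (pd j (c k)) (\<omega> p)) p0"
  using c0_C3 c_C3 by (auto intro!: C1_at_\<omega> gCk_pd simp: eval_nat_numeral simp del: gCk.simps)

text \<open>The formulas \<open>c / \<gamma>\<close> and \<open>- \<gamma> / c\<close> degenerate at
  \<gamma> = 0 for penalised and active constraints. Read backwards, stationarity is a linear system
  for these multipliers with the constraint gradients as columns; LICQ makes it injective at
  \<open>p0\<close>, so the multipliers are C1 across \<gamma> = 0.\<close>

lemma multipliers_C1:
  obtains Y where "\<And>k. k \<in> K \<Longrightarrow> C1_at (Y k) p0" "\<And>k. k \<in> K \<Longrightarrow> Y k p0 = y0 k"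
    "\<forall>\<^sub>F p in nhds p0. \<gamma> p > 0 \<longrightarrow> KKT_system Y p"
proof -
  define a where "a = (\<lambda>j k p. pd j (c k) (\<omega> p))"
  \<comment> \<open>Constraints inactive at \<open>p0\<close> have values bounded away from 0
    nearby, so their multipliers are C1 as they stand and move to the right-hand side.\<close>
  define b where "b = (\<lambda>j p. - pd j c0 (\<omega> p) - (\<Sum>k\<in>Ki. - \<gamma> p / c k (\<omega> p) * pd j (c k) (\<omega> p)))"
  obtain z where z: "\<And>k. k \<in> Ka \<Longrightarrow> C1_at (z k) p0"
    and zev: "\<forall>\<^sub>F p in nhds p0. \<forall>x. (\<forall>j\<in>J. (\<Sum>k\<in>Ka. a j k p * x k) = b j p) \<longrightarrow> (\<forall>k\<in>Ka. x k = z k p)"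
  proof (rule C1_solve[of Ka J a p0 b])
    show "C1_at (a j k) p0" if "k \<in> Ka" for j k
      using that by (auto simp: a_def intro!: C1_pd)
    show "C1_at (b j) p0" for j
      unfolding b_def by (intro C1_at_diff C1_at_sum C1_at_mult C1_at_divide C1_at_minus C1_pd \<gamma>_C1) auto
    show "\<forall>k\<in>Ka. x k = 0" if "\<And>j. j \<in> J \<Longrightarrow> (\<Sum>k\<in>Ka. a j k p0 * x k) = 0" for x
      using that by (intro LICQ) (auto simp: a_def mult.commute)
  qed (use fin in auto)
  define Y where "Y = (\<lambda>k p. if k \<in> Ki then - \<gamma> p / c k (\<omega> p) else z k p)"
  have YC1: "C1_at (Y k) p0" if "k \<in> K" for k
  proof (cases "k \<in> Ki")
    case True
    then show ?thesis unfolding Y_def by (auto intro!: C1_at_divide C1_at_minus C1_pd \<gamma>_C1)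
  next
    case False
    then have "k \<in> Ka" using that by auto
    then have "C1_at (z k) p0" by (rule z)
    then show ?thesis using False unfolding Y_def by (simp only: if_False)
  qed
  have ev: "\<forall>\<^sub>F p in nhds p0. \<gamma> p > 0 \<longrightarrow> KKT_system Y p"
    using zev barrier_KKT
  proof eventually_elim
    case (elim p)
    show ?case
    proof
      assume g: "\<gamma> p > 0"
      with elim(2)[unfolded barrier_stationary_def] obtain \<mu> where KE: "\<forall>k\<in>KE. c k (\<omega> p) = 0" and KG: "\<forall>k\<in>KG. c k (\<omega> p) < 0" and
        st: "\<forall>j\<in>J. pd j c0 (\<omega> p) + (\<Sum>k\<in>KE. \<mu> k * pd j (c k) (\<omega> p))
            + (\<Sum>k\<in>KH. c k (\<omega> p) / \<gamma> p * pd j (c k) (\<omega> p))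
            + (\<Sum>k\<in>KG. - \<gamma> p / c k (\<omega> p) * pd j (c k) (\<omega> p)) = 0" by blast
      define y where "y = (\<lambda>k. if k \<in> KE then \<mu> k else if k \<in> KH then c k (\<omega> p) / \<gamma> p else - \<gamma> p / c k (\<omega> p))"
      have yKE: "k \<in> KE \<Longrightarrow> y k = \<mu> k" and yKH: "k \<in> KH \<Longrightarrow> y k = c k (\<omega> p) / \<gamma> p"
        and yKG: "k \<in> KG \<Longrightarrow> y k = - \<gamma> p / c k (\<omega> p)" for k
        using disj by (auto simp: y_def)
      have st': "pd j c0 (\<omega> p) + (\<Sum>k\<in>K. y k * pd j (c k) (\<omega> p)) = 0" if "j \<in> J" for j
        using st that unfolding K_split3 by (simp add: yKE yKH yKG add.assoc)
      have "(\<Sum>k\<in>Ka. a j k p * y k) = b j p" if "j \<in> J" for j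
        using st'[OF that] unfolding K_split by (simp add: a_def b_def yKG mult.commute sum_negf)
      then have yz: "\<forall>k\<in>Ka. y k = z k p" using elim(1) by auto
      have yY: "Y k p = y k" if "k \<in> K" for k
      proof (cases "k \<in> Ki")
        case True
        then show ?thesis by (simp add: Y_def yKG)
      next
        case False
        then have "y k = z k p" using yz that by blast
        then show ?thesis using False by (simp only: Y_def if_False)
      qed
      show "KKT_system Y p"
        unfolding KKT_system_def
      proof (intro conjI ballI)
        show "pd j c0 (\<omega> p) + (\<Sum>k\<in>K. Y k p * pd j (c k) (\<omega> p)) = 0" if "j \<in> J" for j
          using st'[OF that] yY by simp
        show "c k (\<omega> p) - \<gamma> p * Y k p = 0" if "k \<in> KH" for k
          using that yY[of k] yKH[of k] g by simp
        show "Y k p * c k (\<omega> p) + \<gamma> p = 0" if "k \<in> KG" for k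
          using that yY[of k] yKG[of k] KG by auto
      qed (use KE in auto)
    qed
  qed
  have Yi: "Y k p0 = 0" "y0 k = 0" if "k \<in> Ki" for k
    using that \<gamma>0 compl by (auto simp: Y_def)
  have st0: "pd j c0 (\<omega> p0) + (\<Sum>k\<in>K. Y k p0 * pd j (c k) (\<omega> p0)) = 0" if "j \<in> J" for j
  proof (rule frequently_eq_at_isCont[OF _ freq])
    show "isCont (\<lambda>p. pd j c0 (\<omega> p) + (\<Sum>k\<in>K. Y k p * pd j (c k) (\<omega> p))) p0"
      by (intro C1_at_isCont C1_at_add C1_at_sum C1_at_mult C1_pd YC1)
    show "\<forall>\<^sub>F p in nhds p0. 0 < \<gamma> p \<longrightarrow> pd j c0 (\<omega> p) + (\<Sum>k\<in>K. Y k p * pd j (c k) (\<omega> p)) = 0"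
      using ev by eventually_elim (use that in \<open>auto simp: KKT_system_def\<close>)
  qed
  \<comment> \<open>Both families satisfy stationarity at \<open>p0\<close> and vanish on inactive
    constraints; their difference is a null combination of independent gradients.\<close>
  have "\<forall>k\<in>Ka. Y k p0 - y0 k = 0"
  proof (rule LICQ, rule ballI)
    fix j assume "j \<in> J"
    show "(\<Sum>k\<in>Ka. (Y k p0 - y0 k) * pd j (c k) (\<omega> p0)) = 0"
      using st0[OF \<open>j \<in> J\<close>] KKT[OF \<open>j \<in> J\<close>] unfolding K_split
      by (simp add: Yi left_diff_distrib sum_subtractf)
  qed
  then have "Y k p0 = y0 k" if "k \<in> K" for k
    using that Yi[of k] by (cases "k \<in> Ki") auto
  with YC1 ev that show ?thesis by blast
qed

text \<open>Differentiating the perturbed KKT system yields a linear system for the derivative of the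
  primal-dual solution whose coefficients are continuously differentiable and which is regular
  at \<open>p0\<close>.\<close>

lemma solution_derivative_C1:
  obtains D where "\<And>i. i \<in> J \<Longrightarrow> C1_at (D i) p0"
    and "\<forall>\<^sub>F p in nhds p0. \<gamma> p > 0 \<longrightarrow> (\<forall>i\<in>J. frechet_derivative (\<lambda>p. \<omega> p i) (at p) e = D i p)"
proof -
  obtain Y where YC1: "\<And>k. k \<in> K \<Longrightarrow> C1_at (Y k) p0" and Y0: "\<And>k. k \<in> K \<Longrightarrow> Y k p0 = y0 k"
    and Yev: "\<forall>\<^sub>F p in nhds p0. \<gamma> p > 0 \<longrightarrow> KKT_system Y p"
    by (rule multipliers_C1) blast
  define \<omega>' where "\<omega>' = (\<lambda>i p. frechet_derivative (\<lambda>p. \<omega> p i) (at p) e)"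
  define Y' where "Y' = (\<lambda>k p. frechet_derivative (Y k) (at p) e)"
  define \<gamma>' where "\<gamma>' = (\<lambda>p. frechet_derivative \<gamma> (at p) e)"
  define H where "H = (\<lambda>j i p. pd i (pd j c0) (\<omega> p) + (\<Sum>k\<in>K. Y k p * pd i (pd j (c k)) (\<omega> p)))"
  \<comment> \<open>\<open>C\<close> and \<open>E\<close> are the coefficients of the trajectory and
    of the multiplier in the derivatives of \<open>c = 0\<close>, \<open>c - \<gamma> Y = 0\<close>
    and \<open>Y c + \<gamma> = 0\<close>. Only the last kind multiplies the gradient by
    \<open>Y\<close>.\<close>
  define C where "C = (\<lambda>k i p. (if k \<in> KG then Y k p else 1) * pd i (c k) (\<omega> p))"
  define E where "E = (\<lambda>k p. if k \<in> KE then 0 else if k \<in> KH then - \<gamma> p else c k (\<omega> p))"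
  define a where "a = (\<lambda>r q p. case r of
      Inl j \<Rightarrow> (case q of Inl i \<Rightarrow> H j i p | Inr k \<Rightarrow> pd j (c k) (\<omega> p))
    | Inr k \<Rightarrow> (case q of Inl i \<Rightarrow> C k i p | Inr k' \<Rightarrow> if k' = k then E k p else 0))"
  define b where "b = (\<lambda>r p. case r of
      Inl j \<Rightarrow> - (\<Sum>i\<in>\<Theta>. H j i p * \<omega>' i p)
    | Inr k \<Rightarrow> (if k \<in> KE then 0 else if k \<in> KH then Y k p * \<gamma>' p else - \<gamma>' p) - (\<Sum>i\<in>\<Theta>. C k i p * \<omega>' i p))"
  have HC1: "C1_at (H j i) p0" for j i
    unfolding H_def by (intro C1_at_add C1_at_sum C1_at_mult C1_pd YC1)
  have CC1: "C1_at (C k i) p0" if "k \<in> K" for k i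
    unfolding C_def using that by (cases "k \<in> KG") (auto intro!: C1_at_mult C1_pd YC1)
  have EC1: "C1_at (E k) p0" if "k \<in> K" for k
    unfolding E_def using that by (cases "k \<in> KE"; cases "k \<in> KH") (auto intro!: C1_at_minus C1_pd \<gamma>_C1)
  have dC1: "C1_at (\<lambda>p. if k' = k then E k p else 0) p0" if "k \<in> K" for k k'
    using EC1[OF that] by (cases "k' = k") auto
  have \<omega>'C1: "C1_at (\<omega>' i) p0" if "i \<in> \<Theta>" for i
    unfolding \<omega>'_def using that by (rule \<Theta>_C1)
  have \<gamma>'C1': "C1_at \<gamma>' p0" unfolding \<gamma>'_def by (rule \<gamma>'_C1)
  have rowJ: "(\<Sum>q\<in>J <+> K. a (Inl j) q p * x q) = (\<Sum>i\<in>J. H j i p * x (Inl i)) + (\<Sum>k\<in>K. pd j (c k) (\<omega> p) * x (Inr k))" for j p x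
    using fin by (simp add: sum.Plus a_def)
  have rowK: "(\<Sum>q\<in>J <+> K. a (Inr k) q p * x q) = (\<Sum>i\<in>J. C k i p * x (Inl i)) + E k p * x (Inr k)" if "k \<in> K" for k p x
  proof -
    have "(\<Sum>k'\<in>K. (if k' = k then E k p else 0) * x (Inr k')) = (\<Sum>k'\<in>K. if k' = k then E k p * x (Inr k) else 0)"
      by (intro sum.cong) auto
    also have "\<dots> = E k p * x (Inr k)" using fin that by simp
    finally show ?thesis using fin by (simp add: sum.Plus a_def)
  qed
  obtain z where z: "\<And>q. q \<in> J <+> K \<Longrightarrow> C1_at (z q) p0"
    and zev: "\<forall>\<^sub>F p in nhds p0. \<forall>x. (\<forall>r\<in>J <+> K. (\<Sum>q\<in>J <+> K. a r q p * x q) = b r p) \<longrightarrow> (\<forall>q\<in>J <+> K. x q = z q p)"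
  proof (rule C1_solve[of "J <+> K" "J <+> K" a p0 b])
    show "finite (J <+> K)" using fin by simp
    show "C1_at (a r q) p0" if "r \<in> J <+> K" "q \<in> J <+> K" for r q
      using that HC1 CC1 dC1 C1_pd by (cases r; cases q) (auto simp: a_def)
    show "C1_at (b r) p0" if "r \<in> J <+> K" for r
    proof (cases r)
      case (Inl j)
      then show ?thesis
        by (auto simp: b_def intro!: C1_at_minus C1_at_sum C1_at_mult HC1 \<omega>'C1)
    next
      case (Inr k)
      then have "k \<in> K" using that by auto
      with Inr show ?thesis
        by (cases "k \<in> KE"; cases "k \<in> KH")
          (auto simp: b_def intro!: C1_at_diff C1_at_minus C1_at_sum C1_at_mult YC1 CC1 \<omega>'C1 \<gamma>'C1')
    qed
    show "\<forall>q\<in>J <+> K. x q = 0" if x: "\<And>r. r \<in> J <+> K \<Longrightarrow> (\<Sum>q\<in>J <+> K. a r q p0 * x q) = 0" for x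
    proof -
      define d where "d = (\<lambda>i. x (Inl i))"
      define \<nu> where "\<nu> = (\<lambda>k. x (Inr k))"
      have r1: "(\<Sum>i\<in>J. H j i p0 * d i) + (\<Sum>k\<in>K. pd j (c k) (\<omega> p0) * \<nu> k) = 0" if "j \<in> J" for j
        using x[OF InlI[OF that]] by (simp add: rowJ d_def \<nu>_def)
      have r2: "(\<Sum>i\<in>J. C k i p0 * d i) + E k p0 * \<nu> k = 0" if "k \<in> K" for k
        using x[OF InrI[OF that]] that by (simp add: rowK d_def \<nu>_def)
      \<comment> \<open>An inactive row reads \<open>y0 k * (...) + c k * \<nu> k = 0\<close> with
        \<open>y0 k = 0\<close> and \<open>c k\<close> nonzero.\<close>
      have \<nu>i: "\<nu> k = 0" if "k \<in> Ki" for k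
      proof -
        have "y0 k = 0" using that compl[of k] by auto
        moreover have "k \<notin> KE" "k \<notin> KH" using that disj by auto
        ultimately show ?thesis using r2[of k] that Y0[of k] by (auto simp: C_def E_def)
      qed
      have crit: "(\<Sum>j\<in>J. pd j (c k) (\<omega> p0) * d j) = 0" if "k \<in> Ka" for k
      proof (cases "k \<in> KG")
        case True
        then have k: "c k (\<omega> p0) = 0" "k \<notin> KE" "k \<notin> KH" using that disj by auto
        then have "(\<Sum>i\<in>J. y0 k * pd i (c k) (\<omega> p0) * d i) = 0"
          using r2[of k] True Y0[of k] by (simp add: C_def E_def)
        then have "y0 k * (\<Sum>i\<in>J. pd i (c k) (\<omega> p0) * d i) = 0"
          by (simp add: sum_distrib_left mult.assoc)
        then show ?thesis using strict[OF True] k by simp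
      next
        case False
        then have "E k p0 = 0" using that \<gamma>0 by (auto simp: E_def)
        then show ?thesis using r2[of k] that False by (auto simp: C_def)
      qed
      \<comment> \<open>Pairing the stationarity rows with \<open>d\<close> leaves the Hessian form
        alone: in each cross term either the multiplier component is 0 or \<open>d\<close> is
        orthogonal to the gradient. SOSC then gives \<open>d = 0\<close>, and LICQ removes the
        multiplier part.\<close>
      have "(\<Sum>j\<in>J. d j * ((\<Sum>i\<in>J. H j i p0 * d i) + (\<Sum>k\<in>K. pd j (c k) (\<omega> p0) * \<nu> k))) = 0"
        using r1 by simp
      moreover have "(\<Sum>j\<in>J. d j * (\<Sum>k\<in>K. pd j (c k) (\<omega> p0) * \<nu> k)) = (\<Sum>k\<in>K. \<nu> k * (\<Sum>j\<in>J. pd j (c k) (\<omega> p0) * d j))"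
        unfolding sum_distrib_left by (subst sum.swap) (auto intro!: sum.cong)
      moreover have "\<dots> = 0"
      proof (intro sum.neutral ballI)
        fix k assume "k \<in> K"
        then show "\<nu> k * (\<Sum>j\<in>J. pd j (c k) (\<omega> p0) * d j) = 0"
          using \<nu>i[of k] crit[of k] by (cases "k \<in> Ki") auto
      qed
      ultimately have Hd: "(\<Sum>j\<in>J. d j * (\<Sum>i\<in>J. H j i p0 * d i)) = 0"
        by (simp add: distrib_left sum.distrib)
      have H0: "H j i p0 = pd i (pd j c0) (\<omega> p0) + (\<Sum>k\<in>K. y0 k * pd i (pd j (c k)) (\<omega> p0))" for j i
        using Y0 by (simp add: H_def)
      have d0: "\<forall>j\<in>J. d j = 0"
      proof (rule ccontr)
        assume "\<not> (\<forall>j\<in>J. d j = 0)"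
        then have "\<exists>j\<in>J. d j \<noteq> 0" by blast
        from SOSC[OF this] crit Hd[unfolded H0] show False by simp
      qed
      have "\<forall>k\<in>Ka. \<nu> k = 0"
      proof (rule LICQ, rule ballI)
        fix j assume "j \<in> J"
        then have "(\<Sum>k\<in>K. pd j (c k) (\<omega> p0) * \<nu> k) = 0" using r1 d0 by simp
        then show "(\<Sum>k\<in>Ka. \<nu> k * pd j (c k) (\<omega> p0)) = 0"
          unfolding K_split by (simp add: \<nu>i mult.commute)
      qed
      then have "\<nu> k = 0" if "k \<in> K" for k
        using that \<nu>i[of k] by (cases "k \<in> Ki") auto
      with d0 show ?thesis by (auto simp: d_def \<nu>_def)
    qed
  qed blast
  have evC1: "\<forall>\<^sub>F p in nhds p0. (\<forall>i\<in>J \<union> \<Theta>. C1_at (\<lambda>p. \<omega> p i) p) \<and> (\<forall>k\<in>K. C1_at (Y k) p) \<and> C1_at \<gamma> p"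
    using fin \<omega>_C1 YC1 \<gamma>_C1 by (auto intro!: eventually_conj eventually_ball_finite C1_at_eventually)
  have Yev': "\<forall>\<^sub>F p in nhds p0. \<forall>\<^sub>F p in nhds p. \<gamma> p > 0 \<longrightarrow> KKT_system Y p"
    using Yev by (subst eventually_eventually)
  have "\<forall>\<^sub>F p in nhds p0. \<gamma> p > 0 \<longrightarrow> (\<forall>i\<in>J. frechet_derivative (\<lambda>p. \<omega> p i) (at p) e = z (Inl i) p)"
    using evC1 Yev' zev
  proof eventually_elim
    case (elim p)
    show ?case
    proof
      assume g: "\<gamma> p > 0"
      have d\<omega>: "((\<lambda>p. \<omega> p i) has_derivative frechet_derivative (\<lambda>p. \<omega> p i) (at p)) (at p)" if "i \<in> J \<union> \<Theta>" for i
        using elim(1) that by (intro C1_at_has_derivative) auto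
      have dY: "(Y k has_derivative frechet_derivative (Y k) (at p)) (at p)" if "k \<in> K" for k
        using elim(1) that by (intro C1_at_has_derivative) auto
      have d\<gamma>: "(\<gamma> has_derivative frechet_derivative \<gamma> (at p)) (at p)"
        using elim(1) by (intro C1_at_has_derivative) auto
      have dF: "((\<lambda>p. F (\<omega> p)) has_derivative (\<lambda>e. \<Sum>i\<in>J \<union> \<Theta>. pd i F (\<omega> p) * frechet_derivative (\<lambda>p. \<omega> p i) (at p) e)) (at p)"
        if "gCk flin (Suc k) F" for F k
        by (rule gCk_chain'[OF that _ _ \<omega>_const]) (use fin d\<omega> in auto)
      have I_split: "(\<Sum>i\<in>J \<union> \<Theta>. f i) = (\<Sum>i\<in>J. f i) + (\<Sum>i\<in>\<Theta>. (f i :: real))" for f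
        using fin disj by (simp add: sum.union_disjoint)
      have gc: "gCk flin (Suc 0) (pd j c0)" "k \<in> K \<Longrightarrow> gCk flin (Suc 0) (pd j (c k))" "k \<in> K \<Longrightarrow> gCk flin (Suc 0) (c k)" for j k
        using c0_C3 c_C3[of k] by (auto intro!: gCk_pd intro: gCk_le[of _ 3] simp: eval_nat_numeral simp del: gCk.simps)
      \<comment> \<open>Positivity of \<gamma> is an open condition, so the KKT equations hold
        identically near \<open>p\<close> and may be differentiated there.\<close>
      have "isCont \<gamma> p" using elim(1) C1_at_isCont by auto
      then have "\<forall>\<^sub>F q in nhds p. \<gamma> q > 0"
        using g by (metis isCont_def order_tendstoD(1) tendsto_at_iff_tendsto_nhds)
      with elim(2) have near: "\<forall>\<^sub>F p in nhds p. KKT_system Y p"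
        by eventually_elim (auto simp: KKT_system_def)
      define x where "x = (\<lambda>q. case q of Inl i \<Rightarrow> \<omega>' i p | Inr k \<Rightarrow> Y' k p)"
      have "(\<Sum>q\<in>J <+> K. a r q p * x q) = b r p" if "r \<in> J <+> K" for r
      proof (cases r)
        case (Inl j)
        then have j: "j \<in> J" using that by auto
        have "((\<lambda>p. pd j c0 (\<omega> p) + (\<Sum>k\<in>K. Y k p * pd j (c k) (\<omega> p))) has_derivative
           (\<lambda>e. (\<Sum>i\<in>J \<union> \<Theta>. pd i (pd j c0) (\<omega> p) * frechet_derivative (\<lambda>p. \<omega> p i) (at p) e) +
             (\<Sum>k\<in>K. Y k p * (\<Sum>i\<in>J \<union> \<Theta>. pd i (pd j (c k)) (\<omega> p) * frechet_derivative (\<lambda>p. \<omega> p i) (at p) e)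
               + frechet_derivative (Y k) (at p) e * pd j (c k) (\<omega> p)))) (at p)"
          by (intro has_derivative_add has_derivative_sum has_derivative_mult dY dF[OF gc(1)] dF[OF gc(2)])
        moreover have "\<forall>\<^sub>F p in nhds p. pd j c0 (\<omega> p) + (\<Sum>k\<in>K. Y k p * pd j (c k) (\<omega> p)) = 0"
          using near unfolding KKT_system_def by eventually_elim (use j in blast)
        ultimately have "(\<Sum>i\<in>J \<union> \<Theta>. pd i (pd j c0) (\<omega> p) * \<omega>' i p) +
             (\<Sum>k\<in>K. Y k p * (\<Sum>i\<in>J \<union> \<Theta>. pd i (pd j (c k)) (\<omega> p) * \<omega>' i p) + Y' k p * pd j (c k) (\<omega> p)) = 0"
          unfolding \<omega>'_def Y'_def by (rule has_derivative_eventually_zero)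
        moreover have "(\<Sum>k\<in>K. Y k p * (\<Sum>i\<in>J \<union> \<Theta>. pd i (pd j (c k)) (\<omega> p) * \<omega>' i p))
            = (\<Sum>i\<in>J \<union> \<Theta>. (\<Sum>k\<in>K. Y k p * pd i (pd j (c k)) (\<omega> p)) * \<omega>' i p)"
          unfolding sum_distrib_left sum_distrib_right by (subst sum.swap) (simp add: mult.assoc)
        ultimately have "(\<Sum>i\<in>J \<union> \<Theta>. H j i p * \<omega>' i p) + (\<Sum>k\<in>K. pd j (c k) (\<omega> p) * Y' k p) = 0"
          by (simp add: H_def sum.distrib distrib_right mult.commute[of "Y' _ p"])
        then show ?thesis unfolding I_split by (simp add: Inl rowJ b_def x_def)
      next
        case (Inr k)
        then have k: "k \<in> K" using that by auto
        have dc: "((\<lambda>p. c k (\<omega> p)) has_derivative (\<lambda>e. \<Sum>i\<in>J \<union> \<Theta>. pd i (c k) (\<omega> p) * frechet_derivative (\<lambda>p. \<omega> p i) (at p) e)) (at p)"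
          by (rule dF[OF gc(3)[OF k]])
        consider "k \<in> KE" "k \<notin> KH" "k \<notin> KG" | "k \<in> KH" "k \<notin> KE" "k \<notin> KG" | "k \<in> KG" "k \<notin> KE" "k \<notin> KH" using k disj by auto
        then have "(\<Sum>i\<in>J \<union> \<Theta>. C k i p * \<omega>' i p) + E k p * Y' k p = (if k \<in> KE then 0 else if k \<in> KH then Y k p * \<gamma>' p else - \<gamma>' p)"
        proof cases
          case 1
          have "(\<Sum>i\<in>J \<union> \<Theta>. pd i (c k) (\<omega> p) * \<omega>' i p) = 0"
            unfolding \<omega>'_def by (rule has_derivative_eventually_zero[OF dc])
              (use near[unfolded KKT_system_def] in eventually_elim, use 1 in blast)
          then show ?thesis using 1 by (simp add: C_def E_def)
        next
          case 2
          have "((\<lambda>p. c k (\<omega> p) - \<gamma> p * Y k p) has_derivative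
             (\<lambda>e. (\<Sum>i\<in>J \<union> \<Theta>. pd i (c k) (\<omega> p) * frechet_derivative (\<lambda>p. \<omega> p i) (at p) e)
               - (\<gamma> p * frechet_derivative (Y k) (at p) e + frechet_derivative \<gamma> (at p) e * Y k p))) (at p)"
            by (intro has_derivative_diff has_derivative_mult dc d\<gamma> dY k)
          moreover have "\<forall>\<^sub>F p in nhds p. c k (\<omega> p) - \<gamma> p * Y k p = 0"
            using near unfolding KKT_system_def by eventually_elim (use 2 in blast)
          ultimately have "(\<Sum>i\<in>J \<union> \<Theta>. pd i (c k) (\<omega> p) * \<omega>' i p) - (\<gamma> p * Y' k p + \<gamma>' p * Y k p) = 0"
            unfolding \<omega>'_def Y'_def \<gamma>'_def by (rule has_derivative_eventually_zero)
          then show ?thesis using 2 by (simp add: C_def E_def mult.commute)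
        next
          case 3
          have "((\<lambda>p. Y k p * c k (\<omega> p) + \<gamma> p) has_derivative
             (\<lambda>e. (Y k p * (\<Sum>i\<in>J \<union> \<Theta>. pd i (c k) (\<omega> p) * frechet_derivative (\<lambda>p. \<omega> p i) (at p) e)
               + frechet_derivative (Y k) (at p) e * c k (\<omega> p)) + frechet_derivative \<gamma> (at p) e)) (at p)"
            by (intro has_derivative_add has_derivative_mult dc d\<gamma> dY k)
          moreover have "\<forall>\<^sub>F p in nhds p. Y k p * c k (\<omega> p) + \<gamma> p = 0"
            using near unfolding KKT_system_def by eventually_elim (use 3 in blast)
          ultimately have "Y k p * (\<Sum>i\<in>J \<union> \<Theta>. pd i (c k) (\<omega> p) * \<omega>' i p) + Y' k p * c k (\<omega> p) + \<gamma>' p = 0"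
            unfolding \<omega>'_def Y'_def \<gamma>'_def by (rule has_derivative_eventually_zero)
          then show ?thesis using 3 by (simp add: C_def E_def sum_distrib_left mult_ac)
        qed
        then show ?thesis unfolding I_split by (simp add: Inr rowK[OF k] b_def x_def)
      qed
      then have xz: "\<forall>q\<in>J <+> K. x q = z q p" using elim(3) by blast
      show "\<forall>i\<in>J. frechet_derivative (\<lambda>p. \<omega> p i) (at p) e = z (Inl i) p"
      proof
        fix i assume "i \<in> J"
        then have "x (Inl i) = z (Inl i) p" using xz by blast
        then show "frechet_derivative (\<lambda>p. \<omega> p i) (at p) e = z (Inl i) p"
          by (simp add: x_def \<omega>'_def)
      qed
    qed
  qed
  with z show ?thesis by (intro that[of "\<lambda>i. z (Inl i)"]) auto
qed

end

section \<open>The implicit function theorem and positive definite forms\<close>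

text \<open>In coordinates, \<open>x p\<close> solves a linear system with coefficients continuous
  at \<open>p0\<close> and injective there, so elimination in the class of functions continuous at
  \<open>p0\<close> applies. It supplies continuity of the derivative of an inverse function, one
  vector at a time.\<close>

lemma blinfun_inverse_isCont:
  fixes T :: "'p::t2_space \<Rightarrow> 'a::euclidean_space \<Rightarrow>\<^sub>L 'a" and x :: "'p \<Rightarrow> 'a"
  assumes T: "isCont T p0" and inj: "\<And>v. T p0 v = 0 \<Longrightarrow> v = 0"
    and x: "\<forall>\<^sub>F p in nhds p0. T p (x p) = w"
  shows "isCont x p0"
proof -
  have rep: "T p v \<bullet> c = (\<Sum>b\<in>Basis. (T p b \<bullet> c) * (v \<bullet> b))" for p v c
  proof -
    have "T p v = T p (\<Sum>b\<in>Basis. (v \<bullet> b) *\<^sub>R b)" by (simp add: euclidean_representation)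
    then show ?thesis by (simp add: blinfun.sum_right blinfun.scaleR_right inner_sum_left mult.commute)
  qed
  have "\<exists>z. (\<forall>b\<in>Basis. isCont (z b) p0) \<and>
     (\<forall>\<^sub>F p in nhds p0. \<forall>v. (\<forall>c\<in>Basis. (\<Sum>b\<in>Basis. (T p b \<bullet> c) * v b) = w \<bullet> c) \<longrightarrow> (\<forall>b\<in>Basis. v b = z b p))"
  proof (rule linear_solve_class[where Q = "\<lambda>f. isCont f p0"])
    show "isCont (\<lambda>p. T p b \<bullet> c) p0" for b c
      using T by (intro continuous_intros)
    fix v :: "'a \<Rightarrow> real"
    assume v: "\<And>c. c \<in> Basis \<Longrightarrow> (\<Sum>b\<in>Basis. (T p0 b \<bullet> c) * v b) = 0"
    define v' where "v' = (\<Sum>b\<in>Basis. v b *\<^sub>R b)"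
    have vb: "v' \<bullet> b = v b" if "b \<in> Basis" for b
      using that by (simp add: v'_def inner_sum_left inner_Basis if_distrib cong: if_cong)
    have "T p0 v' = 0"
      by (rule euclidean_eqI, subst rep) (use v vb in \<open>simp cong: sum.cong\<close>)
    then have "v' = 0" by (rule inj)
    then show "\<forall>b\<in>Basis. v b = 0" using vb by force
  qed (auto intro!: continuous_intros)
  then obtain z where z: "\<forall>b\<in>Basis. isCont (z b) p0" and
    ev: "\<forall>\<^sub>F p in nhds p0. \<forall>v. (\<forall>c\<in>Basis. (\<Sum>b\<in>Basis. (T p b \<bullet> c) * v b) = w \<bullet> c) \<longrightarrow> (\<forall>b\<in>Basis. v b = z b p)"
    by blast
  have "\<forall>\<^sub>F p in nhds p0. x p = (\<Sum>b\<in>Basis. z b p *\<^sub>R b)"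
    using ev x
  proof eventually_elim
    case (elim p)
    have "\<forall>c\<in>Basis. (\<Sum>b\<in>Basis. (T p b \<bullet> c) * (x p \<bullet> b)) = w \<bullet> c"
      using elim(2) by (simp add: rep[symmetric])
    with elim(1) have "\<forall>b\<in>Basis. x p \<bullet> b = z b p" by blast
    then show ?case by (metis (no_types, lifting) euclidean_representation sum.cong)
  qed
  then show ?thesis
    using z by (subst isCont_cong[where g = "\<lambda>p. \<Sum>b\<in>Basis. z b p *\<^sub>R b"]) (auto intro!: continuous_intros)
qed

lemma C1_at_componentwise_blinfun:
  fixes F :: "'a::euclidean_space \<Rightarrow> 'b::euclidean_space"
  assumes "\<And>b. b \<in> Basis \<Longrightarrow> C1_at (\<lambda>z. F z \<bullet> b) z0"
  obtains U F' where "open U" "z0 \<in> U" "\<And>z. z \<in> U \<Longrightarrow> (F has_derivative blinfun_apply (F' z)) (at z)" "continuous_on U F'"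
proof -
  have "\<forall>b\<in>Basis. \<exists>U G. open U \<and> z0 \<in> U \<and>
     (\<forall>p\<in>U. ((\<lambda>z. F z \<bullet> b) has_derivative (\<lambda>e. G p \<bullet> e)) (at p)) \<and> continuous_on U G"
    using assms by (simp add: C1_at_def)
  then obtain U G where U: "\<And>b. b \<in> Basis \<Longrightarrow> open (U b) \<and> z0 \<in> U b \<and>
     (\<forall>p\<in>U b. ((\<lambda>z. F z \<bullet> b) has_derivative (\<lambda>e. G b p \<bullet> e)) (at p)) \<and> continuous_on (U b) (G b)"
    unfolding bchoice_iff by blast
  define V where "V = (\<Inter>b\<in>Basis. U b)"
  have V: "open V" "z0 \<in> V" using U by (auto simp: V_def)
  define F' where "F' = (\<lambda>p. Blinfun (\<lambda>e. \<Sum>b\<in>Basis. (G b p \<bullet> e) *\<^sub>R b))"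
  have F': "F' p e = (\<Sum>b\<in>Basis. (G b p \<bullet> e) *\<^sub>R b)" for p e
    unfolding F'_def
    by (subst bounded_linear_Blinfun_apply)
      (auto intro!: bounded_linear_intros bounded_linear_sum bounded_linear_inner_right_comp bounded_linear_ident)
  have "(F has_derivative blinfun_apply (F' p)) (at p)" if "p \<in> V" for p
  proof (subst has_derivative_componentwise_within, intro ballI)
    fix b :: 'b assume b: "b \<in> Basis"
    then have "F' p e \<bullet> b = G b p \<bullet> e" for e
      by (simp add: F' inner_sum_left inner_Basis if_distrib cong: if_cong)
    then show "((\<lambda>z. F z \<bullet> b) has_derivative (\<lambda>e. F' p e \<bullet> b)) (at p)"
      using U[OF b] that b by (auto simp: V_def)
  qed
  moreover have "continuous_on V F'"
  proof (rule continuous_on_blinfun_componentwise)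
    fix e :: 'a
    have "continuous_on V (G b)" if "b \<in> Basis" for b
      using U[OF that] that by (auto simp: V_def intro: continuous_on_subset)
    then show "continuous_on V (\<lambda>p. F' p e)"
      unfolding F' by (auto intro!: continuous_intros)
  qed
  ultimately show ?thesis using that V by blast
qed

text \<open>The inverse function theorem is applied to \<open>\<lambda>z. (F z, snd z)\<close>; the
  branch is the first component of the inverse along \<open>(0, y)\<close>. Injectivity of the
  partial derivative in the first variable suffices because domain and range of that partial
  derivative have equal dimension.\<close>

lemma implicit_function_C1:
  fixes F :: "'x::euclidean_space \<times> 'y::euclidean_space \<Rightarrow> 'x"
  assumes C1: "\<And>b. b \<in> Basis \<Longrightarrow> C1_at (\<lambda>z. F z \<bullet> b) (x0, y0)"
    and F0: "F (x0, y0) = 0"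
    and inj: "\<And>h. (\<And>b. frechet_derivative (\<lambda>z. F z \<bullet> b) (at (x0, y0)) (h, 0) = 0) \<Longrightarrow> h = 0"
  obtains V g where "open V" "y0 \<in> V" "g y0 = x0" "\<And>y. y \<in> V \<Longrightarrow> F (g y, y) = 0" "C1_on V g"
proof -
  obtain U F' where U: "open U" "(x0, y0) \<in> U" and dF: "\<And>z. z \<in> U \<Longrightarrow> (F has_derivative blinfun_apply (F' z)) (at z)"
    and cF': "continuous_on U F'"
    using C1_at_componentwise_blinfun[of F "(x0, y0)"] C1 by blast
  define f where "f = (\<lambda>z. (F z, snd z))"
  define f' where "f' = (\<lambda>z. Blinfun (\<lambda>e. (F' z e, snd e)))"
  have f': "f' z e = (F' z e, snd e)" for z e
    unfolding f'_def
    by (subst bounded_linear_Blinfun_apply)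
      (auto intro!: bounded_linear_Pair bounded_linear_snd blinfun.bounded_linear_right)
  have df: "(f has_derivative blinfun_apply (f' z)) (at z)" if "z \<in> U" for z
    unfolding f_def f' using dF[OF that] by (auto intro!: derivative_eq_intros)
  have cf': "continuous_on U f'"
    by (rule continuous_on_blinfun_componentwise) (use cF' in \<open>auto simp: f' intro!: continuous_intros\<close>)
  have inj0: "v = 0" if "f' (x0, y0) v = 0" for v
  proof -
    obtain h k where v: "v = (h, k)" by (cases v)
    with that have k: "k = 0" and h: "F' (x0, y0) (h, 0) = 0" by (auto simp: f' zero_prod_def)
    have "frechet_derivative (\<lambda>z. F z \<bullet> b) (at (x0, y0)) (h, 0) = 0" for b
    proof -
      have "((\<lambda>z. F z \<bullet> b) has_derivative (\<lambda>e. F' (x0, y0) e \<bullet> b)) (at (x0, y0))"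
        using dF[OF U(2)] by (rule has_derivative_inner_left)
      then show ?thesis using h by (simp add: frechet_derivative_at[symmetric])
    qed
    then have "h = 0" by (rule inj)
    then show ?thesis by (simp add: v k zero_prod_def)
  qed
  have "linear (f' (x0, y0))" by (intro bounded_linear.linear blinfun.bounded_linear_right)
  moreover have "inj (f' (x0, y0))"
    using inj0 calculation by (simp add: linear_injective_0)
  ultimately obtain i where i: "linear i" "i \<circ> f' (x0, y0) = id"
    using linear_injective_left_inverse by blast
  have "Blinfun i o\<^sub>L f' (x0, y0) = id_blinfun"
    using i by (intro blinfun_eqI) (auto simp: bounded_linear_Blinfun_apply linear_conv_bounded_linear o_def id_def fun_eq_iff)
  from inverse_function_theorem[OF U(1) df cf' U(2) this]
  obtain U' W g g' where W: "open U'" "U' \<subseteq> U" "(x0, y0) \<in> U'" "open W" "f (x0, y0) \<in> W" "homeomorphism U' W f g"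
    and dg: "\<And>y. y \<in> W \<Longrightarrow> (g has_derivative (g' y)) (at y)"
    and g': "\<And>y. y \<in> W \<Longrightarrow> g' y = inv (blinfun_apply (f'(g y)))"
    and bij: "\<And>y. y \<in> W \<Longrightarrow> bij (blinfun_apply (f'(g y)))" by blast
  have fg: "f (g w) = w" "g w \<in> U'" if "w \<in> W" for w
    using W(6) that by (auto simp: homeomorphism_def)
  have gf: "g (f z) = z" if "z \<in> U'" for z
    using W(6) that by (auto simp: homeomorphism_def)
  define V where "V = (\<lambda>y. (0, y)) -` W"
  define h where "h = (\<lambda>y. fst (g (0, y)))"
  have contP: "continuous_on UNIV (\<lambda>y. (0::'x, y::'y))" by (intro continuous_intros)
  have "open V" unfolding V_def using W(4) contP by (simp add: open_vimage)
  moreover have "y0 \<in> V" using W(5) F0 by (simp add: V_def f_def)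
  moreover have "h y0 = x0" using gf[OF W(3)] F0 by (simp add: h_def f_def)
  moreover have "F (h y, y) = 0" if "y \<in> V" for y
  proof -
    have "f (g (0, y)) = (0, y)" using that fg by (simp add: V_def)
    then have "F (g (0, y)) = 0" "snd (g (0, y)) = y" by (auto simp: f_def)
    then show ?thesis by (metis h_def prod.collapse)
  qed
  moreover have "C1_on V h"
  proof -
    have lin: "bounded_linear (g' w)" if "w \<in> W" for w
      using dg[OF that] by (rule has_derivative_bounded_linear)
    define D where "D = (\<lambda>y. Blinfun (\<lambda>e. fst (g' (0, y) (0, e))))"
    have blP: "bounded_linear (\<lambda>e. (0::'x, e::'y))"
      by (intro bounded_linear_Pair bounded_linear_zero bounded_linear_ident)
    have D: "D y e = fst (g' (0, y) (0, e))" if "y \<in> V" for y e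
      unfolding D_def
      by (subst bounded_linear_Blinfun_apply)
        (use that in \<open>auto simp: V_def intro!: bounded_linear_compose[OF bounded_linear_fst]
            bounded_linear_compose[OF lin blP]\<close>)
    have "(h has_derivative D y) (at y)" if "y \<in> V" for y
    proof -
      have "((\<lambda>y. g (0, y)) has_derivative (\<lambda>e. g' (0, y) (0, e))) (at y)"
        using has_derivative_compose[OF bounded_linear_imp_has_derivative[OF blP], of g "g' (0, y)" y UNIV] dg[of "(0, y)"] that
        by (auto simp: V_def)
      then have "(h has_derivative (\<lambda>e. fst (g' (0, y) (0, e)))) (at y)"
        unfolding h_def by (rule has_derivative_fst)
      moreover have "(\<lambda>e. fst (g' (0, y) (0, e))) = D y" using D[OF that] by auto
      ultimately show ?thesis by simp
    qed
    moreover have "continuous_on V D"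
    proof (rule continuous_on_blinfun_componentwise)
      fix e :: 'y
      have ic: "isCont (\<lambda>w. g' w (0, e)) w0" if w0: "w0 \<in> W" for w0
      proof (rule blinfun_inverse_isCont[where T = "\<lambda>w. f' (g w)" and w = "(0, e)"])
        have "isCont g w0" using dg[OF w0] has_derivative_continuous by blast
        moreover have "isCont f' (g w0)"
          using cf' U(1) fg(2)[OF w0] W(2) continuous_on_eq_continuous_at by blast
        ultimately show "isCont (\<lambda>w. f' (g w)) w0" by (rule isCont_o2)
        show "v = 0" if "f' (g w0) v = 0" for v
          using bij[OF w0] that by (metis bij_inv_eq_iff blinfun.zero_right)
        have "\<forall>\<^sub>F w in nhds w0. w \<in> W" using W(4) w0 by (rule eventually_nhds_in_open)
        then show "\<forall>\<^sub>F w in nhds w0. f' (g w) (g' w (0, e)) = (0, e)"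
          by eventually_elim (use g' bij in \<open>auto simp: bij_is_surj surj_f_inv_f\<close>)
      qed
      have "continuous_on W (\<lambda>w. g' w (0, e))"
        using ic by (intro continuous_at_imp_continuous_on) auto
      then have "continuous_on V (\<lambda>y. fst (g' (0, y) (0, e)))"
        by (intro continuous_on_fst continuous_on_compose2[of W "\<lambda>w. g' w (0, e)" V "\<lambda>y. (0, y)"] continuous_intros)
          (auto simp: V_def)
      then show "continuous_on V (\<lambda>y. D y e)" using D by (simp cong: continuous_on_cong)
    qed
    ultimately show ?thesis unfolding C1_on_def by blast
  qed
  ultimately show ?thesis using that by blast
qed

text \<open>The limit form has a positive minimum on the unit sphere. On unit vectors the form
  changes by at most the sum of the absolute entry differences, which finally drops below this
  minimum; homogeneity does the rest.\<close>

lemma pos_def_eventually: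
  fixes A :: "'t \<Rightarrow> 'a::euclidean_space \<Rightarrow> 'a \<Rightarrow> real"
  assumes lim: "\<And>b c. b \<in> Basis \<Longrightarrow> c \<in> Basis \<Longrightarrow> ((\<lambda>t. A t b c) \<longlongrightarrow> A0 b c) F"
    and pos: "\<And>y. y \<noteq> 0 \<Longrightarrow> (\<Sum>b\<in>Basis. \<Sum>c\<in>Basis. A0 b c * (y \<bullet> b) * (y \<bullet> c)) > 0"
  shows "\<forall>\<^sub>F t in F. \<forall>y. y \<noteq> 0 \<longrightarrow> (\<Sum>b\<in>Basis. \<Sum>c\<in>Basis. A t b c * (y \<bullet> b) * (y \<bullet> c)) > 0"
proof -
  define q where "q = (\<lambda>B y. \<Sum>b\<in>Basis. \<Sum>c\<in>Basis. B b c * (y \<bullet> b) * (y \<bullet> (c::'a)) :: real)"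
  have "continuous_on (sphere 0 1) (q A0)" unfolding q_def by (intro continuous_intros)
  moreover have "sphere (0::'a) 1 \<noteq> {}" by simp
  ultimately obtain y0 where y0: "y0 \<in> sphere 0 1" "\<forall>y\<in>sphere 0 1. q A0 y0 \<le> q A0 y"
    using continuous_attains_inf[of "sphere 0 1" "q A0"] by auto
  have m: "q A0 y0 > 0" using y0(1) pos[of y0] by (cases "y0 = 0") (auto simp: q_def)
  have "((\<lambda>t. \<Sum>b\<in>Basis. \<Sum>c\<in>Basis. \<bar>A t b c - A0 b c\<bar>) \<longlongrightarrow> (\<Sum>b\<in>Basis. \<Sum>c\<in>Basis. \<bar>A0 b c - A0 b c\<bar>)) F"
    by (intro tendsto_intros lim)
  then have "\<forall>\<^sub>F t in F. (\<Sum>b\<in>Basis. \<Sum>c\<in>Basis. \<bar>A t b c - A0 b c\<bar>) < q A0 y0"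
    using m by (intro order_tendstoD) auto
  then show ?thesis
  proof eventually_elim
    case (elim t)
    have unit: "q (A t) y > 0" if y: "norm y = 1" for y
    proof -
      have "q A0 y - q (A t) y = (\<Sum>b\<in>Basis. \<Sum>c\<in>Basis. (A0 b c - A t b c) * (y \<bullet> b) * (y \<bullet> c))"
        by (simp add: q_def sum_subtractf left_diff_distrib)
      also have "\<dots> \<le> (\<Sum>b\<in>Basis. \<Sum>c\<in>Basis. \<bar>A t b c - A0 b c\<bar>)"
      proof (intro sum_mono)
        fix b c :: 'a assume "b \<in> Basis" "c \<in> Basis"
        then have "\<bar>y \<bullet> b\<bar> * \<bar>y \<bullet> c\<bar> \<le> 1"
          using Basis_le_norm[of b y] Basis_le_norm[of c y] y by (intro mult_le_one) auto
        then have "\<bar>A0 b c - A t b c\<bar> * (\<bar>y \<bullet> b\<bar> * \<bar>y \<bullet> c\<bar>) \<le> \<bar>A0 b c - A t b c\<bar>"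
          by (rule mult_left_le) simp
        then have "\<bar>(A0 b c - A t b c) * (y \<bullet> b) * (y \<bullet> c)\<bar> \<le> \<bar>A t b c - A0 b c\<bar>"
          by (simp add: abs_mult mult.assoc abs_minus_commute)
        then show "(A0 b c - A t b c) * (y \<bullet> b) * (y \<bullet> c) \<le> \<bar>A t b c - A0 b c\<bar>" by linarith
      qed
      also have "\<dots> < q A0 y0" by (rule elim)
      also have "\<dots> \<le> q A0 y" using y0(2) y by simp
      finally show ?thesis by simp
    qed
    show ?case
    proof (intro allI impI)
      fix y :: 'a assume y: "y \<noteq> 0"
      have "q (A t) y = (norm y)\<^sup>2 * q (A t) (y /\<^sub>R norm y)"
        using y by (simp add: q_def sum_distrib_left power2_eq_square field_simps)
      then have "q (A t) y > 0" using unit[of "y /\<^sub>R norm y"] y by simp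
      then show "(\<Sum>b\<in>Basis. \<Sum>c\<in>Basis. A t b c * (y \<bullet> b) * (y \<bullet> c)) > 0" by (simp add: q_def)
    qed
  qed
qed

text \<open>Debreu's lemma.\<close>

lemma pos_def_penalty:
  fixes A0 :: "'a::euclidean_space \<Rightarrow> 'a \<Rightarrow> real" and G :: "'k \<Rightarrow> 'a"
  assumes "finite S" and pos: "\<And>y. y \<noteq> 0 \<Longrightarrow> (\<forall>i\<in>S. G i \<bullet> y = 0) \<Longrightarrow> (\<Sum>b\<in>Basis. \<Sum>c\<in>Basis. A0 b c * (y \<bullet> b) * (y \<bullet> c)) > 0"
  obtains \<kappa> where "\<kappa> \<ge> 0" "\<And>y. y \<noteq> 0 \<Longrightarrow> (\<Sum>b\<in>Basis. \<Sum>c\<in>Basis. A0 b c * (y \<bullet> b) * (y \<bullet> c)) + \<kappa> * (\<Sum>i\<in>S. (G i \<bullet> y)\<^sup>2) > 0"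
proof -
  define q where "q = (\<lambda>y::'a. \<Sum>b\<in>Basis. \<Sum>c\<in>Basis. A0 b c * (y \<bullet> b) * (y \<bullet> c))"
  define r where "r = (\<lambda>y. \<Sum>i\<in>S. (G i \<bullet> y)\<^sup>2)"
  have r0: "r y \<ge> 0" for y unfolding r_def by (intro sum_nonneg) auto
  \<comment> \<open>Open sets whose traces on the sphere grow with \<open>n\<close>: where the
    penalty \<open>r\<close> is positive, a large weight wins, and where it vanishes, the hypothesis
    applies. A finite subcover gives a single weight.\<close>
  define U where "U = (\<lambda>n::nat. {y. q y + real n * r y > 0})"
  have oU: "open (U n)" for n
    unfolding U_def q_def r_def by (intro open_Collect_less continuous_intros)
  have cover: "sphere 0 1 \<subseteq> (\<Union>n\<in>UNIV. U n)"
  proof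
    fix y :: 'a assume "y \<in> sphere 0 1"
    then have y: "y \<noteq> 0" by auto
    show "y \<in> (\<Union>n\<in>UNIV. U n)"
    proof (cases "r y = 0")
      case True
      then have "\<forall>i\<in>S. G i \<bullet> y = 0" using assms(1) by (simp add: r_def sum_nonneg_eq_0_iff)
      with pos[OF y] have "q y > 0" by (simp add: q_def)
      then have "y \<in> U 0" by (simp add: U_def)
      then show ?thesis by blast
    next
      case False
      then have "r y > 0" using r0[of y] by simp
      then obtain n where "real n * r y > - q y" using reals_Archimedean3 by blast
      then have "y \<in> U n" by (simp add: U_def)
      then show ?thesis by blast
    qed
  qed
  obtain C where C: "C \<subseteq> UNIV" "finite C" "sphere 0 1 \<subseteq> (\<Union>n\<in>C. U n)"
    by (rule compactE_image[OF compact_sphere _ cover]) (auto intro: oU)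
  define n where "n = Max (insert 0 C)"
  have unit: "q y + real n * r y > 0" if "norm y = 1" for y
  proof -
    have "y \<in> sphere 0 1" using that by simp
    then obtain k where k: "k \<in> C" "y \<in> U k" using C(3) by blast
    then have "k \<le> n" using C(2) by (auto simp: n_def)
    then have "real k * r y \<le> real n * r y" using r0[of y] by (intro mult_right_mono) auto
    with k show ?thesis by (simp add: U_def)
  qed
  have scale: "q y + real n * r y = (norm y)\<^sup>2 * (q (y /\<^sub>R norm y) + real n * r (y /\<^sub>R norm y))" if "y \<noteq> 0" for y
  proof -
    have qs: "q (t *\<^sub>R z) = t\<^sup>2 * q z" and rs: "r (t *\<^sub>R z) = t\<^sup>2 * r z" for t z
      by (simp_all add: q_def r_def sum_distrib_left power2_eq_square mult_ac)
    have yz: "norm y *\<^sub>R (y /\<^sub>R norm y) = y" using that by simp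
    show ?thesis using qs[of "norm y" "y /\<^sub>R norm y"] rs[of "norm y" "y /\<^sub>R norm y"]
      unfolding yz by (simp only: distrib_left mult.left_commute)
  qed
  have "q y + real n * r y > 0" if "y \<noteq> 0" for y
  proof -
    have "0 < (norm y)\<^sup>2 * (q (y /\<^sub>R norm y) + real n * r (y /\<^sub>R norm y))"
      using that unit[of "y /\<^sub>R norm y"] by simp
    then show ?thesis by (simp only: scale[OF that])
  qed
  then show ?thesis using that[of "real n"] by (simp add: q_def r_def)
qed

lemma isCont_tendsto_nhds: "isCont f x \<Longrightarrow> (f \<longlongrightarrow> f x) (nhds x)"
  by (simp add: isCont_def tendsto_at_iff_tendsto_nhds)

text \<open>It writes the derivative of the inner product of \<open>N\<close> with \<open>y\<close>
  through the matrix entries on basis pairs, the form in which positive definiteness is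
  perturbed.\<close>

lemma frechet_quadratic_form:
  fixes N :: "'a::euclidean_space \<Rightarrow> 'a"
  assumes "\<And>b. b \<in> Basis \<Longrightarrow> C1_at (\<lambda>\<theta>. N \<theta> \<bullet> b) x"
  shows "((\<lambda>\<theta>. N \<theta> \<bullet> y) has_derivative
     (\<lambda>e. \<Sum>b\<in>Basis. \<Sum>c\<in>Basis. frechet_derivative (\<lambda>\<theta>. N \<theta> \<bullet> b) (at x) c * (y \<bullet> b) * (e \<bullet> c))) (at x)"
proof -
  have lin: "frechet_derivative (\<lambda>\<theta>. N \<theta> \<bullet> b) (at x) e = (\<Sum>c\<in>Basis. frechet_derivative (\<lambda>\<theta>. N \<theta> \<bullet> b) (at x) c * (e \<bullet> c))"
    if "b \<in> Basis" for b e
  proof -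
    have "bounded_linear (frechet_derivative (\<lambda>\<theta>. N \<theta> \<bullet> b) (at x))"
      using C1_at_has_derivative[OF assms[OF that]] has_derivative_bounded_linear by blast
    from bounded_linear_eq_inner[OF this, of e] show ?thesis
      by (simp only: inner_sum_left inner_scaleR_left inner_commute[of e])
  qed
  have eq: "(\<Sum>b\<in>Basis. (y \<bullet> b) * frechet_derivative (\<lambda>\<theta>. N \<theta> \<bullet> b) (at x) e) =
      (\<Sum>b\<in>Basis. \<Sum>c\<in>Basis. frechet_derivative (\<lambda>\<theta>. N \<theta> \<bullet> b) (at x) c * (y \<bullet> b) * (e \<bullet> c))" for e
    by (intro sum.cong refl, subst lin) (simp_all add: sum_distrib_left mult_ac)
  have "((\<lambda>\<theta>. \<Sum>b\<in>Basis. (y \<bullet> b) * (N \<theta> \<bullet> b)) has_derivative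
      (\<lambda>e. \<Sum>b\<in>Basis. (y \<bullet> b) * frechet_derivative (\<lambda>\<theta>. N \<theta> \<bullet> b) (at x) e)) (at x)"
    by (intro has_derivative_sum has_derivative_mult_right C1_at_has_derivative assms)
  moreover have "(\<Sum>b\<in>Basis. (y \<bullet> b) * (N \<theta> \<bullet> b)) = N \<theta> \<bullet> y" for \<theta>
  proof -
    have "(\<Sum>b\<in>Basis. (y \<bullet> b) * (N \<theta> \<bullet> b)) = (\<Sum>b\<in>Basis. (N \<theta> \<bullet> b) * (y \<bullet> b))"
      by (intro sum.cong refl mult.commute)
    also have "\<dots> = N \<theta> \<bullet> y" by (rule euclidean_inner[symmetric])
    finally show ?thesis .
  qed
  ultimately show ?thesis by (simp add: eq)
qed

text \<open>On the segment from \<open>x\<close> to \<theta> the directional derivative of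
  \<open>S\<close> starts at 0 and strictly increases, hence \<open>S\<close> increases too. The
  second conclusion excludes further critical points and is what later makes the minimizer
  isolated.\<close>

lemma strict_min_of_pos_def:
  fixes S :: "'a::euclidean_space \<Rightarrow> real"
  assumes S: "\<forall>\<^sub>F \<theta> in nhds x. (S has_derivative (\<lambda>e. N \<theta> \<bullet> e)) (at \<theta>)"
    and N: "\<And>b. b \<in> Basis \<Longrightarrow> C1_at (\<lambda>\<theta>. N \<theta> \<bullet> b) x" and N0: "N x = 0"
    and pos: "\<And>y. y \<noteq> 0 \<Longrightarrow> frechet_derivative (\<lambda>\<theta>. N \<theta> \<bullet> y) (at x) y > 0"
  shows "\<forall>\<^sub>F \<theta> in nhds x. \<theta> \<noteq> x \<longrightarrow> S x < S \<theta> \<and> N \<theta> \<bullet> (\<theta> - x) > 0"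
proof -
  define A where "A = (\<lambda>\<theta> b c. frechet_derivative (\<lambda>\<theta>. N \<theta> \<bullet> b) (at \<theta>) c)"
  have "\<forall>\<^sub>F \<theta> in nhds x. \<forall>y. y \<noteq> 0 \<longrightarrow> (\<Sum>b\<in>Basis. \<Sum>c\<in>Basis. A \<theta> b c * (y \<bullet> b) * (y \<bullet> c)) > 0"
  proof (rule pos_def_eventually)
    show "((\<lambda>\<theta>. A \<theta> b c) \<longlongrightarrow> A x b c) (nhds x)" if "b \<in> Basis" "c \<in> Basis" for b c
      unfolding A_def by (rule isCont_tendsto_nhds[OF C1_at_isCont_frechet[OF N[OF that(1)]]])
    show "(\<Sum>b\<in>Basis. \<Sum>c\<in>Basis. A x b c * (y \<bullet> b) * (y \<bullet> c)) > 0" if "y \<noteq> 0" for y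
      using pos[OF that] frechet_derivative_at[OF frechet_quadratic_form[OF N, of y], symmetric]
      by (simp add: A_def)
  qed
  moreover have "\<forall>\<^sub>F \<theta> in nhds x. \<forall>b\<in>Basis. C1_at (\<lambda>\<theta>. N \<theta> \<bullet> b) \<theta>"
    by (intro eventually_ball_finite ballI C1_at_eventually N) auto
  ultimately have "\<forall>\<^sub>F \<theta> in nhds x. (\<forall>y. y \<noteq> 0 \<longrightarrow> (\<Sum>b\<in>Basis. \<Sum>c\<in>Basis. A \<theta> b c * (y \<bullet> b) * (y \<bullet> c)) > 0) \<and>
      (\<forall>b\<in>Basis. C1_at (\<lambda>\<theta>. N \<theta> \<bullet> b) \<theta>) \<and> (S has_derivative (\<lambda>e. N \<theta> \<bullet> e)) (at \<theta>)"
    using S by eventually_elim auto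
  then obtain \<rho> where "\<rho> > 0" and \<rho>: "\<And>\<theta>. dist \<theta> x < \<rho> \<Longrightarrow> (\<forall>y. y \<noteq> 0 \<longrightarrow> (\<Sum>b\<in>Basis. \<Sum>c\<in>Basis. A \<theta> b c * (y \<bullet> b) * (y \<bullet> c)) > 0) \<and>
      (\<forall>b\<in>Basis. C1_at (\<lambda>\<theta>. N \<theta> \<bullet> b) \<theta>) \<and> (S has_derivative (\<lambda>e. N \<theta> \<bullet> e)) (at \<theta>)"
    unfolding eventually_nhds_metric by blast
  have "S x < S \<theta> \<and> N \<theta> \<bullet> (\<theta> - x) > 0" if "dist \<theta> x < \<rho>" "\<theta> \<noteq> x" for \<theta>
  proof -
    define y where "y = \<theta> - x"
    have y: "y \<noteq> 0" using that by (simp add: y_def)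
    have near: "dist (x + s *\<^sub>R y) x < \<rho>" if "0 \<le> s" "s \<le> 1" for s
    proof -
      have "norm (s *\<^sub>R y) \<le> norm y" using that by (simp add: mult_left_le_one_le)
      then show ?thesis using \<open>dist \<theta> x < \<rho>\<close> by (simp add: dist_norm y_def)
    qed
    have line: "((\<lambda>s. x + s *\<^sub>R y) has_derivative (\<lambda>h. h *\<^sub>R y)) (at s)" for s
      by (auto intro!: derivative_eq_intros)
    have dS: "((\<lambda>s. S (x + s *\<^sub>R y)) has_real_derivative N (x + s *\<^sub>R y) \<bullet> y) (at s)" if "0 \<le> s" "s \<le> 1" for s
      using has_derivative_compose[OF line, of S "\<lambda>e. N (x + s *\<^sub>R y) \<bullet> e" s] \<rho>[OF near[OF that]]
      by (simp add: has_field_derivative_def mult_commute_abs mult.commute)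
    have dN: "\<exists>D>0. ((\<lambda>s. N (x + s *\<^sub>R y) \<bullet> y) has_real_derivative D) (at s)" if "0 \<le> s" "s \<le> 1" for s
    proof -
      define D where "D = (\<Sum>b\<in>Basis. \<Sum>c\<in>Basis. A (x + s *\<^sub>R y) b c * (y \<bullet> b) * (y \<bullet> c))"
      have "D > 0" using \<rho>[OF near[OF that]] y by (auto simp: D_def)
      have "((\<lambda>\<theta>. N \<theta> \<bullet> y) has_derivative (\<lambda>e. \<Sum>b\<in>Basis. \<Sum>c\<in>Basis. A (x + s *\<^sub>R y) b c * (y \<bullet> b) * (e \<bullet> c))) (at (x + s *\<^sub>R y))"
        unfolding A_def by (rule frechet_quadratic_form) (use \<rho>[OF near[OF that]] in auto)
      from has_derivative_compose[OF line this]
      have "((\<lambda>s. N (x + s *\<^sub>R y) \<bullet> y) has_derivative (\<lambda>h. h * D)) (at s)"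
        by (simp add: D_def sum_distrib_left mult_ac)
      with \<open>D > 0\<close> show ?thesis by (auto simp: has_field_derivative_def mult_commute_abs)
    qed
    have npos: "N (x + s *\<^sub>R y) \<bullet> y > 0" if "0 < s" "s \<le> 1" for s
    proof -
      have "N (x + 0 *\<^sub>R y) \<bullet> y < N (x + s *\<^sub>R y) \<bullet> y"
        by (rule DERIV_pos_imp_increasing[OF that(1)]) (use dN that in force)
      then show ?thesis using N0 by simp
    qed
    have "S (x + 0 *\<^sub>R y) < S (x + 1 *\<^sub>R y)"
    proof (rule DERIV_pos_imp_increasing_open[where f = "\<lambda>s. S (x + s *\<^sub>R y)"])
      show "\<exists>D. ((\<lambda>s. S (x + s *\<^sub>R y)) has_real_derivative D) (at s) \<and> D > 0" if "0 < s" "s < 1" for s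
        using dS[of s] npos[of s] that by auto
      show "continuous_on {0..1} (\<lambda>s. S (x + s *\<^sub>R y))"
        using dS by (intro DERIV_continuous_on) (auto intro: has_field_derivative_at_within)
    qed auto
    with npos[of 1] show ?thesis by (simp add: y_def)
  qed
  then show ?thesis using \<open>\<rho> > 0\<close> unfolding eventually_nhds_metric by blast
qed

section \<open>The central path of a logarithmic barrier\<close>

text \<open>An independent family has at most as many members as the dimension. The injection lets a
  vector of multipliers indexed by \<open>A\<close> be stored in the existing type
  \<open>'a\<close>, since no type has exactly \<open>card A\<close> coordinates in general.\<close>

lemma independent_family_inj_Basis:
  fixes M :: "'k \<Rightarrow> 'a::euclidean_space"
  assumes "finite A" and ind: "\<And>a. (\<Sum>i\<in>A. a i *\<^sub>R M i) = 0 \<Longrightarrow> (\<forall>i\<in>A. a i = 0)"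
  obtains \<sigma> where "inj_on \<sigma> A" "\<sigma> ` A \<subseteq> (Basis :: 'a set)"
proof -
  have inj: "inj_on M A"
  proof (rule inj_onI, rule ccontr)
    fix i j assume ij: "i \<in> A" "j \<in> A" "M i = M j" "i \<noteq> j"
    define a where "a = (\<lambda>k. if k = i then 1 else if k = j then -1 else (0::real))"
    have "(\<Sum>k\<in>A. a k *\<^sub>R M k) = (\<Sum>k\<in>{i, j}. a k *\<^sub>R M k)"
      using ij assms(1) by (intro sum.mono_neutral_right) (auto simp: a_def)
    also have "\<dots> = 0" using ij by (simp add: a_def)
    finally have "\<forall>k\<in>A. a k = 0" by (rule ind)
    then show False using ij by (auto simp: a_def)
  qed
  have "independent (M ` A)"
  proof (rule independent_if_scalars_zero)
    show "finite (M ` A)" using assms(1) by simp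
    fix f x assume f: "(\<Sum>x\<in>M ` A. f x *\<^sub>R x) = 0" and x: "x \<in> M ` A"
    have "(\<Sum>i\<in>A. f (M i) *\<^sub>R M i) = 0"
      using f by (simp add: sum.reindex[OF inj])
    then have "\<forall>i\<in>A. f (M i) = 0" by (rule ind)
    then show "f x = 0" using x by auto
  qed
  then have "card (M ` A) \<le> DIM('a)" using independent_bound by blast
  then have "card A \<le> card (Basis :: 'a set)" using card_image[OF inj] by simp
  then show ?thesis using card_le_inj[OF assms(1), of "Basis :: 'a set"] that by auto
qed

text \<open>\<open>M0 p\<close> and \<open>M i p\<close> are the gradients of \<open>\<phi>0\<close> and \<open>\<phi> i\<close> with respect to the first
  component.  They are required to be so for positive second component only, but are continuously
  differentiable on both sides, so that the implicit function theorem is applicable at the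
  boundary.\<close>

locale log_barrier =
  fixes \<phi>0 :: "'a::euclidean_space \<times> real \<Rightarrow> real" and \<phi> :: "nat \<Rightarrow> 'a \<times> real \<Rightarrow> real" and l :: nat
    and M0 :: "'a \<times> real \<Rightarrow> 'a" and M :: "nat \<Rightarrow> 'a \<times> real \<Rightarrow> 'a" and \<theta>s :: 'a and u :: "nat \<Rightarrow> real"
  assumes M0_C1: "\<And>b. C1_at (\<lambda>p. M0 p \<bullet> b) (\<theta>s, 0)"
    and M_C1: "\<And>i b. i < l \<Longrightarrow> C1_at (\<lambda>p. M i p \<bullet> b) (\<theta>s, 0)"
    and \<phi>_C1: "\<And>i. i < l \<Longrightarrow> C1_at (\<phi> i) (\<theta>s, 0)"
    and \<phi>0_deriv: "\<forall>\<^sub>F p in nhds (\<theta>s, 0). snd p > 0 \<longrightarrow> ((\<lambda>\<theta>. \<phi>0 (\<theta>, snd p)) has_derivative (\<lambda>e. M0 p \<bullet> e)) (at (fst p))"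
    and \<phi>_deriv: "\<And>i. i < l \<Longrightarrow> \<forall>\<^sub>F p in nhds (\<theta>s, 0). snd p > 0 \<longrightarrow> ((\<lambda>\<theta>. \<phi> i (\<theta>, snd p)) has_derivative (\<lambda>e. M i p \<bullet> e)) (at (fst p))"
    and \<phi>_deriv0: "\<And>i e. i < l \<Longrightarrow> frechet_derivative (\<phi> i) (at (\<theta>s, 0)) (e, 0) = M i (\<theta>s, 0) \<bullet> e"
    and stat: "M0 (\<theta>s, 0) + (\<Sum>i<l. u i *\<^sub>R M i (\<theta>s, 0)) = 0"
    and compl: "\<And>i. i < l \<Longrightarrow> u i * \<phi> i (\<theta>s, 0) = 0" and feas: "\<And>i. i < l \<Longrightarrow> \<phi> i (\<theta>s, 0) \<le> 0"
    and strict: "\<And>i. i < l \<Longrightarrow> \<phi> i (\<theta>s, 0) = 0 \<Longrightarrow> u i > 0"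
    and LICQ: "\<And>a. (\<Sum>i\<in>{i. i < l \<and> \<phi> i (\<theta>s, 0) = 0}. a i *\<^sub>R M i (\<theta>s, 0)) = 0 \<Longrightarrow> (\<forall>i\<in>{i. i < l \<and> \<phi> i (\<theta>s, 0) = 0}. a i = 0)"
    and SOSC: "\<And>y. y \<noteq> 0 \<Longrightarrow> (\<forall>i\<in>{i. i < l \<and> \<phi> i (\<theta>s, 0) = 0}. M i (\<theta>s, 0) \<bullet> y = 0) \<Longrightarrow>
        frechet_derivative (\<lambda>p. M0 p \<bullet> y) (at (\<theta>s, 0)) (y, 0)
        + (\<Sum>i<l. u i * frechet_derivative (\<lambda>p. M i p \<bullet> y) (at (\<theta>s, 0)) (y, 0)) > 0"
begin

abbreviation "p0 \<equiv> (\<theta>s, 0::real)"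
abbreviation "A \<equiv> {i. i < l \<and> \<phi> i p0 = 0}"
abbreviation "B \<equiv> {i. i < l \<and> \<phi> i p0 \<noteq> 0}"

lemma sum_AB: "(\<Sum>i<l. f i) = (\<Sum>i\<in>A. f i) + (\<Sum>i\<in>B. (f i :: 'b::comm_monoid_add))"
proof -
  have "{..<l} = A \<union> B" by auto
  then show ?thesis by (simp only:) (rule sum.union_disjoint, auto)
qed

lemma u_B: "i \<in> B \<Longrightarrow> u i = 0"
  using compl by auto

text \<open>The equations for the multipliers of the constraints inactive at \<open>p0\<close> are eliminated; those of
  the active ones are placed in coordinates of \<open>'a\<close>, which is possible because their gradients are
  independent.\<close>

lemma central_path:
  obtains V g m where "open V" "(0, 0) \<in> V" "g (0, 0) = \<theta>s" "C1_on V g"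
    "\<And>i. i \<in> A \<Longrightarrow> isCont (m i) (0, 0)" "\<And>i. i \<in> A \<Longrightarrow> m i (0, 0) = u i"
    "\<And>t. t \<in> V \<Longrightarrow> M0 (g t, snd t) + (\<Sum>i\<in>A. m i t *\<^sub>R M i (g t, snd t))
        + (\<Sum>i\<in>B. (- fst t / \<phi> i (g t, snd t)) *\<^sub>R M i (g t, snd t)) = 0"
    "\<And>t i. t \<in> V \<Longrightarrow> i \<in> A \<Longrightarrow> m i t * \<phi> i (g t, snd t) = - fst t"
proof -
  obtain \<sigma> where \<sigma>: "inj_on \<sigma> A" "\<sigma> ` A \<subseteq> (Basis :: 'a set)"
    by (rule independent_family_inj_Basis[of A "\<lambda>i. M i p0"]) (use LICQ in auto)
  \<comment> \<open>A point \<open>z\<close> is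
    \<open>((\<theta>, q), (\<epsilon>, \<gamma>))\<close>, where the vector \<open>q\<close>
    carries the active multipliers in its \<sigma>-coordinates.\<close>
  define P where "P = (\<lambda>z :: ('a \<times> 'a) \<times> (real \<times> real). (fst (fst z), snd (snd z)))"
  define \<mu> where "\<mu> = (\<lambda>i (z :: ('a \<times> 'a) \<times> (real \<times> real)). snd (fst z) \<bullet> \<sigma> i)"
  define \<epsilon> where "\<epsilon> = (\<lambda>z :: ('a \<times> 'a) \<times> (real \<times> real). fst (snd z))"
  define F1 where "F1 = (\<lambda>z. M0 (P z) + (\<Sum>i\<in>A. \<mu> i z *\<^sub>R M i (P z)) + (\<Sum>i\<in>B. (- \<epsilon> z / \<phi> i (P z)) *\<^sub>R M i (P z)))"
  \<comment> \<open>Coordinates of \<open>q\<close> that carry no multiplier are forced to 0, which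
    makes the number of equations equal to the number of unknowns.\<close>
  define F2 where "F2 = (\<lambda>z. (\<Sum>i\<in>A. (\<mu> i z * \<phi> i (P z) + \<epsilon> z) *\<^sub>R \<sigma> i) + (\<Sum>b\<in>Basis - \<sigma> ` A. (snd (fst z) \<bullet> b) *\<^sub>R b))"
  define x0 where "x0 = (\<theta>s, \<Sum>i\<in>A. u i *\<^sub>R \<sigma> i)"
  let ?z0 = "(x0, (0, 0)) :: ('a \<times> 'a) \<times> (real \<times> real)"
  have blP: "bounded_linear P" unfolding P_def
    by (intro bounded_linear_Pair bounded_linear_compose[OF bounded_linear_fst bounded_linear_fst]
        bounded_linear_compose[OF bounded_linear_snd bounded_linear_snd])
  have Pz0: "P ?z0 = p0" by (simp add: P_def x0_def)
  have \<sigma>\<sigma>: "\<sigma> i \<bullet> \<sigma> j = (if i = j then 1 else 0)" if "i \<in> A" "j \<in> A" for i j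
    using \<sigma> that by (auto simp: inner_Basis inj_on_def image_subset_iff)
  have \<mu>0: "\<mu> j ?z0 = u j" if "j \<in> A" for j
  proof -
    have "\<mu> j ?z0 = (\<Sum>i\<in>A. u i * (\<sigma> i \<bullet> \<sigma> j))"
      by (simp add: \<mu>_def x0_def inner_sum_left)
    also have "\<dots> = (\<Sum>i\<in>A. if i = j then u i else 0)"
      using that by (intro sum.cong) (auto simp: \<sigma>\<sigma>)
    finally have "\<mu> j ?z0 = (\<Sum>i\<in>A. if i = j then u i else 0)" .
    then show ?thesis using that by simp
  qed
  have C1P: "C1_at (\<lambda>z. f (P z)) ?z0" if "C1_at f p0" for f
    by (rule C1_at_compose_linear[OF blP]) (use that Pz0 in simp)
  have C1\<mu>: "C1_at (\<mu> i) z" for i z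
    unfolding \<mu>_def by (intro C1_at_linear bounded_linear_compose[OF bounded_linear_inner_left]
      bounded_linear_compose[OF bounded_linear_snd bounded_linear_fst])
  have C1\<epsilon>: "C1_at \<epsilon> z" for z
    unfolding \<epsilon>_def by (intro C1_at_linear bounded_linear_compose[OF bounded_linear_fst bounded_linear_snd])
  have C1b: "C1_at (\<lambda>z. snd (fst z) \<bullet> b) z" for b :: 'a and z :: "('a \<times> 'a) \<times> (real \<times> real)"
    by (intro C1_at_linear bounded_linear_compose[OF bounded_linear_inner_left]
      bounded_linear_compose[OF bounded_linear_snd bounded_linear_fst])
  \<comment> \<open>The factor \<epsilon> is split off so that both product-rule terms vanish at the
    origin in directions that leave the parameters fixed; inactive constraints thus drop out of the
    linearisation.\<close>
  have F1b: "F1 z \<bullet> b = M0 (P z) \<bullet> b + (\<Sum>i\<in>A. \<mu> i z * (M i (P z) \<bullet> b)) + (\<Sum>i\<in>B. \<epsilon> z * (- (M i (P z) \<bullet> b) / \<phi> i (P z)))" for z b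
    by (simp add: F1_def inner_add_left inner_sum_left)
  have F2b: "F2 z \<bullet> b = (\<Sum>i\<in>A. (\<mu> i z * \<phi> i (P z) + \<epsilon> z) * (\<sigma> i \<bullet> b)) + (\<Sum>c\<in>Basis - \<sigma> ` A. (snd (fst z) \<bullet> c) * (c \<bullet> b))" for z b
    by (simp add: F2_def inner_add_left inner_sum_left)
  have C1B: "C1_at (\<lambda>z. - (M i (P z) \<bullet> b) / \<phi> i (P z)) ?z0" if "i \<in> B" for i b
    using that Pz0 by (intro C1_at_divide C1_at_minus C1P[OF M_C1] C1P[OF \<phi>_C1]) auto
  have C1F1: "C1_at (\<lambda>z. F1 z \<bullet> b) ?z0" for b
    unfolding F1b by (intro C1_at_add C1_at_sum C1_at_mult C1P[OF M0_C1] C1P[OF M_C1] C1\<mu> C1\<epsilon> C1B) auto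
  have C1F2: "C1_at (\<lambda>z. F2 z \<bullet> b) ?z0" for b
    unfolding F2b by (intro C1_at_add C1_at_sum C1_at_mult C1P[OF \<phi>_C1] C1\<mu> C1\<epsilon> C1b C1_at_const) auto
  define F where "F = (\<lambda>z. (F1 z, F2 z))"
  have Fb: "F z \<bullet> b = F1 z \<bullet> fst b + F2 z \<bullet> snd b" for z b
    by (simp add: F_def inner_prod_def)
  have F2\<sigma>: "F2 z \<bullet> \<sigma> j = \<mu> j z * \<phi> j (P z) + \<epsilon> z" if "j \<in> A" for z j
  proof -
    have "(\<Sum>c\<in>Basis - \<sigma> ` A. (snd (fst z) \<bullet> c) * (c \<bullet> \<sigma> j)) = 0"
      using that \<sigma> by (intro sum.neutral) (auto simp: inner_Basis image_subset_iff)
    moreover have "(\<Sum>i\<in>A. (\<mu> i z * \<phi> i (P z) + \<epsilon> z) * (\<sigma> i \<bullet> \<sigma> j)) = (\<Sum>i\<in>A. if i = j then \<mu> i z * \<phi> i (P z) + \<epsilon> z else 0)"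
      using that by (intro sum.cong) (auto simp: \<sigma>\<sigma>)
    ultimately show ?thesis using that unfolding F2b by simp
  qed
  have F2c: "F2 z \<bullet> c = snd (fst z) \<bullet> c" if c: "c \<in> Basis - \<sigma> ` A" for z c
  proof -
    have "(\<Sum>i\<in>A. (\<mu> i z * \<phi> i (P z) + \<epsilon> z) * (\<sigma> i \<bullet> c)) = 0"
      using c \<sigma> by (intro sum.neutral) (auto simp: inner_Basis image_subset_iff)
    moreover have "(\<Sum>d\<in>Basis - \<sigma> ` A. (snd (fst z) \<bullet> d) * (d \<bullet> c)) = (\<Sum>d\<in>Basis - \<sigma> ` A. if d = c then snd (fst z) \<bullet> d else 0)"
      using c by (intro sum.cong) (auto simp: inner_Basis)
    ultimately show ?thesis using c unfolding F2b by simp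
  qed
  have F0: "F ?z0 = 0"
  proof -
    have "F1 ?z0 = 0"
      using stat by (simp add: F1_def Pz0 \<epsilon>_def \<mu>0 sum_AB u_B)
    moreover have "F2 ?z0 = 0"
    proof (rule euclidean_eqI)
      fix b :: 'a assume b: "b \<in> Basis"
      show "F2 ?z0 \<bullet> b = 0 \<bullet> b"
      proof (cases "b \<in> \<sigma> ` A")
        case True
        then obtain j where "j \<in> A" "b = \<sigma> j" by blast
        then show ?thesis by (simp add: F2\<sigma> Pz0 \<epsilon>_def)
      next
        case False
        then have "snd (fst ?z0) \<bullet> b = 0"
          using b \<sigma> by (auto simp: x0_def inner_sum_left inner_Basis image_subset_iff intro!: sum.neutral)
        then show ?thesis using F2c[of b ?z0] b False by simp
      qed
    qed
    ultimately show ?thesis by (simp add: F_def zero_prod_def)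
  qed
  have C1F: "C1_at (\<lambda>z. F z \<bullet> b) ?z0" for b
    unfolding Fb by (intro C1_at_add C1F1 C1F2)
  have inj: "h = 0" if h0: "\<And>b. frechet_derivative (\<lambda>z. F z \<bullet> b) (at ?z0) (h, 0) = 0" for h
  proof -
    obtain y \<nu> where h: "h = (y, \<nu>)" by (cases h)
    have h1: "frechet_derivative (\<lambda>z. F1 z \<bullet> b) (at ?z0) ((y, \<nu>), 0) = 0" for b
      using h0[of "(b, 0)"] by (simp add: Fb h)
    have h2: "frechet_derivative (\<lambda>z. F2 z \<bullet> b) (at ?z0) ((y, \<nu>), 0) = 0" for b
      using h0[of "(0, b)"] by (simp add: Fb h)
    have PD: "((\<lambda>z. f (P z)) has_derivative (\<lambda>e. frechet_derivative f (at p0) (P e))) (at ?z0)" if "C1_at f p0" for f :: "'a \<times> real \<Rightarrow> real"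
      using has_derivative_compose[OF bounded_linear_imp_has_derivative[OF blP], of f _ ?z0] C1_at_has_derivative[OF that]
      by (simp add: Pz0)
    have Ph: "P ((y, \<nu>), 0) = (y, 0)" by (simp add: P_def)
    have D\<mu>: "(\<mu> i has_derivative \<mu> i) (at z)" for i z
      unfolding \<mu>_def by (intro bounded_linear_imp_has_derivative bounded_linear_compose[OF bounded_linear_inner_left]
          bounded_linear_compose[OF bounded_linear_snd bounded_linear_fst])
    have D\<epsilon>: "(\<epsilon> has_derivative \<epsilon>) (at z)" for z
      unfolding \<epsilon>_def by (intro bounded_linear_imp_has_derivative bounded_linear_compose[OF bounded_linear_fst bounded_linear_snd])
    have DF1: "((\<lambda>z. F1 z \<bullet> b) has_derivative (\<lambda>e. frechet_derivative (\<lambda>p. M0 p \<bullet> b) (at p0) (P e) +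
         (\<Sum>i\<in>A. \<mu> i ?z0 * frechet_derivative (\<lambda>p. M i p \<bullet> b) (at p0) (P e) + \<mu> i e * (M i (P ?z0) \<bullet> b)) +
         (\<Sum>i\<in>B. \<epsilon> ?z0 * frechet_derivative (\<lambda>z. - (M i (P z) \<bullet> b) / \<phi> i (P z)) (at ?z0) e
             + \<epsilon> e * (- (M i (P ?z0) \<bullet> b) / \<phi> i (P ?z0))))) (at ?z0)" for b
      unfolding F1b
      by (intro has_derivative_add has_derivative_sum has_derivative_mult D\<mu> D\<epsilon> PD[OF M0_C1] PD[OF M_C1] C1_at_has_derivative[OF C1B]) auto
    have e1: "frechet_derivative (\<lambda>p. M0 p \<bullet> b) (at p0) (y, 0) +
         (\<Sum>i\<in>A. u i * frechet_derivative (\<lambda>p. M i p \<bullet> b) (at p0) (y, 0)) + (\<Sum>i\<in>A. (\<nu> \<bullet> \<sigma> i) * (M i p0 \<bullet> b)) = 0" for b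
    proof -
      have "\<epsilon> ?z0 = 0" "\<epsilon> ((y, \<nu>), 0) = 0" "\<mu> i ((y, \<nu>), 0) = \<nu> \<bullet> \<sigma> i" for i
        by (simp_all add: \<epsilon>_def \<mu>_def)
      then show ?thesis
        using h1[of b] frechet_derivative_at[OF DF1[of b], symmetric]
        by (simp add: Ph Pz0 \<mu>0 sum.distrib add.assoc)
    qed
    have crit: "M i p0 \<bullet> y = 0" if i: "i \<in> A" for i
    proof -
      have "((\<lambda>z. F2 z \<bullet> \<sigma> i) has_derivative (\<lambda>e. (\<mu> i ?z0 * frechet_derivative (\<phi> i) (at p0) (P e) + \<mu> i e * \<phi> i (P ?z0)) + \<epsilon> e)) (at ?z0)"
        unfolding F2\<sigma>[OF i] using i
        by (intro has_derivative_add has_derivative_mult D\<mu> D\<epsilon> PD[OF \<phi>_C1]) auto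
      from frechet_derivative_at[OF this, symmetric] h2[of "\<sigma> i"]
      have "u i * (M i p0 \<bullet> y) = 0"
        using i by (simp add: Ph Pz0 \<mu>0 \<phi>_deriv0 \<epsilon>_def)
      then show ?thesis using strict[of i] i by auto
    qed
    have "(\<Sum>i<l. u i * frechet_derivative (\<lambda>p. M i p \<bullet> y) (at p0) (y, 0)) = (\<Sum>i\<in>A. u i * frechet_derivative (\<lambda>p. M i p \<bullet> y) (at p0) (y, 0))"
      by (simp add: sum_AB u_B)
    moreover have "(\<Sum>i\<in>A. (\<nu> \<bullet> \<sigma> i) * (M i p0 \<bullet> y)) = 0" using crit by (intro sum.neutral) auto
    \<comment> \<open>Testing the linearised stationarity with \<open>y\<close> itself kills the
      multiplier terms by \<open>crit\<close>; what remains is the form that SOSC makes positive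
      unless \<open>y\<close> is 0.\<close>
    ultimately have "y = 0" using SOSC[of y] crit e1[of y] by fastforce
    have fz: "frechet_derivative f (at p0) (y, 0) = 0" if "C1_at f p0" for f :: "'a \<times> real \<Rightarrow> real"
    proof -
      have "linear (frechet_derivative f (at p0))"
        by (intro bounded_linear.linear has_derivative_bounded_linear[OF C1_at_has_derivative[OF that]])
      from linear_0[OF this] show ?thesis using \<open>y = 0\<close> by (simp add: zero_prod_def)
    qed
    have orth: "(\<Sum>i\<in>A. (\<nu> \<bullet> \<sigma> i) *\<^sub>R M i p0) \<bullet> b = 0" for b
    proof -
      have "(\<Sum>i\<in>A. u i * frechet_derivative (\<lambda>p. M i p \<bullet> b) (at p0) (y, 0)) = 0"
        by (intro sum.neutral) (auto simp: fz[OF M_C1])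
      then show ?thesis using e1[of b] fz[OF M0_C1[of b]] by (simp add: inner_sum_left)
    qed
    have "(\<Sum>i\<in>A. (\<nu> \<bullet> \<sigma> i) *\<^sub>R M i p0) = 0"
      using orth inner_eq_zero_iff by blast
    then have \<nu>A: "\<forall>i\<in>A. \<nu> \<bullet> \<sigma> i = 0" by (rule LICQ)
    have "\<nu> = 0"
    proof (rule euclidean_eqI)
      fix b :: 'a assume b: "b \<in> Basis"
      show "\<nu> \<bullet> b = 0 \<bullet> b"
      proof (cases "b \<in> \<sigma> ` A")
        case False
        have "bounded_linear (\<lambda>z :: ('a \<times> 'a) \<times> (real \<times> real). snd (fst z) \<bullet> b)"
          by (intro bounded_linear_compose[OF bounded_linear_inner_left]
              bounded_linear_compose[OF bounded_linear_snd bounded_linear_fst])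
        then have "((\<lambda>z. F2 z \<bullet> b) has_derivative (\<lambda>z. snd (fst z) \<bullet> b)) (at ?z0)"
          using F2c[of b] b False by (simp add: bounded_linear_imp_has_derivative)
        from frechet_derivative_at[OF this, symmetric] h2[of b] show ?thesis by simp
      qed (use \<nu>A in auto)
    qed
    then show ?thesis by (simp add: h \<open>y = 0\<close> zero_prod_def)
  qed
  obtain V G where V: "open V" "(0, 0) \<in> V" "G (0, 0) = x0" and FG: "\<And>t. t \<in> V \<Longrightarrow> F (G t, t) = 0" and C1G: "C1_on V G"
    by (rule implicit_function_C1[OF C1F F0 inj]) blast+
  define g where "g = (\<lambda>t. fst (G t))"
  define m where "m = (\<lambda>i t. snd (G t) \<bullet> \<sigma> i)"
  show ?thesis
  proof (rule that)
    show "open V" "(0, 0) \<in> V" "g (0, 0) = \<theta>s" using V by (auto simp: g_def x0_def)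
    obtain D where D: "\<And>t. t \<in> V \<Longrightarrow> (G has_derivative blinfun_apply (D t)) (at t)" "continuous_on V D"
      using C1G by (auto simp: C1_on_def)
    have fst_D: "(fst_blinfun o\<^sub>L D t) e = fst (D t e)" for t e
      by (simp add: fst_blinfun.rep_eq)
    show "C1_on V g"
      unfolding C1_on_def
    proof (intro exI conjI ballI)
      show "(g has_derivative (fst_blinfun o\<^sub>L D t)) (at t)" if "t \<in> V" for t
        unfolding g_def fst_D using D(1)[OF that] by (rule has_derivative_fst)
      show "continuous_on V (\<lambda>t. fst_blinfun o\<^sub>L D t)"
        by (rule continuous_on_blinfun_componentwise) (use D(2) in \<open>auto simp: fst_D intro!: continuous_intros\<close>)
    qed
    have "isCont G (0, 0)" using D(1)[OF V(2)] has_derivative_continuous by blast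
    then show "isCont (m i) (0, 0)" for i
      unfolding m_def by (intro continuous_intros)
    show "m i (0, 0) = u i" if "i \<in> A" for i
      using \<mu>0[OF that] by (simp add: m_def V(3) \<mu>_def)
    fix t assume t: "t \<in> V"
    have "F1 (G t, t) = 0" "F2 (G t, t) = 0" using FG[OF t] by (auto simp: F_def zero_prod_def)
    then show "M0 (g t, snd t) + (\<Sum>i\<in>A. m i t *\<^sub>R M i (g t, snd t))
        + (\<Sum>i\<in>B. (- fst t / \<phi> i (g t, snd t)) *\<^sub>R M i (g t, snd t)) = 0"
      by (simp add: F1_def P_def \<mu>_def \<epsilon>_def g_def m_def)
    show "m i t * \<phi> i (g t, snd t) = - fst t" if "i \<in> A" for i
      using F2\<sigma>[OF that, of "(G t, t)"] \<open>F2 (G t, t) = 0\<close>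
      by (simp add: P_def \<mu>_def \<epsilon>_def g_def m_def)
  qed
qed

end

section \<open>Restriction to fixed \<gamma> and isolated minimizers\<close>

lemma C1_at_section:
  assumes "C1_at f (x, \<gamma>)"
  shows "C1_at (\<lambda>\<theta>. f (\<theta>, \<gamma>)) x"
    and "frechet_derivative (\<lambda>\<theta>. f (\<theta>, \<gamma>)) (at x) e = frechet_derivative f (at (x, \<gamma>)) (e, 0)"
proof -
  have bl: "bounded_linear (\<lambda>\<theta>. (\<theta>, 0))"
    by (intro bounded_linear_Pair bounded_linear_ident bounded_linear_zero)
  show "C1_at (\<lambda>\<theta>. f (\<theta>, \<gamma>)) x"
    using C1_at_compose_affine[OF bl, of f x "(0, \<gamma>)"] assms by simp
  have "((\<lambda>\<theta>. (\<theta>, \<gamma>)) has_derivative (\<lambda>e. (e, 0))) (at x)"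
    by (auto intro!: derivative_eq_intros)
  from has_derivative_compose[OF this C1_at_has_derivative[OF assms]]
  show "frechet_derivative (\<lambda>\<theta>. f (\<theta>, \<gamma>)) (at x) e = frechet_derivative f (at (x, \<gamma>)) (e, 0)"
    by (simp add: frechet_derivative_at[symmetric])
qed

lemma frechet_section_quadratic_form:
  fixes N :: "'a::euclidean_space \<times> real \<Rightarrow> 'a"
  assumes "\<And>b. b \<in> Basis \<Longrightarrow> C1_at (\<lambda>p. N p \<bullet> b) (x, \<gamma>)" and "C1_at (\<lambda>p. N p \<bullet> y) (x, \<gamma>)"
  shows "frechet_derivative (\<lambda>p. N p \<bullet> y) (at (x, \<gamma>)) (e, 0) =
     (\<Sum>b\<in>Basis. \<Sum>c\<in>Basis. frechet_derivative (\<lambda>p. N p \<bullet> b) (at (x, \<gamma>)) (c, 0) * (y \<bullet> b) * (e \<bullet> c))"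
proof -
  have "((\<lambda>\<theta>. N (\<theta>, \<gamma>) \<bullet> y) has_derivative
     (\<lambda>e. \<Sum>b\<in>Basis. \<Sum>c\<in>Basis. frechet_derivative (\<lambda>\<theta>. N (\<theta>, \<gamma>) \<bullet> b) (at x) c * (y \<bullet> b) * (e \<bullet> c))) (at x)"
    by (intro frechet_quadratic_form C1_at_section(1)[of "\<lambda>p. N p \<bullet> _"] assms)
  from frechet_derivative_at[OF this, symmetric]
  have "frechet_derivative (\<lambda>\<theta>. N (\<theta>, \<gamma>) \<bullet> y) (at x) e =
     (\<Sum>b\<in>Basis. \<Sum>c\<in>Basis. frechet_derivative (\<lambda>\<theta>. N (\<theta>, \<gamma>) \<bullet> b) (at x) c * (y \<bullet> b) * (e \<bullet> c))" by simp
  then show ?thesis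
    using C1_at_section(2)[of "\<lambda>p. N p \<bullet> _", OF assms(1)] C1_at_section(2)[of "\<lambda>p. N p \<bullet> _", OF assms(2)]
    by simp
qed

lemma square_inner_eq_sum:
  fixes v y :: "'a::euclidean_space"
  shows "(v \<bullet> y)\<^sup>2 = (\<Sum>b\<in>Basis. \<Sum>c\<in>Basis. (v \<bullet> b) * (v \<bullet> c) * (y \<bullet> b) * (y \<bullet> c))"
  unfolding power2_eq_square
  by (subst (1 2) euclidean_inner[of v y]) (simp add: sum_product mult_ac)

text \<open>Near \<open>x\<close> the set \<open>S\<close> contains a full neighbourhood, so another
  local minimizer \<open>y\<close> would be a critical point with \<open>N y = 0\<close>, against
  the sign of the inner product of \<open>N y\<close> with \<open>y - x\<close>.\<close>

lemma isolated_local_min_onI: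
  fixes f :: "'a::euclidean_space \<Rightarrow> real"
  assumes dom: "\<forall>\<^sub>F y in nhds x. y \<in> S"
    and min: "\<forall>\<^sub>F y in nhds x. y \<noteq> x \<longrightarrow> f x < f y \<and> N y \<bullet> (y - x) > 0"
    and der: "\<forall>\<^sub>F y in nhds x. (f has_derivative (\<lambda>e. N y \<bullet> e)) (at y)"
  shows "isolated_local_min_on f S x"
proof -
  have "\<forall>\<^sub>F y in nhds x. y \<in> S \<and> (y \<noteq> x \<longrightarrow> f x < f y \<and> N y \<bullet> (y - x) > 0) \<and> (f has_derivative (\<lambda>e. N y \<bullet> e)) (at y)"
    using dom min der by eventually_elim auto
  then obtain \<rho> where "\<rho> > 0" and \<rho>: "\<And>y. dist y x < \<rho> \<Longrightarrow> y \<in> S \<and> (y \<noteq> x \<longrightarrow> f x < f y \<and> N y \<bullet> (y - x) > 0) \<and> (f has_derivative (\<lambda>e. N y \<bullet> e)) (at y)"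
    unfolding eventually_nhds_metric by blast
  have "local_min_on f S x"
    unfolding local_min_on_def using \<rho>[of x] \<open>\<rho> > 0\<close> \<rho> by (metis dist_self less_eq_real_def)
  moreover have "y = x" if y: "dist y x < \<rho>" "local_min_on f S y" for y
  proof (rule ccontr)
    assume "y \<noteq> x"
    with \<rho>[OF y(1)] have N: "N y \<bullet> (y - x) > 0" by auto
    obtain r where r: "r > 0" "\<forall>z\<in>S. dist z y < r \<longrightarrow> f y \<le> f z"
      using y(2) by (auto simp: local_min_on_def)
    have "(\<lambda>e. N y \<bullet> e) = (\<lambda>e. 0)"
    proof (rule differential_zero_maxmin)
      show "y \<in> ball y r \<inter> ball x \<rho>" using r y by (auto simp: dist_commute)
      show "(f has_derivative (\<lambda>e. N y \<bullet> e)) (at y)" using \<rho>[OF y(1)] by auto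
      show "(\<forall>z\<in>ball y r \<inter> ball x \<rho>. f z \<le> f y) \<or> (\<forall>z\<in>ball y r \<inter> ball x \<rho>. f y \<le> f z)"
        using r \<rho> by (auto simp: dist_commute)
    qed auto
    from fun_cong[OF this, of "y - x"] N show False by simp
  qed
  ultimately show ?thesis using \<open>\<rho> > 0\<close> by (auto simp: isolated_local_min_on_def)
qed

context log_barrier
begin

text \<open>The locale speaks about germs at \<open>p0\<close>; this pointwise form holds on a whole
  neighbourhood and so can be used at the points of the central path.\<close>

definition regular :: "'a \<times> real \<Rightarrow> bool" where
  "regular p \<longleftrightarrow> (\<forall>b\<in>Basis. C1_at (\<lambda>p. M0 p \<bullet> b) p \<and> (\<forall>i<l. C1_at (\<lambda>p. M i p \<bullet> b) p)) \<and> (\<forall>i<l. C1_at (\<phi> i) p) \<and>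
     (snd p > 0 \<longrightarrow> ((\<lambda>\<theta>. \<phi>0 (\<theta>, snd p)) has_derivative (\<lambda>e. M0 p \<bullet> e)) (at (fst p)) \<and>
        (\<forall>i<l. ((\<lambda>\<theta>. \<phi> i (\<theta>, snd p)) has_derivative (\<lambda>e. M i p \<bullet> e)) (at (fst p))))"

lemma eventually_regular: "\<forall>\<^sub>F p in nhds p0. regular p"
proof -
  have "\<forall>\<^sub>F p in nhds p0. \<forall>b\<in>Basis. C1_at (\<lambda>p. M0 p \<bullet> b) p \<and> (\<forall>i\<in>{..<l}. C1_at (\<lambda>p. M i p \<bullet> b) p)"
    by (intro eventually_ball_finite eventually_conj ballI C1_at_eventually M0_C1 M_C1) auto
  moreover have "\<forall>\<^sub>F p in nhds p0. \<forall>i\<in>{..<l}. C1_at (\<phi> i) p \<and>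
      (snd p > 0 \<longrightarrow> ((\<lambda>\<theta>. \<phi> i (\<theta>, snd p)) has_derivative (\<lambda>e. M i p \<bullet> e)) (at (fst p)))"
    by (intro eventually_ball_finite eventually_conj ballI C1_at_eventually \<phi>_C1 \<phi>_deriv) auto
  ultimately show ?thesis using \<phi>0_deriv
    by eventually_elim (auto simp: regular_def)
qed

lemma C1_at_inner_all:
  assumes "\<And>b. b \<in> Basis \<Longrightarrow> C1_at (\<lambda>p. (N p :: 'a) \<bullet> b) p"
  shows "C1_at (\<lambda>p. N p \<bullet> y) p"
  unfolding euclidean_inner[of _ y] by (intro C1_at_sum C1_at_mult assms C1_at_const)

text \<open>The assumptions \<open>st\<close> and \<open>pd\<close> are the first- and second-order
  conditions of the barrier function: \<open>- \<epsilon> / \<phi>\<close> acts as multiplier, and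
  differentiating it produces the squared gradient terms with factor
  \<open>\<epsilon> / \<phi>\<^sup>2\<close>.\<close>

lemma isolated_min_if_pos_def:
  assumes reg: "\<forall>\<^sub>F q in nhds (x, \<gamma>). regular q" and \<gamma>: "\<gamma> > 0" and \<epsilon>: "\<epsilon> > 0"
    and neg: "\<And>i. i < l \<Longrightarrow> \<phi> i (x, \<gamma>) < 0"
    and st: "M0 (x, \<gamma>) + (\<Sum>i<l. (- \<epsilon> / \<phi> i (x, \<gamma>)) *\<^sub>R M i (x, \<gamma>)) = 0"
    and pd: "\<And>y. y \<noteq> 0 \<Longrightarrow> frechet_derivative (\<lambda>p. M0 p \<bullet> y) (at (x, \<gamma>)) (y, 0)
        + (\<Sum>i<l. (- \<epsilon> / \<phi> i (x, \<gamma>)) * frechet_derivative (\<lambda>p. M i p \<bullet> y) (at (x, \<gamma>)) (y, 0))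
        + (\<Sum>i<l. \<epsilon> / (\<phi> i (x, \<gamma>))\<^sup>2 * (M i (x, \<gamma>) \<bullet> y)\<^sup>2) > 0"
  shows "isolated_local_min_on (\<lambda>\<theta>. \<phi>0 (\<theta>, \<gamma>) - \<epsilon> * (\<Sum>i<l. ln (- \<phi> i (\<theta>, \<gamma>)))) {\<theta>. \<forall>i<l. \<phi> i (\<theta>, \<gamma>) < 0} x"
    and "\<exists>\<rho>>0. \<forall>\<theta>\<in>ball x \<rho>. \<forall>i<l. \<phi> i (\<theta>, \<gamma>) < 0"
proof -
  have rx: "regular (x, \<gamma>)" using reg by (rule eventually_nhds_x_imp_x)
  define S where "S = (\<lambda>\<theta>. \<phi>0 (\<theta>, \<gamma>) - \<epsilon> * (\<Sum>i<l. ln (- \<phi> i (\<theta>, \<gamma>))))"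
  define N where "N = (\<lambda>p. M0 p + (\<Sum>i<l. (- \<epsilon> / \<phi> i p) *\<^sub>R M i p))"
  have tend: "((\<lambda>\<theta>. (\<theta>, \<gamma>)) \<longlongrightarrow> (x, \<gamma>)) (nhds x)"
    by (intro tendsto_intros filterlim_ident)
  have reg': "\<forall>\<^sub>F \<theta> in nhds x. regular (\<theta>, \<gamma>)"
    using tend reg by (simp add: filterlim_iff)
  have "\<forall>\<^sub>F q in nhds (x, \<gamma>). \<forall>i\<in>{..<l}. \<phi> i q < 0"
  proof (intro eventually_ball_finite ballI)
    fix i assume "i \<in> {..<l}"
    then have "i < l" by simp
    then have "isCont (\<phi> i) (x, \<gamma>)" using rx by (intro C1_at_isCont) (auto simp: regular_def)
    then show "\<forall>\<^sub>F q in nhds (x, \<gamma>). \<phi> i q < 0"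
      using neg[OF \<open>i < l\<close>] by (intro order_tendstoD(2)[OF isCont_tendsto_nhds])
  qed simp
  then have neg': "\<forall>\<^sub>F \<theta> in nhds x. \<forall>i<l. \<phi> i (\<theta>, \<gamma>) < 0"
    using tend by (auto simp: filterlim_iff lessThan_def)
  then show "\<exists>\<rho>>0. \<forall>\<theta>\<in>ball x \<rho>. \<forall>i<l. \<phi> i (\<theta>, \<gamma>) < 0"
    unfolding eventually_nhds_metric by (auto simp: dist_commute)
  have dS: "\<forall>\<^sub>F \<theta> in nhds x. (S has_derivative (\<lambda>e. N (\<theta>, \<gamma>) \<bullet> e)) (at \<theta>)"
    using reg' neg'
  proof eventually_elim
    case (elim \<theta>)
    have d0: "((\<lambda>\<theta>. \<phi>0 (\<theta>, \<gamma>)) has_derivative (\<lambda>e. M0 (\<theta>, \<gamma>) \<bullet> e)) (at \<theta>)"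
      and di: "\<And>i. i < l \<Longrightarrow> ((\<lambda>\<theta>. \<phi> i (\<theta>, \<gamma>)) has_derivative (\<lambda>e. M i (\<theta>, \<gamma>) \<bullet> e)) (at \<theta>)"
      using elim(1) \<gamma> by (auto simp: regular_def)
    have "((\<lambda>\<theta>. ln (- \<phi> i (\<theta>, \<gamma>))) has_derivative (\<lambda>e. M i (\<theta>, \<gamma>) \<bullet> e / \<phi> i (\<theta>, \<gamma>))) (at \<theta>)" if "i < l" for i
    proof -
      have "\<phi> i (\<theta>, \<gamma>) < 0" using elim(2) that by auto
      then show ?thesis
        using that by (auto intro!: derivative_eq_intros di simp: divide_inverse mult.commute)
    qed
    then have "(S has_derivative (\<lambda>e. M0 (\<theta>, \<gamma>) \<bullet> e - \<epsilon> * (\<Sum>i<l. M i (\<theta>, \<gamma>) \<bullet> e / \<phi> i (\<theta>, \<gamma>)))) (at \<theta>)"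
      unfolding S_def by (intro has_derivative_diff has_derivative_mult_right has_derivative_sum d0) auto
    moreover have "N (\<theta>, \<gamma>) \<bullet> e = M0 (\<theta>, \<gamma>) \<bullet> e - \<epsilon> * (\<Sum>i<l. M i (\<theta>, \<gamma>) \<bullet> e / \<phi> i (\<theta>, \<gamma>))" for e
      by (simp add: N_def inner_diff_left inner_add_left inner_sum_left sum_distrib_left sum_negf)
    ultimately show ?case by (simp only:)
  qed
  have C0: "C1_at (\<lambda>p. M0 p \<bullet> b) (x, \<gamma>)" for b
    by (rule C1_at_inner_all) (use rx in \<open>auto simp: regular_def\<close>)
  have Ci: "C1_at (\<lambda>p. M i p \<bullet> b) (x, \<gamma>)" "C1_at (\<phi> i) (x, \<gamma>)" if "i < l" for i b
    by (rule C1_at_inner_all) (use rx that in \<open>auto simp: regular_def\<close>)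
  have Nb: "N p \<bullet> b = M0 p \<bullet> b + (\<Sum>i<l. (- \<epsilon> / \<phi> i p) * (M i p \<bullet> b))" for p b
    by (simp add: N_def inner_add_left inner_sum_left)
  have nz: "\<phi> i (x, \<gamma>) \<noteq> 0" if "i < l" for i
    using neg[OF that] by simp
  have CN: "C1_at (\<lambda>p. N p \<bullet> b) (x, \<gamma>)" for b
    unfolding Nb using nz by (intro C1_at_add C1_at_sum C1_at_mult C1_at_divide C0 Ci C1_at_const) auto
  have strict: "\<forall>\<^sub>F \<theta> in nhds x. \<theta> \<noteq> x \<longrightarrow> S x < S \<theta> \<and> N (\<theta>, \<gamma>) \<bullet> (\<theta> - x) > 0"
  proof (rule strict_min_of_pos_def[OF dS])
    show "C1_at (\<lambda>\<theta>. N (\<theta>, \<gamma>) \<bullet> b) x" for b by (rule C1_at_section(1)[OF CN])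
    show "N (x, \<gamma>) = 0" using st by (simp add: N_def)
    fix y :: 'a assume y: "y \<noteq> 0"
    have dphi: "frechet_derivative (\<phi> i) (at (x, \<gamma>)) (y, 0) = M i (x, \<gamma>) \<bullet> y" if "i < l" for i
    proof -
      have "((\<lambda>\<theta>. \<phi> i (\<theta>, \<gamma>)) has_derivative (\<lambda>e. M i (x, \<gamma>) \<bullet> e)) (at x)"
        using rx \<gamma> that by (auto simp: regular_def)
      from frechet_derivative_at[OF this, symmetric]
      have "frechet_derivative (\<lambda>\<theta>. \<phi> i (\<theta>, \<gamma>)) (at x) y = M i (x, \<gamma>) \<bullet> y" by simp
      then show ?thesis using C1_at_section(2)[OF Ci(2)[OF that], of y] by simp
    qed
    have "((\<lambda>p. N p \<bullet> y) has_derivative (\<lambda>e. frechet_derivative (\<lambda>p. M0 p \<bullet> y) (at (x, \<gamma>)) e +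
       (\<Sum>i<l. (- \<epsilon> / \<phi> i (x, \<gamma>)) * frechet_derivative (\<lambda>p. M i p \<bullet> y) (at (x, \<gamma>)) e
           + (\<epsilon> / (\<phi> i (x, \<gamma>))\<^sup>2 * frechet_derivative (\<phi> i) (at (x, \<gamma>)) e) * (M i (x, \<gamma>) \<bullet> y)))) (at (x, \<gamma>))"
      unfolding Nb
    proof (intro has_derivative_add has_derivative_sum has_derivative_mult C1_at_has_derivative C0 Ci)
      fix i assume "i \<in> {..<l}"
      then have i: "i < l" by simp
      then have nz: "\<phi> i (x, \<gamma>) \<noteq> 0" using neg[of i] by auto
      show "((\<lambda>p. - \<epsilon> / \<phi> i p) has_derivative (\<lambda>e. \<epsilon> / (\<phi> i (x, \<gamma>))\<^sup>2 * frechet_derivative (\<phi> i) (at (x, \<gamma>)) e)) (at (x, \<gamma>))"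
        using nz by (auto intro!: derivative_eq_intros C1_at_has_derivative[OF Ci(2)[OF i]] simp: power2_eq_square field_simps)
    qed auto
    from frechet_derivative_at[OF this, symmetric]
    have "frechet_derivative (\<lambda>p. N p \<bullet> y) (at (x, \<gamma>)) (y, 0) = frechet_derivative (\<lambda>p. M0 p \<bullet> y) (at (x, \<gamma>)) (y, 0) +
       (\<Sum>i<l. (- \<epsilon> / \<phi> i (x, \<gamma>)) * frechet_derivative (\<lambda>p. M i p \<bullet> y) (at (x, \<gamma>)) (y, 0)
           + \<epsilon> / (\<phi> i (x, \<gamma>))\<^sup>2 * (M i (x, \<gamma>) \<bullet> y)\<^sup>2)"
      by (simp add: dphi power2_eq_square mult.assoc)
    also have "\<dots> > 0" using pd[OF y] by (simp only: sum.distrib add.assoc)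
    finally show "0 < frechet_derivative (\<lambda>\<theta>. N (\<theta>, \<gamma>) \<bullet> y) (at x) y"
      using C1_at_section(2)[OF CN[of y], of y] by simp
  qed
  show "isolated_local_min_on (\<lambda>\<theta>. \<phi>0 (\<theta>, \<gamma>) - \<epsilon> * (\<Sum>i<l. ln (- \<phi> i (\<theta>, \<gamma>)))) {\<theta>. \<forall>i<l. \<phi> i (\<theta>, \<gamma>) < 0} x"
    by (rule isolated_local_min_onI[where N = "\<lambda>\<theta>. N (\<theta>, \<gamma>)"]) (use neg' strict dS in \<open>auto simp: S_def\<close>)
qed

theorem barrier_minimizers:
  "\<exists>\<epsilon>0>0. \<exists>\<gamma>0>0. \<exists>th :: real \<Rightarrow> real \<Rightarrow> 'a.
     (\<forall>\<epsilon> \<gamma>. 0 < \<epsilon> \<and> \<epsilon> < \<epsilon>0 \<and> 0 < \<gamma> \<and> \<gamma> < \<gamma>0 \<longrightarrow>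
        isolated_local_min_on (\<lambda>\<theta>. \<phi>0 (\<theta>, \<gamma>) - \<epsilon> * (\<Sum>i<l. ln (- \<phi> i (\<theta>, \<gamma>))))
          {\<theta>. \<forall>i<l. \<phi> i (\<theta>, \<gamma>) < 0} (th \<epsilon> \<gamma>) \<and>
        (\<forall>i<l. \<phi> i (th \<epsilon> \<gamma>, \<gamma>) < 0) \<and>
        (\<exists>\<rho>>0. \<forall>\<theta>\<in>ball (th \<epsilon> \<gamma>) \<rho>. \<forall>i<l. \<phi> i (\<theta>, \<gamma>) < 0)) \<and>
     C1_on ({0<..<\<epsilon>0} \<times> {0<..<\<gamma>0}) (\<lambda>p. th (fst p) (snd p)) \<and>
     ((\<lambda>p. th (fst p) (snd p)) \<longlongrightarrow> \<theta>s) (at (0, 0) within ({0<..<\<epsilon>0} \<times> {0<..<\<gamma>0}))"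
proof -
  obtain V g m where V: "open V" "(0, 0) \<in> V" and g0: "g (0, 0) = \<theta>s" and C1g: "C1_on V g"
    and m_cont: "\<And>i. i \<in> A \<Longrightarrow> isCont (m i) (0, 0)" and m0: "\<And>i. i \<in> A \<Longrightarrow> m i (0, 0) = u i"
    and st: "\<And>t. t \<in> V \<Longrightarrow> M0 (g t, snd t) + (\<Sum>i\<in>A. m i t *\<^sub>R M i (g t, snd t))
        + (\<Sum>i\<in>B. (- fst t / \<phi> i (g t, snd t)) *\<^sub>R M i (g t, snd t)) = 0"
    and m\<phi>: "\<And>t i. t \<in> V \<Longrightarrow> i \<in> A \<Longrightarrow> m i t * \<phi> i (g t, snd t) = - fst t"
    by (rule central_path) blast
  define P where "P = (\<lambda>t. (g t, snd t :: real))"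
  have P0: "P (0, 0) = p0" using g0 by (simp add: P_def)
  have gcont: "isCont g (0, 0)"
    using C1g V by (auto simp: C1_on_def intro: has_derivative_continuous)
  then have Pcont: "isCont P (0, 0)" unfolding P_def by (intro continuous_intros)
  have Plim: "(P \<longlongrightarrow> p0) (nhds (0, 0))" using isCont_tendsto_nhds[OF Pcont] P0 by simp
  \<comment> \<open>Off the axis both cases equal \<open>- \<epsilon> / \<phi>\<close>. For active
    constraints that quotient has no value at the origin, whereas \<open>m\<close> is continuous
    there with limit \<open>u\<close>.\<close>
  define w where "w = (\<lambda>i t. if i \<in> A then m i t else - fst t / \<phi> i (P t))"
  have contP: "isCont (\<lambda>t. f (P t)) (0, 0)" if "isCont f p0" for f :: "'a \<times> real \<Rightarrow> real"
    using isCont_o2[OF Pcont] that P0 by simp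
  have wlim: "isCont (w i) (0, 0)" "w i (0, 0) = u i" if "i < l" for i
  proof -
    show "w i (0, 0) = u i" using m0 u_B[of i] that by (auto simp: w_def)
    show "isCont (w i) (0, 0)"
    proof (cases "i \<in> A")
      case True
      then show ?thesis using m_cont by (simp add: w_def)
    next
      case False
      have "isCont (\<lambda>t. - fst t / \<phi> i (P t)) (0, 0)"
        using False that P0 by (intro continuous_intros contP C1_at_isCont \<phi>_C1) auto
      then show ?thesis using False by (simp only: w_def if_False)
    qed
  qed
  \<comment> \<open>The Lagrangian Hessian along the central path, with multipliers
    \<open>w\<close>. It is continuous at the origin, where it becomes the form of SOSC.\<close>
  define H where "H = (\<lambda>t b c. frechet_derivative (\<lambda>p. M0 p \<bullet> b) (at (P t)) (c, 0)
      + (\<Sum>i<l. w i t * frechet_derivative (\<lambda>p. M i p \<bullet> b) (at (P t)) (c, 0)))"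
  have H_form: "(\<Sum>b\<in>Basis. \<Sum>c\<in>Basis. H t b c * (y \<bullet> b) * (y \<bullet> c)) =
      frechet_derivative (\<lambda>p. M0 p \<bullet> y) (at (P t)) (y, 0)
      + (\<Sum>i<l. w i t * frechet_derivative (\<lambda>p. M i p \<bullet> y) (at (P t)) (y, 0))" if "regular (P t)" for t y
  proof -
    have C: "b \<in> Basis \<Longrightarrow> C1_at (\<lambda>p. M0 p \<bullet> b) (P t)" "b \<in> Basis \<Longrightarrow> i < l \<Longrightarrow> C1_at (\<lambda>p. M i p \<bullet> b) (P t)" for b i
      using that by (auto simp: regular_def)
    have C': "C1_at (\<lambda>p. M0 p \<bullet> y) (P t)" "i < l \<Longrightarrow> C1_at (\<lambda>p. M i p \<bullet> y) (P t)" for i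
      by (rule C1_at_inner_all, rule C, assumption+)+
    have "(\<Sum>i<l. w i t * frechet_derivative (\<lambda>p. M i p \<bullet> y) (at (P t)) (y, 0)) =
        (\<Sum>i<l. w i t * (\<Sum>b\<in>Basis. \<Sum>c\<in>Basis. frechet_derivative (\<lambda>p. M i p \<bullet> b) (at (P t)) (c, 0) * (y \<bullet> b) * (y \<bullet> c)))"
      unfolding P_def by (intro sum.cong refl arg_cong2[where f = "(*)"] frechet_section_quadratic_form C(2)[unfolded P_def] C'(2)[unfolded P_def]) auto
    also have "\<dots> = (\<Sum>b\<in>Basis. \<Sum>c\<in>Basis. \<Sum>i<l. w i t * frechet_derivative (\<lambda>p. M i p \<bullet> b) (at (P t)) (c, 0) * (y \<bullet> b) * (y \<bullet> c))"
      unfolding sum_distrib_left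
      by (subst sum.swap, intro sum.cong refl, subst sum.swap, intro sum.cong refl) (simp add: mult.assoc)
    finally have *: "(\<Sum>i<l. w i t * frechet_derivative (\<lambda>p. M i p \<bullet> y) (at (P t)) (y, 0)) = \<dots>" .
    have "frechet_derivative (\<lambda>p. M0 p \<bullet> y) (at (P t)) (y, 0) =
        (\<Sum>b\<in>Basis. \<Sum>c\<in>Basis. frechet_derivative (\<lambda>p. M0 p \<bullet> b) (at (P t)) (c, 0) * (y \<bullet> b) * (y \<bullet> c))"
      unfolding P_def by (intro frechet_section_quadratic_form C(1)[unfolded P_def] C'(1)[unfolded P_def])
    with * show ?thesis
      by (simp add: H_def distrib_right sum.distrib sum_distrib_right)
  qed
  obtain \<kappa> where \<kappa>: "\<kappa> \<ge> 0" "\<And>y. y \<noteq> 0 \<Longrightarrow> (\<Sum>b\<in>Basis. \<Sum>c\<in>Basis. H (0, 0) b c * (y \<bullet> b) * (y \<bullet> c)) + \<kappa> * (\<Sum>i\<in>A. (M i p0 \<bullet> y)\<^sup>2) > 0"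
  proof (rule pos_def_penalty[of A "\<lambda>i. M i p0" "H (0, 0)"])
    fix y assume "y \<noteq> 0" "\<forall>i\<in>A. M i p0 \<bullet> y = 0"
    from SOSC[OF this] show "(\<Sum>b\<in>Basis. \<Sum>c\<in>Basis. H (0, 0) b c * (y \<bullet> b) * (y \<bullet> c)) > 0"
      using eventually_nhds_x_imp_x[OF eventually_regular] wlim(2) by (subst H_form) (auto simp: P0)
  qed auto
  define K where "K = (\<lambda>t b c. H t b c + \<kappa> * (\<Sum>i\<in>A. (M i (P t) \<bullet> b) * (M i (P t) \<bullet> c)))"
  have K_form: "(\<Sum>b\<in>Basis. \<Sum>c\<in>Basis. K t b c * (y \<bullet> b) * (y \<bullet> c)) =
      (\<Sum>b\<in>Basis. \<Sum>c\<in>Basis. H t b c * (y \<bullet> b) * (y \<bullet> c)) + \<kappa> * (\<Sum>i\<in>A. (M i (P t) \<bullet> y)\<^sup>2)" for t y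
  proof -
    have "(\<Sum>i\<in>A. (M i (P t) \<bullet> y)\<^sup>2) = (\<Sum>b\<in>Basis. \<Sum>c\<in>Basis. \<Sum>i\<in>A. (M i (P t) \<bullet> b) * (M i (P t) \<bullet> c) * (y \<bullet> b) * (y \<bullet> c))"
      unfolding square_inner_eq_sum
      by (subst sum.swap, intro sum.cong refl, subst sum.swap, intro sum.cong refl)
    then show ?thesis
      by (simp add: K_def distrib_right sum.distrib sum_distrib_left sum_distrib_right mult.assoc)
  qed
  have "\<forall>\<^sub>F t in nhds (0, 0). \<forall>y. y \<noteq> 0 \<longrightarrow> (\<Sum>b\<in>Basis. \<Sum>c\<in>Basis. K t b c * (y \<bullet> b) * (y \<bullet> c)) > 0"
  proof (rule pos_def_eventually)
    show "((\<lambda>t. K t b c) \<longlongrightarrow> K (0, 0) b c) (nhds (0, 0))" if "b \<in> Basis" "c \<in> Basis" for b c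
      unfolding K_def H_def
      by (intro isCont_tendsto_nhds continuous_intros contP[OF C1_at_isCont_frechet] contP[OF C1_at_isCont] M0_C1 M_C1 wlim) auto
    show "(\<Sum>b\<in>Basis. \<Sum>c\<in>Basis. K (0, 0) b c * (y \<bullet> b) * (y \<bullet> c)) > 0" if "y \<noteq> 0" for y
      using \<kappa>(2)[OF that] by (simp add: K_form P0)
  qed
  moreover have "\<forall>\<^sub>F t in nhds (0, 0). t \<in> V" using V by (rule eventually_nhds_in_open)
  \<comment> \<open>Since \<open>m * \<phi> = - \<epsilon>\<close> on the branch, the bound on
    \<open>(m i t)\<^sup>2\<close> amounts to \<open>\<kappa> < \<epsilon> / \<phi>\<^sup>2\<close>:
    the barrier curvature exceeds the weight from Debreu's lemma. It holds near the origin because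
    \<open>\<kappa> * fst t\<close> tends to 0 and \<open>m i\<close> to
    \<open>u i > 0\<close>.\<close>
  moreover have "\<forall>\<^sub>F t in nhds (0, 0). \<forall>i\<in>A. m i t > 0 \<and> \<kappa> * fst t < (m i t)\<^sup>2"
  proof (intro eventually_ball_finite ballI eventually_conj)
    fix i assume i: "i \<in> A"
    then have ui: "u i > 0" using strict by auto
    show "\<forall>\<^sub>F t in nhds (0, 0). m i t > 0"
      using order_tendstoD(1)[OF isCont_tendsto_nhds[OF m_cont[OF i]]] ui m0[OF i] by simp
    have "isCont (\<lambda>t. (m i t)\<^sup>2 - \<kappa> * fst t) (0, 0)" by (intro continuous_intros m_cont i)
    from order_tendstoD(1)[OF isCont_tendsto_nhds[OF this], of 0]
    show "\<forall>\<^sub>F t in nhds (0, 0). \<kappa> * fst t < (m i t)\<^sup>2"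
      using ui m0[OF i] by simp
  qed auto
  moreover have "\<forall>\<^sub>F t in nhds (0, 0). \<forall>i\<in>B. \<phi> i (P t) < 0"
  proof (intro eventually_ball_finite ballI)
    fix i assume i: "i \<in> B"
    have "isCont (\<lambda>t. \<phi> i (P t)) (0, 0)" using i by (intro contP C1_at_isCont \<phi>_C1) auto
    then show "\<forall>\<^sub>F t in nhds (0, 0). \<phi> i (P t) < 0"
      using order_tendstoD(2)[OF isCont_tendsto_nhds] feas[of i] i P0 by fastforce
  qed auto
  moreover have "\<forall>\<^sub>F t in nhds (0, 0). \<forall>\<^sub>F q in nhds (P t). regular q"
  proof -
    have "\<forall>\<^sub>F p in nhds p0. \<forall>\<^sub>F q in nhds p. regular q"
      using eventually_regular by (simp add: eventually_eventually)
    then show ?thesis using Plim by (rule eventually_compose_filterlim)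
  qed
  ultimately have "\<forall>\<^sub>F t in nhds (0, 0). t \<in> V \<and> (\<forall>\<^sub>F q in nhds (P t). regular q) \<and> (\<forall>i\<in>B. \<phi> i (P t) < 0) \<and>
     (\<forall>i\<in>A. m i t > 0 \<and> \<kappa> * fst t < (m i t)\<^sup>2) \<and> (\<forall>y. y \<noteq> 0 \<longrightarrow> (\<Sum>b\<in>Basis. \<Sum>c\<in>Basis. K t b c * (y \<bullet> b) * (y \<bullet> c)) > 0)"
    by eventually_elim auto
  then obtain d where d: "d > 0" and good: "\<And>t. dist t (0, 0) < d \<Longrightarrow> t \<in> V \<and> (\<forall>\<^sub>F q in nhds (P t). regular q) \<and> (\<forall>i\<in>B. \<phi> i (P t) < 0) \<and>
     (\<forall>i\<in>A. m i t > 0 \<and> \<kappa> * fst t < (m i t)\<^sup>2) \<and> (\<forall>y. y \<noteq> 0 \<longrightarrow> (\<Sum>b\<in>Basis. \<Sum>c\<in>Basis. K t b c * (y \<bullet> b) * (y \<bullet> c)) > 0)"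
    unfolding eventually_nhds_metric by blast
  \<comment> \<open>The distance is at most the sum of the two coordinates, so the square of side
    \<open>d/2\<close> fits into the ball of radius \<open>d\<close>.\<close>
  have box: "dist t (0, 0) < d" if "t \<in> {0<..<d/2} \<times> {0<..<d/2}" for t :: "real \<times> real"
  proof -
    obtain a b where t: "t = (a, b)" by (cases t)
    have "dist t (0, 0) \<le> \<bar>a\<bar> + \<bar>b\<bar>"
      using sqrt_sum_squares_le_sum_abs[of a b] by (simp add: t dist_Pair_Pair)
    then show ?thesis using that t by auto
  qed
  have main: "isolated_local_min_on (\<lambda>\<theta>. \<phi>0 (\<theta>, \<gamma>) - \<epsilon> * (\<Sum>i<l. ln (- \<phi> i (\<theta>, \<gamma>))))
          {\<theta>. \<forall>i<l. \<phi> i (\<theta>, \<gamma>) < 0} (g (\<epsilon>, \<gamma>)) \<and>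
        (\<forall>i<l. \<phi> i (g (\<epsilon>, \<gamma>), \<gamma>) < 0) \<and>
        (\<exists>\<rho>>0. \<forall>\<theta>\<in>ball (g (\<epsilon>, \<gamma>)) \<rho>. \<forall>i<l. \<phi> i (\<theta>, \<gamma>) < 0)"
    if \<epsilon>: "0 < \<epsilon>" "\<epsilon> < d/2" and \<gamma>: "0 < \<gamma>" "\<gamma> < d/2" for \<epsilon> \<gamma>
  proof -
    let ?t = "(\<epsilon>, \<gamma>)"
    have "?t \<in> {0<..<d/2} \<times> {0<..<d/2}" using that by simp
    note G = good[OF box[OF this]]
    have Pt: "P ?t = (g ?t, \<gamma>)" by (simp add: P_def)
    have m\<phi>': "m i ?t * \<phi> i (P ?t) = - \<epsilon>" if "i \<in> A" for i
      using m\<phi>[of ?t i] that G by (simp add: P_def)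
    have neg: "\<phi> i (P ?t) < 0" if "i < l" for i
    proof (cases "i \<in> A")
      case True
      \<comment> \<open>Strict feasibility is automatic: the multiplier stays near
        \<open>u i > 0\<close> while its product with the constraint value is
        \<open>- \<epsilon>\<close>.\<close>
      then have "m i ?t > 0" "m i ?t * \<phi> i (P ?t) < 0" using G m\<phi>'[OF True] \<epsilon> by auto
      then show ?thesis by (simp add: mult_less_0_iff)
    qed (use G that in auto)
    have w: "w i ?t = - \<epsilon> / \<phi> i (P ?t)" if "i < l" for i
      using m\<phi>'[of i] neg[OF that] by (auto simp: w_def field_simps)
    have st': "M0 (P ?t) + (\<Sum>i<l. (- \<epsilon> / \<phi> i (P ?t)) *\<^sub>R M i (P ?t)) = 0"
    proof -
      have "(\<Sum>i\<in>A. (- \<epsilon> / \<phi> i (P ?t)) *\<^sub>R M i (P ?t)) = (\<Sum>i\<in>A. m i ?t *\<^sub>R M i (P ?t))"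
      proof (intro sum.cong refl)
        fix i assume "i \<in> A"
        with w[of i] have "m i ?t = - \<epsilon> / \<phi> i (P ?t)" by (simp add: w_def)
        then show "(- \<epsilon> / \<phi> i (P ?t)) *\<^sub>R M i (P ?t) = m i ?t *\<^sub>R M i (P ?t)" by (simp only:)
      qed
      then show ?thesis using st[of ?t] G unfolding sum_AB by (simp add: P_def add.assoc)
    qed
    have pd: "frechet_derivative (\<lambda>p. M0 p \<bullet> y) (at (P ?t)) (y, 0)
        + (\<Sum>i<l. (- \<epsilon> / \<phi> i (P ?t)) * frechet_derivative (\<lambda>p. M i p \<bullet> y) (at (P ?t)) (y, 0))
        + (\<Sum>i<l. \<epsilon> / (\<phi> i (P ?t))\<^sup>2 * (M i (P ?t) \<bullet> y)\<^sup>2) > 0" if y: "y \<noteq> 0" for y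
    proof -
      have "\<kappa> * (\<Sum>i\<in>A. (M i (P ?t) \<bullet> y)\<^sup>2) \<le> (\<Sum>i\<in>A. \<epsilon> / (\<phi> i (P ?t))\<^sup>2 * (M i (P ?t) \<bullet> y)\<^sup>2)"
        unfolding sum_distrib_left
      proof (intro sum_mono mult_right_mono)
        fix i assume i: "i \<in> A"
        then have nz: "\<phi> i (P ?t) \<noteq> 0" using neg[of i] by auto
        have "\<kappa> * \<epsilon> * (\<phi> i (P ?t))\<^sup>2 \<le> (m i ?t)\<^sup>2 * (\<phi> i (P ?t))\<^sup>2"
          using G i by (intro mult_right_mono) auto
        also have "\<dots> = (m i ?t * \<phi> i (P ?t))\<^sup>2" by (simp add: power_mult_distrib)
        also have "\<dots> = \<epsilon> * \<epsilon>" unfolding m\<phi>'[OF i] by (simp add: power2_eq_square)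
        finally have "\<kappa> * (\<phi> i (P ?t))\<^sup>2 \<le> \<epsilon>" using \<epsilon> by (simp add: mult.assoc mult.left_commute[of \<kappa>])
        then show "\<kappa> \<le> \<epsilon> / (\<phi> i (P ?t))\<^sup>2" using nz by (simp add: pos_le_divide_eq)
      qed auto
      also have "\<dots> \<le> (\<Sum>i<l. \<epsilon> / (\<phi> i (P ?t))\<^sup>2 * (M i (P ?t) \<bullet> y)\<^sup>2)"
        using \<epsilon> by (intro sum_mono2) auto
      finally have "\<kappa> * (\<Sum>i\<in>A. (M i (P ?t) \<bullet> y)\<^sup>2) \<le> \<dots>" .
      moreover have "(\<Sum>b\<in>Basis. \<Sum>c\<in>Basis. K ?t b c * (y \<bullet> b) * (y \<bullet> c)) > 0" using G y by blast
      moreover have "regular (P ?t)" using G eventually_nhds_x_imp_x by blast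
      ultimately show ?thesis unfolding K_form by (subst (asm) H_form) (auto simp: w)
    qed
    show ?thesis
      using isolated_min_if_pos_def[of "g ?t" \<gamma> \<epsilon>] G \<epsilon> \<gamma> neg st' pd unfolding Pt by blast
  qed
  have "C1_on ({0<..<d/2} \<times> {0<..<d/2}) g"
  proof -
    have "{0<..<d/2} \<times> {0<..<d/2} \<subseteq> V" using good box by blast
    then show ?thesis using C1g unfolding C1_on_def by (meson continuous_on_subset subsetD)
  qed
  moreover have "(g \<longlongrightarrow> \<theta>s) (at (0, 0) within ({0<..<d/2} \<times> {0<..<d/2}))"
    using gcont g0 unfolding isCont_def by (metis tendsto_within_subset subset_UNIV)
  ultimately show ?thesis
    using main d by (intro exI[of _ "d/2"] conjI exI[of _ "\<lambda>\<epsilon> \<gamma>. g (\<epsilon>, \<gamma>)"]) auto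
qed

end

section \<open>Coordinates for trajectories\<close>

text \<open>\<open>IX t j\<close>, \<open>IU t j\<close> and \<open>IT k\<close> index the components of \<open>x\<^sub>t\<close>, \<open>u\<^sub>t\<close> and \<open>\<theta>\<close>; the coordinates of
  irrelevant stages, unused by \<^const>\<open>traj_eq\<close>, are set to 0 in \<open>coords\<close>.\<close>

datatype ('n, 'm, 'r) idx = IX nat 'n | IU nat 'm | IT 'r

datatype 'n cidx = Dyn nat 'n | Ini 'n | Eq nat nat | EqT nat | Ineq nat nat | IneqT nat

definition sx :: "(('n::finite, 'm::finite, 'r::finite) idx \<Rightarrow> real) \<Rightarrow> nat \<Rightarrow> real^'n" where
  "sx w t = (\<chi> j. w (IX t j))"

definition su :: "(('n::finite, 'm::finite, 'r::finite) idx \<Rightarrow> real) \<Rightarrow> nat \<Rightarrow> real^'m" where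
  "su w t = (\<chi> j. w (IU t j))"

definition sth :: "(('n::finite, 'm::finite, 'r::finite) idx \<Rightarrow> real) \<Rightarrow> real^'r" where
  "sth w = (\<chi> k. w (IT k))"

definition coords :: "nat \<Rightarrow> ('n::finite, 'm::finite) traj \<Rightarrow> real^'r::finite \<Rightarrow> ('n, 'm, 'r) idx \<Rightarrow> real" where
  "coords T \<xi> \<theta> i = (case i of IX t j \<Rightarrow> if t \<le> T then fst \<xi> t $ j else 0
     | IU t j \<Rightarrow> if t < T then snd \<xi> t $ j else 0 | IT k \<Rightarrow> \<theta> $ k)"

definition Jset :: "nat \<Rightarrow> ('n::finite, 'm::finite, 'r::finite) idx set" where
  "Jset T = (\<lambda>(t, j). IX t j) ` ({..T} \<times> UNIV) \<union> (\<lambda>(t, j). IU t j) ` ({..<T} \<times> UNIV)"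

definition Tset :: "('n::finite, 'm::finite, 'r::finite) idx set" where
  "Tset = range IT"

lemma sx_nth [simp]: "sx w t $ j = w (IX t j)" and su_nth [simp]: "su w t $ k = w (IU t k)"
  and sth_nth [simp]: "sth w $ r = w (IT r)"
  by (simp_all add: sx_def su_def sth_def)

lemma s_coords [simp]: "t \<le> T \<Longrightarrow> sx (coords T \<xi> \<theta>) t = fst \<xi> t"
  "t < T \<Longrightarrow> su (coords T \<xi> \<theta>) t = snd \<xi> t" "sth (coords T \<xi> \<theta>) = \<theta>"
  by (simp_all add: vec_eq_iff coords_def)

lemma Jset_iff [simp]: "IX t j \<in> Jset T \<longleftrightarrow> t \<le> T" "IU t k \<in> Jset T \<longleftrightarrow> t < T" "IT r \<notin> Jset T"
  by (auto simp: Jset_def)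

lemma Tset_iff [simp]: "IX t j \<notin> Tset" "IU t k \<notin> Tset" "IT r \<in> Tset"
  by (auto simp: Tset_def)

lemma finite_idx [simp]: "finite (Jset T)" "finite Tset" "Jset T \<inter> Tset = {}"
  by (auto simp: Jset_def Tset_def)

lemma coords_outside: "i \<notin> Jset T \<union> Tset \<Longrightarrow> coords T \<xi> \<theta> i = 0"
  by (cases i) (auto simp: coords_def)

lemma s_flin [simp]: "sx (flin w d s) t = sx w t + s *\<^sub>R sx d t" "su (flin w d s) t = su w t + s *\<^sub>R su d t"
  "sth (flin w d s) = sth w + s *\<^sub>R sth d"
  by (simp_all add: vec_eq_iff flin_def)

lemma continuous_on_s [continuous_intros]: "continuous_on UNIV (\<lambda>w. sx w t)" "continuous_on UNIV (\<lambda>w. su w t)" "continuous_on UNIV sth"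
  unfolding sx_def su_def sth_def by (intro continuous_on_vec_lambda continuous_on_product_coordinates)+

lemma gCk_stage:
  assumes "gCk vline k (\<lambda>((x, u), \<theta>). F x u \<theta>)"
  shows "gCk flin k (\<lambda>w. F (sx w t) (su w t) (sth w))"
  using gCk_line_map[of "\<lambda>w. ((sx w t, su w t), sth w)" flin vline, OF _ _ assms]
  by (simp add: vline_def continuous_on_Pair continuous_on_s)

lemma gCk_terminal:
  assumes "gCk vline k (\<lambda>(x, \<theta>). F x \<theta>)"
  shows "gCk flin k (\<lambda>w. F (sx w t) (sth w))"
  using gCk_line_map[of "\<lambda>w. (sx w t, sth w)" flin vline, OF _ _ assms]
  by (simp add: vline_def continuous_on_Pair continuous_on_s)

lemma gCk_param:
  assumes "gCk vline k F"
  shows "gCk flin k (\<lambda>w. F (sth w))"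
  by (rule gCk_line_map[OF _ _ assms]) (auto simp: vline_def intro: continuous_intros)

lemma gCk_traj:
  assumes "gCk tline k (\<lambda>(\<xi>, \<theta>). F \<xi> \<theta>)"
  shows "gCk flin k (\<lambda>w. F (sx w, su w) (sth w))"
proof -
  have "continuous_on UNIV (\<lambda>w. ((sx w, su w), sth w))"
    by (intro continuous_on_Pair continuous_on_coordinatewise_then_product continuous_intros)
  then show ?thesis
    using gCk_line_map[of "\<lambda>w. ((sx w, su w), sth w)" flin tline, OF _ _ assms]
    by (simp add: tline_def fun_eq_iff)
qed

text \<open>For real-valued functions \<open>vector_derivative\<close> and \<open>deriv\<close>
  select from the same predicate, so the two notions agree even without differentiability.\<close>

lemma dd_eq_Dd:
  fixes f :: "'a::real_normed_vector \<Rightarrow> real"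
  assumes "\<And>s. f (p + s *\<^sub>R e) = F (flin w d s)"
  shows "dd f p e = Dd F w d"
  by (simp add: dd_def Dd_def assms vector_derivative_def deriv_def has_real_derivative_iff_has_vector_derivative)

lemma dd_nth_eq_Dd:
  fixes f :: "'a::real_normed_vector \<Rightarrow> real^'n"
  assumes "\<And>s j. f (p + s *\<^sub>R e) $ j = F j (flin w d s)" and "\<And>j. gCk flin (Suc 0) (F j)"
  shows "dd f p e $ j = Dd (F j) w d"
proof -
  have "((\<lambda>s. f (p + s *\<^sub>R e)) has_vector_derivative (\<chi> j. Dd (F j) w d)) (at 0)"
    unfolding has_vector_derivative_def
  proof (subst has_derivative_componentwise_within, intro ballI)
    fix b :: "real^'n" assume "b \<in> Basis"
    then obtain j where b: "b = axis j 1" by (auto simp: Basis_vec_def)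
    have "((\<lambda>s. f (p + s *\<^sub>R e) $ j) has_real_derivative Dd (F j) w d) (at 0)"
      unfolding assms(1) by (rule DERIV_Dd[OF assms(2)])
    then show "((\<lambda>s. f (p + s *\<^sub>R e) \<bullet> b) has_derivative (\<lambda>h. (h *\<^sub>R (\<chi> j. Dd (F j) w d)) \<bullet> b)) (at 0)"
      by (simp add: b inner_axis has_field_derivative_def mult_commute_abs)
  qed
  then have "dd f p e = (\<chi> j. Dd (F j) w d)" unfolding dd_def by (rule vector_derivative_at)
  then show ?thesis by simp
qed

section \<open>Partial derivatives of Lagrangians\<close>

lemma pd_lincomb:
  assumes "finite K" "gCk flin (Suc m) c0" "\<And>k. k \<in> K \<Longrightarrow> gCk flin (Suc m) (c k)"
  shows "pd i (\<lambda>w. c0 w + (\<Sum>k\<in>K. y k * c k w)) = (\<lambda>w. pd i c0 w + (\<Sum>k\<in>K. y k * pd i (c k) w))"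
proof
  fix w
  have "pd i (\<lambda>w. c0 w + (\<Sum>k\<in>K. y k * c k w)) w = pd i c0 w + pd i (\<lambda>w. \<Sum>k\<in>K. y k * c k w) w"
    unfolding pd_def by (intro Dd_add[OF assms(2), of m] gCk_sum gCk_cmult assms)
  also have "pd i (\<lambda>w. \<Sum>k\<in>K. y k * c k w) w = (\<Sum>k\<in>K. pd i (\<lambda>w. y k * c k w) w)"
    unfolding pd_def by (intro Dd_sum[of _ m] gCk_cmult assms)
  also have "\<dots> = (\<Sum>k\<in>K. y k * pd i (c k) w)"
    unfolding pd_def by (intro sum.cong refl Dd_cmult[OF assms(3)])
  finally show "pd i (\<lambda>w. c0 w + (\<Sum>k\<in>K. y k * c k w)) w = pd i c0 w + (\<Sum>k\<in>K. y k * pd i (c k) w)" .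
qed

lemma Dd_Dd_eq_sum_pd:
  assumes F: "gCk flin (Suc (Suc m)) F" and J: "finite J" "\<And>i. i \<notin> J \<Longrightarrow> d i = 0"
  shows "Dd (\<lambda>w. Dd F w d) w d = (\<Sum>j\<in>J. d j * (\<Sum>i\<in>J. pd i (pd j F) w * d i))"
proof -
  have "(\<lambda>w. Dd F w d) = (\<lambda>w. \<Sum>j\<in>J. d j * pd j F w)"
    by (rule ext, rule Dd_eq_sum_pd[OF F J])
  then have "Dd (\<lambda>w. Dd F w d) w d = Dd (\<lambda>w. \<Sum>j\<in>J. d j * pd j F w) w d" by simp
  also have "\<dots> = (\<Sum>j\<in>J. d j * Dd (pd j F) w d)"
    using Dd_sum[OF J(1), of m "\<lambda>j w. d j * pd j F w" w d] Dd_cmult[OF gCk_pd[OF F], of _ _ w d]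
    by (simp add: gCk_cmult gCk_pd[OF F] del: gCk.simps)
  also have "\<dots> = (\<Sum>j\<in>J. d j * (\<Sum>i\<in>J. pd i (pd j F) w * d i))"
    by (simp add: Dd_eq_sum_pd[OF gCk_pd[OF F] J] mult.commute)
  finally show ?thesis .
qed

section \<open>The Lagrangian of an optimal control problem\<close>

locale smooth_ocp =
  fixes P :: "('n::finite, 'm::finite, 'r::finite) ocp"
  assumes C3: "ocp_C3 P"
begin

abbreviation "T \<equiv> hor P"

definition cost :: "(('n, 'm, 'r) idx \<Rightarrow> real) \<Rightarrow> real" where
  "cost w = (\<Sum>t<T. cst P t (sx w t) (su w t) (sth w)) + tcst P (sx w T) (sth w)"

definition dync :: "nat \<Rightarrow> 'n \<Rightarrow> (('n, 'm, 'r) idx \<Rightarrow> real) \<Rightarrow> real" where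
  "dync t j w = dyn P (sx w t) (su w t) (sth w) $ j"

text \<open>The dynamics enter as \<open>f - x\<^sub>t\<^sub>+\<^sub>1\<close>, so that in the
  Lagrangian the costate multiplies \<open>f\<close> with a plus sign, as in the
  Hamiltonian.\<close>

definition con :: "'n cidx \<Rightarrow> (('n, 'm, 'r) idx \<Rightarrow> real) \<Rightarrow> real" where
  "con k w = (case k of
      Dyn t j \<Rightarrow> dync t j w - w (IX (Suc t) j)
    | Ini j \<Rightarrow> ini P (sth w) $ j - w (IX 0 j)
    | Eq t i \<Rightarrow> hc P t (sx w t) (su w t) (sth w) i
    | EqT i \<Rightarrow> hTc P (sx w T) (sth w) i
    | Ineq t i \<Rightarrow> gc P t (sx w t) (su w t) (sth w) i
    | IneqT i \<Rightarrow> gTc P (sx w T) (sth w) i)"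

definition KE :: "'n cidx set" where
  "KE = (\<lambda>(t, j). Dyn t j) ` ({..<T} \<times> UNIV) \<union> range Ini"

definition KH :: "'n cidx set" where
  "KH = (\<lambda>(t, i). Eq t i) ` (SIGMA t:{..<T}. {..<ns P t}) \<union> EqT ` {..<nsT P}"

definition KG :: "'n cidx set" where
  "KG = (\<lambda>(t, i). Ineq t i) ` (SIGMA t:{..<T}. {..<nq P t}) \<union> IneqT ` {..<nqT P}"

lemma K_iff [simp]: "Dyn t j \<in> KE \<longleftrightarrow> t < T" "Ini j \<in> KE" "Eq t i \<notin> KE" "EqT i \<notin> KE" "Ineq t i \<notin> KE" "IneqT i \<notin> KE"
  "Dyn t j \<notin> KH" "Ini j \<notin> KH" "Eq t i \<in> KH \<longleftrightarrow> t < T \<and> i < ns P t" "EqT i \<in> KH \<longleftrightarrow> i < nsT P" "Ineq t i \<notin> KH" "IneqT i \<notin> KH"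
  "Dyn t j \<notin> KG" "Ini j \<notin> KG" "Ineq t i \<in> KG \<longleftrightarrow> t < T \<and> i < nq P t" "IneqT i \<in> KG \<longleftrightarrow> i < nqT P" "Eq t i \<notin> KG" "EqT i \<notin> KG"
  by (auto simp: KE_def KH_def KG_def)

lemma finite_K [simp]: "finite KE" "finite KH" "finite KG"
  by (auto simp: KE_def KH_def KG_def)

lemma disj_K [simp]: "KE \<inter> KH = {}" "KE \<inter> KG = {}" "KH \<inter> KG = {}"
  by (auto simp: KE_def KH_def KG_def)

lemma sum_KE: "(\<Sum>k\<in>KE. f k) = (\<Sum>t<T. \<Sum>j\<in>UNIV. f (Dyn t j)) + (\<Sum>j\<in>UNIV. (f (Ini j) :: real))"
  unfolding KE_def
  by (subst sum.union_disjoint) (auto simp: sum.reindex inj_on_def sum.cartesian_product split_def)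

lemma sum_KH: "(\<Sum>k\<in>KH. f k) = (\<Sum>t<T. \<Sum>i<ns P t. f (Eq t i)) + (\<Sum>i<nsT P. (f (EqT i) :: real))"
  unfolding KH_def
  by (subst sum.union_disjoint) (auto simp: sum.reindex inj_on_def sum.Sigma split_def)

lemma sum_KG: "(\<Sum>k\<in>KG. f k) = (\<Sum>t<T. \<Sum>i<nq P t. f (Ineq t i)) + (\<Sum>i<nqT P. (f (IneqT i) :: real))"
  unfolding KG_def
  by (subst sum.union_disjoint) (auto simp: sum.reindex inj_on_def sum.Sigma split_def)

lemma sum_KG_filter: "(\<Sum>k\<in>{k\<in>KG. Q k}. f k) = (\<Sum>t<T. \<Sum>i\<in>{i. i < nq P t \<and> Q (Ineq t i)}. f (Ineq t i))
    + (\<Sum>i\<in>{i. i < nqT P \<and> Q (IneqT i)}. (f (IneqT i) :: real))"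
proof -
  have "(\<Sum>k\<in>{k\<in>KG. Q k}. f k) = (\<Sum>k\<in>KG. if Q k then f k else 0)"
    by (rule sum.inter_filter) simp
  also have "\<dots> = (\<Sum>t<T. \<Sum>i<nq P t. if Q (Ineq t i) then f (Ineq t i) else 0) + (\<Sum>i<nqT P. if Q (IneqT i) then f (IneqT i) else 0)"
    by (rule sum_KG)
  moreover have "(\<Sum>i\<in>{i. i < n \<and> R i}. h i) = (\<Sum>i<n. if R i then h i else 0)" for n R and h :: "nat \<Rightarrow> real"
    using sum.inter_filter[of "{..<n}" h R] by simp
  ultimately show ?thesis by simp
qed

lemma K_cases:
  assumes "k \<in> KE \<union> KH \<union> KG"
  obtains t j where "k = Dyn t j" "t < T" | j where "k = Ini j" | t i where "k = Eq t i" "t < T" "i < ns P t" | i where "k = EqT i" "i < nsT P"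
    | t i where "k = Ineq t i" "t < T" "i < nq P t" | i where "k = IneqT i" "i < nqT P"
  using assms by (auto simp: KE_def KH_def KG_def)

lemma smooth:
  "t < T \<Longrightarrow> gCk flin 3 (\<lambda>w. cst P t (sx w t) (su w t) (sth w))"
  "gCk flin 3 (\<lambda>w. tcst P (sx w T) (sth w))"
  "gCk flin 3 (\<lambda>w. dyn P (sx w t) (su w t) (sth w) $ j)"
  "gCk flin 3 (\<lambda>w. ini P (sth w) $ j)"
  "t < T \<Longrightarrow> i < nq P t \<Longrightarrow> gCk flin 3 (\<lambda>w. gc P t (sx w t) (su w t) (sth w) i)"
  "t < T \<Longrightarrow> i < ns P t \<Longrightarrow> gCk flin 3 (\<lambda>w. hc P t (sx w t) (su w t) (sth w) i)"
  "i < nqT P \<Longrightarrow> gCk flin 3 (\<lambda>w. gTc P (sx w T) (sth w) i)"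
  "i < nsT P \<Longrightarrow> gCk flin 3 (\<lambda>w. hTc P (sx w T) (sth w) i)"
  using C3 unfolding ocp_C3_def
  by (intro gCk_stage gCk_terminal gCk_param; blast)+

lemma dync_C3: "gCk flin 3 (dync t j)"
  using smooth(3) by (simp add: dync_def[abs_def])

lemma gCk_diff_coordinate: "gCk flin k F \<Longrightarrow> gCk flin k (\<lambda>w. F w - w i)"
  using gCk_add[of flin k F "\<lambda>w. - 1 * w i"] gCk_cmult[OF gCk_coordinate[of k i], of "- 1"] by simp

lemma cost_C3: "gCk flin 3 cost"
  unfolding cost_def[abs_def] by (intro gCk_add gCk_sum smooth) auto

lemma con_C3: "k \<in> KE \<union> KH \<union> KG \<Longrightarrow> gCk flin 3 (con k)"
  by (erule K_cases) (auto simp: con_def[abs_def] intro: smooth dync_C3 gCk_diff_coordinate simp del: gCk.simps)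

lemma C3_C1: "gCk flin 3 F \<Longrightarrow> gCk flin (Suc 0) F" and C3_C2: "gCk flin 3 F \<Longrightarrow> gCk flin (Suc (Suc 0)) F"
  using gCk_le[of "Suc 0" 3 flin F] gCk_le[of "Suc (Suc 0)" 3 flin F] by (auto simp del: gCk.simps)

lemma dd_dyn:
  assumes "sth d = 0"
  shows "dd (\<lambda>z. dyn P (fst z) (snd z) (sth w)) (sx w t, su w t) (sx d t, su d t) $ j = Dd (dync t j) w d"
  by (rule dd_nth_eq_Dd[where F = "dync t"]) (use assms C3_C1[OF dync_C3] in \<open>auto simp: dync_def simp del: gCk.simps\<close>)

lemma Dd_Dyn: "Dd (con (Dyn t j)) w d = Dd (dync t j) w d - d (IX (Suc t) j)"
proof -
  have "Dd (con (Dyn t j)) w d = Dd (\<lambda>w. dync t j w + (- 1) * w (IX (Suc t) j)) w d"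
    by (simp add: con_def[abs_def])
  also have "\<dots> = Dd (dync t j) w d + Dd (\<lambda>w. (- 1) * w (IX (Suc t) j)) w d"
    by (intro Dd_add[of 0 _ 0] C3_C1 dync_C3 gCk_cmult gCk_coordinate)
  also have "Dd (\<lambda>w. (- 1) * w (IX (Suc t) j)) w d = - d (IX (Suc t) j)"
    using Dd_cmult[OF gCk_coordinate, of "-1" "IX (Suc t) j" w d] by (simp add: Dd_coordinate)
  finally show ?thesis by simp
qed

lemma Dd_Ini:
  assumes "sth d = 0"
  shows "Dd (con (Ini j)) w d = - d (IX 0 j)"
proof -
  have "Dd (con (Ini j)) w d = Dd (\<lambda>w'. ini P (sth w) $ j + (-1) * w' (IX 0 j)) w d"
    by (rule Dd_cong_line) (simp add: con_def assms)
  also have "\<dots> = Dd (\<lambda>w'. ini P (sth w) $ j) w d + Dd (\<lambda>w. (- 1) * w (IX 0 j)) w d"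
    by (intro Dd_add[of 0 _ 0] gCk_const gCk_cmult gCk_coordinate)
  also have "Dd (\<lambda>w. (- 1) * w (IX 0 j)) w d = - d (IX 0 j)"
    using Dd_cmult[OF gCk_coordinate, of "-1" "IX 0 j" w d] by (simp add: Dd_coordinate)
  finally show ?thesis by simp
qed

lemma dd_stage:
  fixes F :: "real^'n \<Rightarrow> real^'m \<Rightarrow> real^'r \<Rightarrow> real"
  assumes "sth d = 0"
  shows "dd (\<lambda>z. F (fst z) (snd z) (sth w)) (sx w t, su w t) (sx d t, su d t) = Dd (\<lambda>w. F (sx w t) (su w t) (sth w)) w d"
  by (rule dd_eq_Dd) (simp add: assms)

lemma dd_terminal:
  fixes F :: "real^'n \<Rightarrow> real^'r \<Rightarrow> real"
  assumes "sth d = 0"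
  shows "dd (\<lambda>x. F x (sth w)) (sx w t) (sx d t) = Dd (\<lambda>w. F (sx w t) (sth w)) w d"
  by (rule dd_eq_Dd) (simp add: assms)

lemma dd_con:
  assumes "sth d = 0"
  shows "dd (\<lambda>z. hc P t (fst z) (snd z) (sth w) i) (sx w t, su w t) (sx d t, su d t) = Dd (con (Eq t i)) w d"
    "dd (\<lambda>z. gc P t (fst z) (snd z) (sth w) i) (sx w t, su w t) (sx d t, su d t) = Dd (con (Ineq t i)) w d"
    "dd (\<lambda>x. hTc P x (sth w) i) (sx w T) (sx d T) = Dd (con (EqT i)) w d"
    "dd (\<lambda>x. gTc P x (sth w) i) (sx w T) (sx d T) = Dd (con (IneqT i)) w d"
  using dd_stage[OF assms, of "\<lambda>x u \<theta>. hc P t x u \<theta> i"] dd_stage[OF assms, of "\<lambda>x u \<theta>. gc P t x u \<theta> i"]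
    dd_terminal[OF assms, of "\<lambda>x \<theta>. hTc P x \<theta> i"] dd_terminal[OF assms, of "\<lambda>x \<theta>. gTc P x \<theta> i"]
  by (simp_all add: con_def[abs_def])

end

text \<open>Costates of condition (i) start at index 1. The nonlinear program also has the initial
  condition as a constraint, whose multiplier is the extra parameter \<open>lam0\<close>.\<close>

locale ocp_multipliers = smooth_ocp P for P :: "('n::finite, 'm::finite, 'r::finite) ocp" +
  fixes lam :: "nat \<Rightarrow> real^'n" and v ww :: "nat \<Rightarrow> nat \<Rightarrow> real" and lam0 :: "real^'n"
begin

definition Lw :: "nat \<Rightarrow> (('n, 'm, 'r) idx \<Rightarrow> real) \<Rightarrow> real" where
  "Lw t w = stage_lag P (sth w) lam v ww t (sx w t, su w t)"

definition LTw :: "(('n, 'm, 'r) idx \<Rightarrow> real) \<Rightarrow> real" where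
  "LTw w = term_lag P (sth w) v ww (sx w T)"

definition multiplier :: "'n cidx \<Rightarrow> real" where
  "multiplier k = (case k of Dyn t j \<Rightarrow> lam (Suc t) $ j | Ini j \<Rightarrow> lam0 $ j | Eq t i \<Rightarrow> ww t i | EqT i \<Rightarrow> ww T i
    | Ineq t i \<Rightarrow> v t i | IneqT i \<Rightarrow> v T i)"

definition lag :: "(('n, 'm, 'r) idx \<Rightarrow> real) \<Rightarrow> real" where
  "lag w = cost w + (\<Sum>k\<in>KE \<union> KH \<union> KG. multiplier k * con k w)"

lemma sum_K: "(\<Sum>k\<in>KE \<union> KH \<union> KG. f k) = (\<Sum>k\<in>KE. f k) + (\<Sum>k\<in>KH. f k) + (\<Sum>k\<in>KG. (f k :: real))"
  by (simp add: sum.union_disjoint Int_Un_distrib2)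

lemma Lw_C3: "t < T \<Longrightarrow> gCk flin 3 (Lw t)"
  unfolding Lw_def[abs_def] stage_lag_def inner_vec_def fst_conv snd_conv inner_real_def
  by (intro gCk_add gCk_sum gCk_cmult smooth) auto

lemma LTw_C3: "gCk flin 3 LTw"
  unfolding LTw_def[abs_def] term_lag_def
  by (intro gCk_add gCk_sum gCk_cmult smooth) auto

lemma lag_C3: "gCk flin 3 lag"
  unfolding lag_def[abs_def] by (intro gCk_add gCk_sum gCk_cmult cost_C3 con_C3) auto

text \<open>Regrouping by stages: the Lagrangian of the whole program is the sum of the Hamiltonians
  plus terms affine in the states for fixed \<theta>. These terms yield the adjoint recursion at
  first order and disappear at second order.\<close>

lemma lag_eq: "lag w = (\<Sum>t<T. Lw t w) + LTw w + lam0 \<bullet> (ini P (sth w) - sx w 0) - (\<Sum>t<T. lam (Suc t) \<bullet> sx w (Suc t))"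
  unfolding lag_def sum_K sum_KE sum_KH sum_KG
  by (simp add: cost_def Lw_def LTw_def stage_lag_def term_lag_def con_def multiplier_def dync_def inner_vec_def
      sum.distrib sum_subtractf right_diff_distrib)

lemma Dd_lag:
  assumes "sth d = 0"
  shows "Dd lag w d = (\<Sum>t<T. Dd (Lw t) w d) + Dd LTw w d - (lam0 \<bullet> sx d 0 + (\<Sum>t<T. lam (Suc t) \<bullet> sx d (Suc t)))"
proof -
  define R where "R = (\<lambda>w' :: ('n, 'm, 'r) idx \<Rightarrow> real. lam0 \<bullet> (ini P (sth w) - sx w' 0) - (\<Sum>t<T. lam (Suc t) \<bullet> sx w' (Suc t)))"
  define B where "B = lam0 \<bullet> sx d 0 + (\<Sum>t<T. lam (Suc t) \<bullet> sx d (Suc t))"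
  have "R (flin w d s) = R w + s * (- B)" for s
    by (simp add: R_def B_def inner_diff_right inner_add_right sum.distrib sum_distrib_left algebra_simps)
  then have R: "((\<lambda>s. R (flin w d s)) has_real_derivative - B) (at 0)"
    by (auto intro!: derivative_eq_intros)
  have "((\<lambda>s. (\<Sum>t<T. Lw t (flin w d s)) + LTw (flin w d s) + R (flin w d s)) has_real_derivative
     (\<Sum>t<T. Dd (Lw t) w d) + Dd LTw w d + - B) (at 0)"
    by (intro DERIV_add DERIV_sum DERIV_Dd[OF C3_C1] Lw_C3 LTw_C3 R) auto
  moreover have "lag (flin w d s) = (\<Sum>t<T. Lw t (flin w d s)) + LTw (flin w d s) + R (flin w d s)" for s
    unfolding lag_eq R_def using assms by simp
  ultimately have "((\<lambda>s. lag (flin w d s)) has_real_derivative (\<Sum>t<T. Dd (Lw t) w d) + Dd LTw w d + - B) (at 0)"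
    by (simp only:)
  from DERIV_imp_deriv[OF this] show ?thesis unfolding Dd_def[of lag] B_def by simp
qed

lemma dd_Lw:
  assumes "sth d = 0"
  shows "dd (stage_lag P (sth w) lam v ww t) (sx w t, su w t) (sx d t, su d t) = Dd (Lw t) w d"
    "dd (term_lag P (sth w) v ww) (sx w T) (sx d T) = Dd LTw w d"
  by (rule dd_eq_Dd, simp add: Lw_def LTw_def assms)+

text \<open>The direction leaves \<theta> fixed, so the identity for first derivatives may be used
  at all points of the line before differentiating again.\<close>

lemma dd_dd_Lw:
  assumes "sth d = 0"
  shows "dd (\<lambda>z. dd (stage_lag P (sth w) lam v ww t) z (sx d t, su d t)) (sx w t, su w t) (sx d t, su d t) = Dd (\<lambda>w. Dd (Lw t) w d) w d"
    "dd (\<lambda>x. dd (term_lag P (sth w) v ww) x (sx d T)) (sx w T) (sx d T) = Dd (\<lambda>w. Dd LTw w d) w d"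
proof -
  have "dd (stage_lag P (sth w) lam v ww t) (sx w t + s *\<^sub>R sx d t, su w t + s *\<^sub>R su d t) (sx d t, su d t) = Dd (Lw t) (flin w d s) d"
    "dd (term_lag P (sth w) v ww) (sx w T + s *\<^sub>R sx d T) (sx d T) = Dd LTw (flin w d s) d" for s
    using dd_Lw(1)[OF assms, where w = "flin w d s"] dd_Lw(2)[OF assms, where w = "flin w d s"] assms by simp_all
  then show "dd (\<lambda>z. dd (stage_lag P (sth w) lam v ww t) z (sx d t, su d t)) (sx w t, su w t) (sx d t, su d t) = Dd (\<lambda>w. Dd (Lw t) w d) w d"
    "dd (\<lambda>x. dd (term_lag P (sth w) v ww) x (sx d T)) (sx w T) (sx d T) = Dd (\<lambda>w. Dd LTw w d) w d"
    by (auto intro!: dd_eq_Dd[where F = "\<lambda>w. Dd _ w d"])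
qed

lemma Dd_Dd_lag:
  assumes "sth d = 0"
  shows "Dd (\<lambda>w. Dd lag w d) w d = (\<Sum>t<T. Dd (\<lambda>w. Dd (Lw t) w d) w d) + Dd (\<lambda>w. Dd LTw w d) w d"
proof -
  define B where "B = lam0 \<bullet> sx d 0 + (\<Sum>t<T. lam (Suc t) \<bullet> sx d (Suc t))"
  have "(\<lambda>w. Dd lag w d) = (\<lambda>w. ((\<Sum>t<T. Dd (Lw t) w d) + Dd LTw w d) + - B)"
    using Dd_lag[OF assms] by (auto simp: B_def)
  then have "Dd (\<lambda>w. Dd lag w d) w d = Dd (\<lambda>w. ((\<Sum>t<T. Dd (Lw t) w d) + Dd LTw w d) + - B) w d" by simp
  also have "\<dots> = Dd (\<lambda>w. (\<Sum>t<T. Dd (Lw t) w d) + Dd LTw w d) w d + Dd (\<lambda>w. - B) w d"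
    by (intro Dd_add[of 0 _ 0] gCk_add gCk_sum gCk_Dd C3_C2 Lw_C3 LTw_C3 gCk_const) auto
  also have "Dd (\<lambda>w. (\<Sum>t<T. Dd (Lw t) w d) + Dd LTw w d) w d = Dd (\<lambda>w. \<Sum>t<T. Dd (Lw t) w d) w d + Dd (\<lambda>w. Dd LTw w d) w d"
    by (intro Dd_add[of 0 _ 0] gCk_add gCk_sum gCk_Dd C3_C2 Lw_C3 LTw_C3) auto
  also have "Dd (\<lambda>w. \<Sum>t<T. Dd (Lw t) w d) w d = (\<Sum>t<T. Dd (\<lambda>w. Dd (Lw t) w d) w d)"
    by (intro Dd_sum[of _ 0] gCk_Dd C3_C2 Lw_C3) auto
  finally show ?thesis by simp
qed

end

context ocp_multipliers
begin

lemma dd_stage_lag: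
  assumes t: "t < T"
  shows "dd (stage_lag P (sth w) lam v ww t) (sx w t, su w t) (a, b)
    = (\<Sum>j\<in>UNIV. a $ j * pd (IX t j) (Lw t) w) + (\<Sum>j\<in>UNIV. b $ j * pd (IU t j) (Lw t) w)"
proof -
  define d :: "('n, 'm, 'r) idx \<Rightarrow> real" where
    "d = (\<lambda>i. case i of IX t' j \<Rightarrow> if t' = t then a $ j else 0 | IU t' j \<Rightarrow> if t' = t then b $ j else 0 | IT k \<Rightarrow> 0)"
  have s: "sx d t = a" "su d t = b" "sth d = 0" by (simp_all add: vec_eq_iff d_def)
  let ?I = "range (IX t) \<union> range (IU t) :: ('n, 'm, 'r) idx set"
  have "d i = 0" if "i \<notin> ?I" for i
    using that by (cases i) (auto simp: d_def)
  then have "Dd (Lw t) w d = (\<Sum>i\<in>?I. d i * pd i (Lw t) w)"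
    by (intro Dd_eq_sum_pd[OF C3_C1[OF Lw_C3[OF t]]]) auto
  also have "\<dots> = (\<Sum>i\<in>range (IX t). d i * pd i (Lw t) w) + (\<Sum>i\<in>range (IU t). d i * pd i (Lw t) w)"
    by (intro sum.union_disjoint) auto
  also have "\<dots> = (\<Sum>j\<in>UNIV. a $ j * pd (IX t j) (Lw t) w) + (\<Sum>j\<in>UNIV. b $ j * pd (IU t j) (Lw t) w)"
    by (simp add: sum.reindex inj_on_def d_def)
  finally show ?thesis using dd_Lw(1)[OF s(3), where t = t and w = w] by (simp add: s)
qed

text \<open>Stage \<open>t\<close> contributes the product of the costate with the state variation,
  by the adjoint equation and stationarity in the input. The sum cancels against the linear terms of
  the Lagrangian after an index shift, provided \<open>lam0\<close> is the state derivative of the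
  first Hamiltonian.\<close>

lemma KKT_lag:
  assumes lam: "\<And>t d. 1 \<le> t \<Longrightarrow> t < T \<Longrightarrow> lam t \<bullet> d = dd (stage_lag P (sth w) lam v ww t) (sx w t, su w t) (d, 0)"
    and lamT: "\<And>d. lam T \<bullet> d = dd (term_lag P (sth w) v ww) (sx w T) d"
    and u: "\<And>t e. t < T \<Longrightarrow> dd (stage_lag P (sth w) lam v ww t) (sx w t, su w t) (0, e) = 0"
    and lam0: "lam0 = (if T = 0 then lam 0 else (\<chi> j. dd (stage_lag P (sth w) lam v ww 0) (sx w 0, su w 0) (axis j 1, 0)))"
    and d: "sth d = 0"
  shows "Dd lag w d = 0"
proof -
  \<comment> \<open>The costate sequence with \<open>lam0\<close> in slot 0. For
    \<open>T = 0\<close> the choice \<open>lam0 = lam 0\<close> keeps the terminal costate in that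
    slot.\<close>
  define l where "l = (\<lambda>t. if t = 0 then lam0 else lam t)"
  have l0: "lam0 \<bullet> a = dd (stage_lag P (sth w) lam v ww 0) (sx w 0, su w 0) (a, 0)" if "T > 0" for a
  proof -
    have "lam0 $ j = pd (IX 0 j) (Lw 0) w" for j
      using that by (simp add: lam0 dd_stage_lag axis_def if_distrib[of "\<lambda>x. x * _"] cong: if_cong)
    then show ?thesis using that by (simp add: dd_stage_lag inner_vec_def mult.commute)
  qed
  have "Dd (Lw t) w d = l t \<bullet> sx d t" if t: "t < T" for t
  proof -
    have "Dd (Lw t) w d = dd (stage_lag P (sth w) lam v ww t) (sx w t, su w t) (sx d t, su d t)"
      using dd_Lw(1)[OF d] by simp
    also have "\<dots> = dd (stage_lag P (sth w) lam v ww t) (sx w t, su w t) (sx d t, 0) + dd (stage_lag P (sth w) lam v ww t) (sx w t, su w t) (0, su d t)"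
      by (simp add: dd_stage_lag[OF t])
    also have "\<dots> = l t \<bullet> sx d t"
      using u[OF t] lam[of t "sx d t"] l0[of "sx d t"] t by (cases t) (auto simp: l_def)
    finally show ?thesis .
  qed
  moreover have "Dd LTw w d = l T \<bullet> sx d T"
    using dd_Lw(2)[OF d, of w] lamT[of "sx d T"] lam0 by (auto simp: l_def)
  moreover have "(\<Sum>t<T. l t \<bullet> sx d t) + l T \<bullet> sx d T = l 0 \<bullet> sx d 0 + (\<Sum>t<T. l (Suc t) \<bullet> sx d (Suc t))"
    using sum.lessThan_Suc_shift[of "\<lambda>t. l t \<bullet> sx d t" T] by simp
  ultimately show ?thesis by (simp add: Dd_lag[OF d] l_def)
qed

end

section \<open>The inner conditions as KKT conditions of a nonlinear program\<close>

context smooth_ocp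
begin

lemma sth_outside_Jset:
  assumes "\<And>i. i \<notin> Jset T \<Longrightarrow> d i = 0"
  shows "sth (d :: ('n, 'm, 'r) idx \<Rightarrow> real) = 0"
  using assms by (simp add: vec_eq_iff)

lemma Dd_con_eq_sum_pd:
  assumes "k \<in> KE \<union> KH \<union> KG" "\<And>i. i \<notin> Jset T \<Longrightarrow> d i = 0"
  shows "Dd (con k) w d = (\<Sum>j\<in>Jset T. d j * pd j (con k) w)"
  by (rule Dd_eq_sum_pd[OF C3_C1[OF con_C3[OF assms(1)]]]) (use assms in auto)

text \<open>A null combination of the partial derivatives over \<open>Jset T\<close> is a null
  combination of directional derivatives for every variation \<open>(dX, dU)\<close>, which is the
  form in which condition (ii) states independence.\<close>

lemma cond_ii_nlp:
  assumes ii: "cond_ii P \<theta> \<xi>" and y: "\<And>j. j \<in> Jset T \<Longrightarrow>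
     (\<Sum>k\<in>KE \<union> KH \<union> {k\<in>KG. con k (coords T \<xi> \<theta>) = 0}. y k * pd j (con k) (coords T \<xi> \<theta>)) = 0"
  shows "\<forall>k\<in>KE \<union> KH \<union> {k\<in>KG. con k (coords T \<xi> \<theta>) = 0}. y k = 0"
proof -
  define w where "w = coords T \<xi> \<theta>"
  let ?Ka = "KE \<union> KH \<union> {k\<in>KG. con k w = 0}"
  \<comment> \<open>The minus signs convert \<open>f - x\<^sub>t\<^sub>+\<^sub>1\<close> and
    \<open>x\<^sub>0(\<theta>) - x\<^sub>0\<close> into the opposite orientation of condition
    (ii).\<close>
  define mu where "mu = (\<lambda>t. case t of 0 \<Rightarrow> (\<chi> j. - y (Ini j)) | Suc t \<Rightarrow> (\<chi> j. - y (Dyn t j)))"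
  \<comment> \<open>Slot \<open>T\<close> is free for the terminal multipliers, since stage
    constraints have \<open>t < T\<close>.\<close>
  define a where "a = (\<lambda>t i. if t = T then y (EqT i) else y (Eq t i))"
  define b where "b = (\<lambda>t i. if t = T then y (IneqT i) else y (Ineq t i))"
  have w: "t \<le> T \<Longrightarrow> sx w t = fst \<xi> t" "t < T \<Longrightarrow> su w t = snd \<xi> t" "sth w = \<theta>" for t
    by (simp_all add: w_def)
  have cw: "t < T \<Longrightarrow> con (Ineq t i) w = gc P t (fst \<xi> t) (snd \<xi> t) \<theta> i" "con (IneqT i) w = gTc P (fst \<xi> T) \<theta> i" for t i
    by (simp_all add: con_def w)
  have "(\<Sum>t<T. mu (Suc t) \<bullet> (dX (Suc t) - dd (\<lambda>z. dyn P (fst z) (snd z) \<theta>) (fst \<xi> t, snd \<xi> t) (dX t, dU t)))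
          + mu 0 \<bullet> dX 0
          + (\<Sum>t<T. \<Sum>i<ns P t. a t i * dd (\<lambda>z. hc P t (fst z) (snd z) \<theta> i) (fst \<xi> t, snd \<xi> t) (dX t, dU t))
          + (\<Sum>i<nsT P. a T i * dd (\<lambda>x. hTc P x \<theta> i) (fst \<xi> T) (dX T))
          + (\<Sum>t<T. \<Sum>i\<in>{i. i < nq P t \<and> gc P t (fst \<xi> t) (snd \<xi> t) \<theta> i = 0}.
                b t i * dd (\<lambda>z. gc P t (fst z) (snd z) \<theta> i) (fst \<xi> t, snd \<xi> t) (dX t, dU t))
          + (\<Sum>i\<in>{i. i < nqT P \<and> gTc P (fst \<xi> T) \<theta> i = 0}. b T i * dd (\<lambda>x. gTc P x \<theta> i) (fst \<xi> T) (dX T))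
          = 0" for dX dU
  proof -
    define d :: "('n, 'm, 'r) idx \<Rightarrow> real" where "d = coords T (dX, dU) 0"
    have d: "t \<le> T \<Longrightarrow> sx d t = dX t" "t < T \<Longrightarrow> su d t = dU t" "sth d = 0" for t
      by (simp_all add: d_def)
    have d0: "d i = 0" if "i \<notin> Jset T" for i
      using that by (cases i) (auto simp: d_def coords_def)
    have "(\<Sum>k\<in>?Ka. y k * Dd (con k) w d) = (\<Sum>k\<in>?Ka. \<Sum>j\<in>Jset T. d j * (y k * pd j (con k) w))"
      by (intro sum.cong refl, subst Dd_con_eq_sum_pd[OF _ d0]) (auto simp: sum_distrib_left mult_ac)
    also have "\<dots> = (\<Sum>j\<in>Jset T. d j * (\<Sum>k\<in>?Ka. y k * pd j (con k) w))"
      by (subst sum.swap) (simp add: sum_distrib_left)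
    also have "\<dots> = 0" using y by (simp add: w_def)
    finally have "(\<Sum>k\<in>?Ka. y k * Dd (con k) w d) = 0" .
    moreover have "(\<Sum>k\<in>?Ka. f k) = (\<Sum>k\<in>KE. f k) + (\<Sum>k\<in>KH. f k) + (\<Sum>k\<in>{k\<in>KG. con k w = 0}. (f k :: real))" for f
      using disj_K by (subst sum.union_disjoint, simp, simp, blast, subst sum.union_disjoint) auto
    ultimately have z: "(\<Sum>k\<in>KE. y k * Dd (con k) w d) + (\<Sum>k\<in>KH. y k * Dd (con k) w d) + (\<Sum>k\<in>{k\<in>KG. con k w = 0}. y k * Dd (con k) w d) = 0"
      by simp
    have "(\<Sum>j\<in>UNIV. y (Dyn t j) * Dd (con (Dyn t j)) w d) =
        mu (Suc t) \<bullet> (dX (Suc t) - dd (\<lambda>z. dyn P (fst z) (snd z) \<theta>) (fst \<xi> t, snd \<xi> t) (dX t, dU t))" if "t < T" for t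
    proof -
      have Dy: "Dd (con (Dyn t j)) w d = dd (\<lambda>z. dyn P (fst z) (snd z) \<theta>) (fst \<xi> t, snd \<xi> t) (dX t, dU t) $ j - dX (Suc t) $ j" for j
        using dd_dyn[OF d(3), of w t j] that by (simp add: Dd_Dyn w d) (simp add: d_def coords_def)
      show ?thesis by (simp add: Dy mu_def inner_vec_def right_diff_distrib)
    qed
    moreover have "(\<Sum>j\<in>UNIV. y (Ini j) * Dd (con (Ini j)) w d) = mu 0 \<bullet> dX 0"
      using d(1)[of 0] by (simp add: Dd_Ini[OF d(3)] mu_def inner_vec_def vec_eq_iff)
    moreover have "y (Eq t i) * Dd (con (Eq t i)) w d = a t i * dd (\<lambda>z. hc P t (fst z) (snd z) \<theta> i) (fst \<xi> t, snd \<xi> t) (dX t, dU t)" if "t < T" for t i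
      using dd_con(1)[OF d(3), where t = t and i = i and w = w] that by (simp add: w d a_def)
    moreover have "y (Ineq t i) * Dd (con (Ineq t i)) w d = b t i * dd (\<lambda>z. gc P t (fst z) (snd z) \<theta> i) (fst \<xi> t, snd \<xi> t) (dX t, dU t)" if "t < T" for t i
      using dd_con(2)[OF d(3), where t = t and i = i and w = w] that by (simp add: w d b_def)
    moreover have "y (EqT i) * Dd (con (EqT i)) w d = a T i * dd (\<lambda>x. hTc P x \<theta> i) (fst \<xi> T) (dX T)" for i
      using dd_con(3)[OF d(3), where i = i and w = w] by (simp add: w d a_def)
    moreover have "y (IneqT i) * Dd (con (IneqT i)) w d = b T i * dd (\<lambda>x. gTc P x \<theta> i) (fst \<xi> T) (dX T)" for i
      using dd_con(4)[OF d(3), where i = i and w = w] by (simp add: w d b_def)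
    ultimately show ?thesis
      using z unfolding sum_KE sum_KH sum_KG_filter by (simp add: cw add.assoc cong: conj_cong)
  qed
  then have "(\<forall>t\<le>T. mu t = 0) \<and> (\<forall>t<T. \<forall>i<ns P t. a t i = 0) \<and> (\<forall>i<nsT P. a T i = 0) \<and>
           (\<forall>t<T. \<forall>i<nq P t. gc P t (fst \<xi> t) (snd \<xi> t) \<theta> i = 0 \<longrightarrow> b t i = 0) \<and>
           (\<forall>i<nqT P. gTc P (fst \<xi> T) \<theta> i = 0 \<longrightarrow> b T i = 0)"
    using ii unfolding cond_ii_def Let_def by blast
  then have mu: "t \<le> T \<Longrightarrow> mu t = 0" and a: "t < T \<Longrightarrow> i < ns P t \<Longrightarrow> a t i = 0" "i < nsT P \<Longrightarrow> a T i = 0"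
    and b: "t < T \<Longrightarrow> i < nq P t \<Longrightarrow> gc P t (fst \<xi> t) (snd \<xi> t) \<theta> i = 0 \<Longrightarrow> b t i = 0"
      "i < nqT P \<Longrightarrow> gTc P (fst \<xi> T) \<theta> i = 0 \<Longrightarrow> b T i = 0" for t i by blast+
  have "y k = 0" if "k \<in> ?Ka" for k
  proof -
    have "k \<in> KE \<union> KH \<union> KG" and act: "k \<in> KG \<Longrightarrow> con k w = 0" using that by (auto simp: KE_def KH_def KG_def)
    then show ?thesis
    proof (cases rule: K_cases)
      case (1 t j)
      then show ?thesis using mu[of "Suc t"] by (simp add: mu_def vec_eq_iff)
    next
      case (2 j)
      then show ?thesis using mu[of 0] by (simp add: mu_def vec_eq_iff)
    qed (use a b act cw in \<open>auto simp: a_def b_def\<close>)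
  qed
  then show ?thesis unfolding w_def by blast
qed

text \<open>The multipliers of condition (i), completed by \<open>lam0\<close>, serve as the
  multipliers of the program. Strict complementarity turns the critical cone of (i) into the kernel
  of all active gradients.\<close>

lemma inner_conds_strict_KKT:
  assumes "inner_conds P \<theta> \<xi>"
  obtains y where "strict_KKT (Jset T) KE KH KG cost con (coords T \<xi> \<theta>) y"
proof -
  define w where "w = coords T \<xi> \<theta>"
  obtain lam v ww where i: "cond_i P \<theta> \<xi> lam v ww" and iii: "cond_iii P \<theta> \<xi> v" and ii: "cond_ii P \<theta> \<xi>"
    using assms(1) unfolding inner_conds_def by blast
  define X where "X = fst \<xi>"
  define U where "U = snd \<xi>"
  \<comment> \<open>The value for which the state equation at stage 0 holds. With horizon 0 there is
    no stage, and the terminal adjoint equation already determines \<open>lam 0\<close>.\<close>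
  define lam0 where "lam0 = (if T = 0 then lam 0 else (\<chi> j. dd (stage_lag P \<theta> lam v ww 0) (X 0, U 0) (axis j 1, 0)))"
  interpret ocp_multipliers P lam v ww lam0 ..
  have w: "t \<le> T \<Longrightarrow> sx w t = X t" "t < T \<Longrightarrow> su w t = U t" "sth w = \<theta>" for t
    by (simp_all add: w_def X_def U_def)
  have cw: "t < T \<Longrightarrow> con (Ineq t i) w = gc P t (X t) (U t) \<theta> i" "con (IneqT i) w = gTc P (X T) \<theta> i" for t i
    by (simp_all add: con_def w)
  note I = i[unfolded cond_i_def Let_def, folded X_def U_def]
  have i1: "1 \<le> t \<Longrightarrow> t < T \<Longrightarrow> lam t \<bullet> d = dd (stage_lag P \<theta> lam v ww t) (X t, U t) (d, 0)" for t d using I by blast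
  have i2: "lam T \<bullet> d = dd (term_lag P \<theta> v ww) (X T) d" for d using I by blast
  have i3: "t < T \<Longrightarrow> dd (stage_lag P \<theta> lam v ww t) (X t, U t) (0, e) = 0" for t e using I by blast
  have i4: "t < T \<Longrightarrow> i < nq P t \<Longrightarrow> v t i \<ge> 0 \<and> v t i * gc P t (X t) (U t) \<theta> i = 0" for t i using I by blast
  have i5: "i < nqT P \<Longrightarrow> v T i \<ge> 0 \<and> v T i * gTc P (X T) \<theta> i = 0" for i using I by blast
  have kkt: "Dd lag w d = 0" if "sth d = 0" for d
  proof (rule KKT_lag[OF _ _ _ _ that])
    show "lam0 = (if T = 0 then lam 0 else (\<chi> j. dd (stage_lag P (sth w) lam v ww 0) (sx w 0, su w 0) (axis j 1, 0)))"
      by (simp add: lam0_def w)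
  qed (use i1 i2 i3 w in auto)
  have pd_lag: "pd j lag = (\<lambda>w. pd j cost w + (\<Sum>k\<in>KE \<union> KH \<union> KG. multiplier k * pd j (con k) w))" for j
    unfolding lag_def[abs_def] by (rule pd_lincomb[of _ 0]) (auto intro: C3_C1 cost_C3 con_C3 simp del: gCk.simps)
  have pd_pd_lag: "pd i (pd j lag) w = pd i (pd j cost) w + (\<Sum>k\<in>KE \<union> KH \<union> KG. multiplier k * pd i (pd j (con k)) w)" for i j
  proof -
    have "pd i (\<lambda>w. pd j cost w + (\<Sum>k\<in>KE \<union> KH \<union> KG. multiplier k * pd j (con k) w)) =
       (\<lambda>w. pd i (pd j cost) w + (\<Sum>k\<in>KE \<union> KH \<union> KG. multiplier k * pd i (pd j (con k)) w))"
      by (rule pd_lincomb[of _ 0]) (auto intro!: gCk_pd C3_C2 cost_C3 con_C3 simp del: gCk.simps)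
    then show ?thesis unfolding pd_lag by simp
  qed
  have "strict_KKT (Jset T) KE KH KG cost con w multiplier"
    unfolding strict_KKT_def Let_def
  proof (intro conjI allI impI ballI)
    fix j :: "('n, 'm, 'r) idx" assume j: "j \<in> Jset T"
    then have "sth (\<lambda>i. if i = j then 1 else 0 :: real) = (0 :: real^'r)"
      by (auto simp: vec_eq_iff)
    from kkt[OF this] have "pd j lag w = 0" by (simp only: pd_def)
    then show "pd j cost w + (\<Sum>k\<in>KE \<union> KH \<union> KG. multiplier k * pd j (con k) w) = 0"
      by (simp only: pd_lag)
  next
    fix k assume "k \<in> KG"
    moreover have "v t i * con (Ineq t i) w = 0" if "t < T" "i < nq P t" for t i
      using i4[OF that] cw that by simp
    moreover have "v T i * con (IneqT i) w = 0" if "i < nqT P" for i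
      using i5[OF that] cw by simp
    ultimately show "multiplier k * con k w = 0"
      by (cases k) (simp_all add: multiplier_def)
  next
    fix k assume "k \<in> KG" "con k w = 0"
    then show "multiplier k > 0"
      using iii cw by (auto simp: KG_def multiplier_def cond_iii_def X_def U_def)
  next
    fix z k assume "\<forall>j\<in>Jset T. (\<Sum>k\<in>KE \<union> KH \<union> {k\<in>KG. con k w = 0}. z k * pd j (con k) w) = 0"
      and "k \<in> KE \<union> KH \<union> {k\<in>KG. con k w = 0}"
    then show "z k = 0" using cond_ii_nlp[OF ii, of z] unfolding w_def by blast
  next
    fix e :: "('n, 'm, 'r) idx \<Rightarrow> real"
    assume nz: "\<exists>j\<in>Jset T. e j \<noteq> 0"
      and crit: "\<forall>k\<in>KE \<union> KH \<union> {k\<in>KG. con k w = 0}. (\<Sum>j\<in>Jset T. pd j (con k) w * e j) = 0"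
    \<comment> \<open>Dropping coordinates outside \<open>Jset T\<close> leaves the parameter fixed
      and allows derivatives to be written as finite sums.\<close>
    define d where "d = (\<lambda>i. if i \<in> Jset T then e i else 0)"
    have d0: "\<And>i. i \<notin> Jset T \<Longrightarrow> d i = 0" by (simp add: d_def)
    have sd: "sth d = 0" using sth_outside_Jset[of d] d0 by blast
    have Dc: "Dd (con k) w d = 0" if "k \<in> KE \<union> KH \<union> {k\<in>KG. con k w = 0}" for k
      using bspec[OF crit that] that by (subst Dd_con_eq_sum_pd[OF _ d0]) (auto simp: d_def mult.commute)
    have a1: "traj_nonzero T (sx d, su d)"
    proof -
      obtain j where j: "j \<in> Jset T" "d j \<noteq> 0" using nz by (auto simp: d_def)
      then show ?thesis by (cases j) (auto simp: traj_nonzero_def vec_eq_iff)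
    qed
    have a2: "sx d (Suc t) = dd (\<lambda>z. dyn P (fst z) (snd z) \<theta>) (X t, U t) (sx d t, su d t)" if "t < T" for t
    proof -
      have "dd (\<lambda>z. dyn P (fst z) (snd z) \<theta>) (X t, U t) (sx d t, su d t) $ j = d (IX (Suc t) j)" for j
        using dd_dyn[OF sd, of w t j] Dc[of "Dyn t j"] that by (simp add: Dd_Dyn w)
      then show ?thesis by (simp add: vec_eq_iff)
    qed
    have a3: "sx d 0 = 0" using Dc[of "Ini _"] by (simp add: Dd_Ini[OF sd] vec_eq_iff)
    have a4: "dd (\<lambda>z. hc P t (fst z) (snd z) \<theta> i) (X t, U t) (sx d t, su d t) = 0" if "t < T" "i < ns P t" for t i
      using dd_con(1)[OF sd, where t = t and i = i and w = w] Dc[of "Eq t i"] that by (simp add: w)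
    have a5: "dd (\<lambda>x. hTc P x \<theta> i) (X T) (sx d T) = 0" if "i < nsT P" for i
      using dd_con(3)[OF sd, where i = i and w = w] Dc[of "EqT i"] that by (simp add: w)
    \<comment> \<open>One equality for every active constraint covers both requirements of the
      critical cone: positive multipliers force activity, and equality implies the
      inequality.\<close>
    have a6: "dd (\<lambda>z. gc P t (fst z) (snd z) \<theta> i) (X t, U t) (sx d t, su d t) = 0" if "t < T" "i < nq P t" "gc P t (X t) (U t) \<theta> i = 0" for t i
      using dd_con(2)[OF sd, where t = t and i = i and w = w] Dc[of "Ineq t i"] that cw by (simp add: w)
    have a7: "dd (\<lambda>x. gTc P x \<theta> i) (X T) (sx d T) = 0" if "i < nqT P" "gTc P (X T) \<theta> i = 0" for i
      using dd_con(4)[OF sd, where i = i and w = w] Dc[of "IneqT i"] that cw by (simp add: w)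
    have "(\<Sum>t<T. dd (\<lambda>z. dd (stage_lag P \<theta> lam v ww t) z (sx d t, su d t)) (X t, U t) (sx d t, su d t))
          + dd (\<lambda>x. dd (term_lag P \<theta> v ww) x (sx d T)) (X T) (sx d T) > 0"
    proof (rule I[THEN conjunct2, THEN conjunct2, THEN conjunct2, THEN conjunct2, THEN conjunct2, THEN conjunct2, rule_format, of "sx d" "su d"], intro conjI allI impI)
      fix t i assume *: "t < T" "i < nq P t" "v t i > 0"
      then have "gc P t (X t) (U t) \<theta> i = 0" using i4[of t i] by auto
      then show "dd (\<lambda>z. gc P t (fst z) (snd z) \<theta> i) (X t, U t) (sx d t, su d t) = 0" using a6 * by blast
    next
      fix i assume *: "i < nqT P" "v T i > 0"
      then have "gTc P (X T) \<theta> i = 0" using i5[of i] by auto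
      then show "dd (\<lambda>x. gTc P x \<theta> i) (X T) (sx d T) = 0" using a7 * by blast
    qed (use a1 a2 a3 a4 a5 a6 a7 in \<open>auto simp: order_le_less\<close>)
    moreover have "dd (\<lambda>z. dd (stage_lag P \<theta> lam v ww t) z (sx d t, su d t)) (X t, U t) (sx d t, su d t) = Dd (\<lambda>w. Dd (Lw t) w d) w d" if "t < T" for t
      using dd_dd_Lw(1)[OF sd, where w = w and t = t] that by (simp add: w)
    ultimately have "Dd (\<lambda>w. Dd lag w d) w d > 0"
      using dd_dd_Lw(2)[OF sd, where w = w] by (simp add: Dd_Dd_lag[OF sd] w)
    also have "Dd (\<lambda>w. Dd lag w d) w d = (\<Sum>j\<in>Jset T. d j * (\<Sum>i\<in>Jset T. pd i (pd j lag) w * d i))"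
      by (rule Dd_Dd_eq_sum_pd[OF C3_C2[OF lag_C3]]) (auto simp: d0)
    finally show "(\<Sum>j\<in>Jset T. e j * (\<Sum>i\<in>Jset T. (pd i (pd j cost) w + (\<Sum>k\<in>KE \<union> KH \<union> KG. multiplier k * pd i (pd j (con k)) w)) * e i)) > 0"
      by (simp add: pd_pd_lag d_def)
  qed
  then show ?thesis using that unfolding w_def by blast
qed

end

section \<open>Stationarity of barrier solutions\<close>

text \<open>The linear algebra behind Lagrange multipliers. A functional \<open>b k\<close>
  vanishing on the common kernel of the others is redundant; otherwise some \<open>e\<close> in that
  kernel detects it, and subtracting a multiple of \<open>b k\<close> from \<open>a\<close> reduces
  to the smaller family.\<close>

lemma functional_in_span:
  fixes a :: "'i \<Rightarrow> real" and b :: "'k \<Rightarrow> 'i \<Rightarrow> real"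
  assumes "finite K" "finite J"
    and "\<And>d. (\<forall>k\<in>K. (\<Sum>i\<in>J. d i * b k i) = 0) \<Longrightarrow> (\<Sum>i\<in>J. d i * a i) = 0"
  shows "\<exists>y. \<forall>i\<in>J. a i = (\<Sum>k\<in>K. y k * b k i)"
  using assms(1,3)
proof (induction K arbitrary: a rule: finite_induct)
  case empty
  have "a i = 0" if "i \<in> J" for i
  proof -
    have "(\<Sum>j\<in>J. (if j = i then 1 else 0) * a j) = 0" by (rule empty) simp
    moreover have "(\<Sum>j\<in>J. (if j = i then 1 else 0) * a j) = (\<Sum>j\<in>J. if j = i then a j else 0)"
      by (intro sum.cong) auto
    ultimately show ?thesis using that assms(2) by simp
  qed
  then show ?case by simp
next
  case (insert k K)
  show ?case
  proof (cases "\<forall>d. (\<forall>k\<in>K. (\<Sum>i\<in>J. d i * b k i) = 0) \<longrightarrow> (\<Sum>i\<in>J. d i * b k i) = 0")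
    case True
    then have "\<exists>y. \<forall>i\<in>J. a i = (\<Sum>k\<in>K. y k * b k i)"
      using insert.prems by (intro insert.IH) auto
    then obtain y where "\<forall>i\<in>J. a i = (\<Sum>k\<in>K. y k * b k i)" by blast
    moreover have "(\<Sum>k'\<in>K. (y(k := 0)) k' * b k' i) = (\<Sum>k\<in>K. y k * b k i)" for i
      using insert.hyps by (intro sum.cong) auto
    ultimately show ?thesis using insert.hyps by (intro exI[of _ "y(k := 0)"]) auto
  next
    case False
    then obtain e where e: "\<forall>k\<in>K. (\<Sum>i\<in>J. e i * b k i) = 0" and ek: "(\<Sum>i\<in>J. e i * b k i) \<noteq> 0" by blast
    \<comment> \<open>Chosen so that \<open>a - c * b k\<close> vanishes at
      \<open>e\<close>.\<close>
    define c where "c = (\<Sum>i\<in>J. e i * a i) / (\<Sum>i\<in>J. e i * b k i)"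
    have "\<exists>y. \<forall>i\<in>J. a i - c * b k i = (\<Sum>k\<in>K. y k * b k i)"
    proof (rule insert.IH)
      fix d assume d: "\<forall>k\<in>K. (\<Sum>i\<in>J. d i * b k i) = 0"
      \<comment> \<open>Moving \<open>d\<close> along \<open>e\<close> by this amount lands in the
        kernel of \<open>b k\<close> without leaving the kernels of the others.\<close>
      define r where "r = (\<Sum>i\<in>J. d i * b k i) / (\<Sum>i\<in>J. e i * b k i)"
      have rk: "r * (\<Sum>i\<in>J. e i * b k i) = (\<Sum>i\<in>J. d i * b k i)"
        using ek by (simp add: r_def)
      have lin: "(\<Sum>i\<in>J. (d i - r * e i) * f i) = (\<Sum>i\<in>J. d i * f i) - r * (\<Sum>i\<in>J. e i * f i)" for f
        by (simp add: left_diff_distrib sum_subtractf sum_distrib_left mult.assoc)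
      have "(\<Sum>i\<in>J. (d i - r * e i) * a i) = 0"
        by (rule insert.prems) (use d e rk in \<open>auto simp: lin\<close>)
      then have "(\<Sum>i\<in>J. d i * a i) = c * (\<Sum>i\<in>J. d i * b k i)"
        unfolding lin by (simp add: r_def c_def)
      moreover have "(\<Sum>i\<in>J. d i * (a i - c * b k i)) = (\<Sum>i\<in>J. d i * a i) - c * (\<Sum>i\<in>J. d i * b k i)"
        by (simp add: right_diff_distrib sum_subtractf sum_distrib_left mult.left_commute)
      ultimately show "(\<Sum>i\<in>J. d i * (a i - c * b k i)) = 0" by simp
    qed
    then obtain y where y: "\<forall>i\<in>J. a i - c * b k i = (\<Sum>k\<in>K. y k * b k i)" by blast
    have "(\<Sum>k'\<in>K. (y(k := c)) k' * b k' i) = (\<Sum>k\<in>K. y k * b k i)" for i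
      using insert.hyps by (intro sum.cong) auto
    then show ?thesis using insert.hyps y by (intro exI[of _ "y(k := c)"]) (force simp: algebra_simps)
  qed
qed

section \<open>Rollouts and the first-order condition of barrier minimizers\<close>

context smooth_ocp
begin

lemma barrier_feas_coords: "barrier_feas P \<theta> \<zeta> \<longleftrightarrow> dyn_ok P \<theta> \<zeta> \<and> (\<forall>k\<in>KG. con k (coords T \<zeta> \<theta>) < 0)"
  by (force simp: barrier_feas_def KG_def con_def)

lemma barrier_cost_coords:
  "barrier_cost P \<theta> \<gamma> \<zeta> = cost (coords T \<zeta> \<theta>) - \<gamma> * (\<Sum>k\<in>KG. ln (- con k (coords T \<zeta> \<theta>)))
     + 1 / (2 * \<gamma>) * (\<Sum>k\<in>KH. (con k (coords T \<zeta> \<theta>))\<^sup>2)"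
  unfolding barrier_cost_def Let_def cost_def sum_KG sum_KH
  by (simp add: con_def sum.distrib sum_subtractf sum_distrib_left distrib_left)

lemma dyn_ok_con: "dyn_ok P \<theta> \<xi> \<Longrightarrow> k \<in> KE \<Longrightarrow> con k (coords T \<xi> \<theta>) = 0"
  by (auto simp: KE_def con_def dync_def dyn_ok_def coords_def)

primrec rollout :: "real^'r \<Rightarrow> (nat \<Rightarrow> real^'m) \<Rightarrow> nat \<Rightarrow> real^'n" where
  "rollout \<theta> U 0 = ini P \<theta>"
| "rollout \<theta> U (Suc t) = dyn P (rollout \<theta> U t) (U t) \<theta>"

lemma rollout_eq: "dyn_ok P \<theta> \<xi> \<Longrightarrow> t \<le> T \<Longrightarrow> rollout \<theta> (snd \<xi>) t = fst \<xi> t"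
  by (induction t) (auto simp: dyn_ok_def)

lemma dyn_ok_rollout: "dyn_ok P \<theta> (rollout \<theta> U, U)"
  by (simp add: dyn_ok_def)

text \<open>Every tangent direction of the dynamics is realised by perturbing the inputs and rolling out
  the states.\<close>

lemma rollout_derivative:
  fixes d :: "('n, 'm, 'r) idx \<Rightarrow> real"
  assumes ok: "dyn_ok P \<theta> \<xi>" and tan: "\<And>k. k \<in> KE \<Longrightarrow> Dd (con k) (coords T \<xi> \<theta>) d = 0" and sd: "sth d = 0"
    and t: "t \<le> T"
  shows "((\<lambda>s. rollout \<theta> (\<lambda>t. snd \<xi> t + s *\<^sub>R su d t) t $ j) has_real_derivative d (IX t j)) (at 0)"
  using t
proof (induction t arbitrary: j)
  case 0
  have "d (IX 0 j) = 0" using tan[of "Ini j"] by (simp add: Dd_Ini[OF sd])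
  then show ?case by simp
next
  case (Suc t)
  define w where "w = coords T \<xi> \<theta>"
  define X where "X = (\<lambda>s. rollout \<theta> (\<lambda>t. snd \<xi> t + s *\<^sub>R su d t))"
  let ?I = "range (IX t) \<union> range (IU t) :: ('n, 'm, 'r) idx set"
  \<comment> \<open>Only the coordinates of stage \<open>t\<close> follow the rolled-out curve. The
    next state depends on no others, so freezing the rest keeps the moving set finite.\<close>
  define \<omega> where "\<omega> = (\<lambda>s i. case i of IX t' j \<Rightarrow> if t' = t then X s t $ j else w i
     | IU t' j \<Rightarrow> if t' = t then snd \<xi> t $ j + s * su d t $ j else w i | IT k \<Rightarrow> w i)"
  \<comment> \<open>The matching velocity; it gives the same derivative of \<open>dync t j\<close>
    as \<open>d\<close>, because that function sees only stage \<open>t\<close> and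
    \<theta>.\<close>
  define d' where "d' = (\<lambda>i. if i \<in> ?I then d i else 0)"
  have tT: "t < T" using Suc.prems by simp
  have s\<omega>: "sx (\<omega> s) t = X s t" "su (\<omega> s) t = snd \<xi> t + s *\<^sub>R su d t" "sth (\<omega> s) = \<theta>" for s
    by (simp_all add: vec_eq_iff \<omega>_def w_def coords_def)
  have X0: "X 0 t = fst \<xi> t" using rollout_eq[OF ok, of t] tT by (simp add: X_def)
  have \<omega>0: "\<omega> 0 = w"
  proof
    fix i show "\<omega> 0 i = w i"
      by (cases i) (use X0 tT in \<open>auto simp: \<omega>_def w_def coords_def\<close>)
  qed
  have "((\<lambda>s. dync t j (\<omega> s)) has_real_derivative Dd (dync t j) (\<omega> 0) d') (at 0)"
  proof (rule gCk_curve[OF C3_C1[OF dync_C3], where I = ?I and c = w])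
    fix i assume "i \<in> ?I"
    then show "((\<lambda>s. \<omega> s i) has_real_derivative d' i) (at 0)"
      using Suc.IH tT by (auto simp: \<omega>_def d'_def X_def intro!: derivative_eq_intros)
  next
    show "\<omega> s i = w i" if "i \<notin> ?I" for s i
      using that by (cases i) (auto simp: \<omega>_def)
  qed (auto simp: d'_def)
  moreover have "dync t j (\<omega> s) = X s (Suc t) $ j" for s
    by (simp add: dync_def s\<omega>) (simp add: X_def)
  moreover have "Dd (dync t j) w d' = Dd (dync t j) w d"
  proof -
    have "sx d' t = sx d t" "su d' t = su d t" "sth d' = sth d"
      using sd by (auto simp: vec_eq_iff d'_def)
    then show ?thesis by (simp add: Dd_def dync_def)
  qed
  moreover have "Dd (dync t j) w d = d (IX (Suc t) j)"
    using tan[of "Dyn t j"] tT by (simp add: Dd_Dyn w_def)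
  ultimately show ?case by (simp add: \<omega>0 X_def del: rollout.simps)
qed

text \<open>Fermat's rule along a curve of rollouts. The dynamics hold exactly on it, while strict
  inequalities and closeness persist for small \<open>s\<close>, so the barrier cost becomes a
  function of one real variable with a local minimum at 0.\<close>

lemma barrier_first_order:
  fixes d :: "('n, 'm, 'r) idx \<Rightarrow> real"
  assumes \<gamma>: "\<gamma> > 0" and min: "barrier_locmin P \<theta> \<gamma> \<xi>"
    and d0: "\<And>i. i \<notin> Jset T \<Longrightarrow> d i = 0"
  defines "w \<equiv> coords T \<xi> \<theta>"
  assumes tan: "\<And>k. k \<in> KE \<Longrightarrow> Dd (con k) w d = 0"
  shows "Dd cost w d + (\<Sum>k\<in>KH. con k w / \<gamma> * Dd (con k) w d) + (\<Sum>k\<in>KG. - \<gamma> / con k w * Dd (con k) w d) = 0"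
proof -
  have sd: "sth d = 0" using sth_outside_Jset[of d] d0 by blast
  obtain \<rho> where feas: "barrier_feas P \<theta> \<xi>" and \<rho>: "\<rho> > 0"
    and le: "\<And>\<eta>. barrier_feas P \<theta> \<eta> \<Longrightarrow> traj_near T \<xi> \<eta> \<rho> \<Longrightarrow> barrier_cost P \<theta> \<gamma> \<xi> \<le> barrier_cost P \<theta> \<gamma> \<eta>"
    using min unfolding barrier_locmin_def by blast
  then have ok: "dyn_ok P \<theta> \<xi>" and neg: "\<forall>k\<in>KG. con k w < 0" by (auto simp: barrier_feas_coords w_def)
  define U where "U = (\<lambda>s t. snd \<xi> t + s *\<^sub>R su d t)"
  define \<eta> where "\<eta> = (\<lambda>s. (rollout \<theta> (U s), U s))"
  define \<omega> where "\<omega> = (\<lambda>s. coords T (\<eta> s) \<theta>)"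
  have U0: "U 0 = snd \<xi>" by (simp add: U_def)
  have \<omega>0: "\<omega> 0 = w"
  proof
    fix i :: "('n, 'm, 'r) idx"
    show "\<omega> 0 i = w i"
      by (cases i) (use rollout_eq[OF ok] in \<open>auto simp: \<omega>_def w_def coords_def \<eta>_def U0\<close>)
  qed
  have d\<omega>: "((\<lambda>s. \<omega> s i) has_real_derivative d i) (at 0)" if "i \<in> Jset T" for i
  proof (cases i)
    case (IX t j)
    then show ?thesis using rollout_derivative[OF ok tan[unfolded w_def] sd, of t j] that
      by (simp add: \<omega>_def coords_def \<eta>_def U_def)
  next
    case (IU t k)
    then show ?thesis using that by (auto simp: \<omega>_def coords_def \<eta>_def U_def intro!: derivative_eq_intros)
  qed (use that in simp)
  have dF: "((\<lambda>s. F (\<omega> s)) has_real_derivative Dd F w d) (at 0)" if "gCk flin 3 F" for F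
  proof -
    have "((\<lambda>s. F (\<omega> s)) has_real_derivative Dd F (\<omega> 0) d) (at 0)"
    proof (rule gCk_curve[OF C3_C1[OF that], where I = "Jset T" and c = w])
      show "\<omega> s i = w i" if "i \<notin> Jset T" for s i
        using that by (cases i) (auto simp: \<omega>_def w_def coords_def)
    qed (use d\<omega> d0 in auto)
    then show ?thesis by (simp add: \<omega>0)
  qed
  define f where "f = (\<lambda>s. barrier_cost P \<theta> \<gamma> (\<eta> s))"
  have f: "f s = cost (\<omega> s) - \<gamma> * (\<Sum>k\<in>KG. ln (- con k (\<omega> s))) + 1 / (2 * \<gamma>) * (\<Sum>k\<in>KH. (con k (\<omega> s))\<^sup>2)" for s
    by (simp add: f_def barrier_cost_coords \<omega>_def)
  have "((\<lambda>s. ln (- con k (\<omega> s))) has_real_derivative Dd (con k) w d / con k w) (at 0)" if "k \<in> KG" for k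
    using neg that by (auto intro!: derivative_eq_intros dF con_C3 simp: \<omega>0 divide_inverse)
  moreover have "((\<lambda>s. (con k (\<omega> s))\<^sup>2) has_real_derivative 2 * con k w * Dd (con k) w d) (at 0)" if "k \<in> KH" for k
    using that by (auto intro!: derivative_eq_intros dF con_C3 simp: \<omega>0)
  ultimately have "((\<lambda>s. cost (\<omega> s) - \<gamma> * (\<Sum>k\<in>KG. ln (- con k (\<omega> s))) + 1 / (2 * \<gamma>) * (\<Sum>k\<in>KH. (con k (\<omega> s))\<^sup>2)) has_real_derivative
      Dd cost w d - \<gamma> * (\<Sum>k\<in>KG. Dd (con k) w d / con k w) + 1 / (2 * \<gamma>) * (\<Sum>k\<in>KH. 2 * con k w * Dd (con k) w d)) (at 0)"
    by (intro DERIV_add DERIV_diff DERIV_cmult DERIV_sum dF cost_C3)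
  then have df: "(f has_real_derivative
      Dd cost w d - \<gamma> * (\<Sum>k\<in>KG. Dd (con k) w d / con k w) + 1 / (2 * \<gamma>) * (\<Sum>k\<in>KH. 2 * con k w * Dd (con k) w d)) (at 0)"
    by (simp add: f[abs_def])
  have "\<forall>\<^sub>F s in nhds 0. \<forall>k\<in>KG. con k (\<omega> s) < 0"
  proof (intro eventually_ball_finite ballI)
    fix k assume k: "k \<in> KG"
    have "isCont (\<lambda>s. con k (\<omega> s)) 0" using dF[OF con_C3[of k]] k DERIV_isCont by blast
    from order_tendstoD(2)[OF isCont_tendsto_nhds[OF this]]
    show "\<forall>\<^sub>F s in nhds 0. con k (\<omega> s) < 0" using neg k by (simp add: \<omega>0)
  qed simp
  moreover have "\<forall>\<^sub>F s in nhds 0. \<forall>t\<in>{..T}. dist (fst \<xi> t) (fst (\<eta> s) t) < \<rho>"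
  proof (intro eventually_ball_finite ballI)
    fix t assume t: "t \<in> {..T}"
    have "isCont (\<lambda>s. rollout \<theta> (U s) t) 0"
      unfolding isCont_def
    proof (rule vec_tendstoI)
      fix j
      have "isCont (\<lambda>s. rollout \<theta> (U s) t $ j) 0"
        using rollout_derivative[OF ok tan[unfolded w_def] sd, of t j] t DERIV_isCont by (auto simp: U_def)
      then show "((\<lambda>s. rollout \<theta> (U s) t $ j) \<longlongrightarrow> rollout \<theta> (U 0) t $ j) (at 0)" by (simp add: isCont_def)
    qed
    then have "isCont (\<lambda>s. dist (fst \<xi> t) (fst (\<eta> s) t)) 0"
      unfolding \<eta>_def by (auto intro!: continuous_intros)
    from order_tendstoD(2)[OF isCont_tendsto_nhds[OF this]]
    show "\<forall>\<^sub>F s in nhds 0. dist (fst \<xi> t) (fst (\<eta> s) t) < \<rho>"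
      using \<rho> t rollout_eq[OF ok, of t] by (simp add: \<eta>_def U0)
  qed simp
  moreover have "\<forall>\<^sub>F s in nhds 0. \<forall>t\<in>{..<T}. dist (snd \<xi> t) (snd (\<eta> s) t) < \<rho>"
  proof (intro eventually_ball_finite ballI)
    fix t
    have "isCont (\<lambda>s. dist (snd \<xi> t) (snd (\<eta> s) t)) 0"
      unfolding \<eta>_def U_def by (auto intro!: continuous_intros)
    from order_tendstoD(2)[OF isCont_tendsto_nhds[OF this]]
    show "\<forall>\<^sub>F s in nhds 0. dist (snd \<xi> t) (snd (\<eta> s) t) < \<rho>"
      using \<rho> by (simp add: \<eta>_def U0)
  qed simp
  ultimately have "\<forall>\<^sub>F s in nhds 0. f 0 \<le> f s"
  proof eventually_elim
    case (elim s)
    have "barrier_feas P \<theta> (\<eta> s)"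
      using elim(1) dyn_ok_rollout by (simp add: barrier_feas_coords \<omega>_def \<eta>_def)
    moreover have "traj_near T \<xi> (\<eta> s) \<rho>" using elim(2,3) by (auto simp: traj_near_def)
    ultimately have "barrier_cost P \<theta> \<gamma> \<xi> \<le> f s" unfolding f_def by (rule le)
    moreover have "barrier_cost P \<theta> \<gamma> \<xi> = f 0"
      unfolding f \<omega>0 by (simp add: barrier_cost_coords w_def)
    ultimately show ?case by simp
  qed
  then obtain e where "e > 0" "\<forall>s. dist s 0 < e \<longrightarrow> f 0 \<le> f s"
    unfolding eventually_nhds_metric by blast
  then have "Dd cost w d - \<gamma> * (\<Sum>k\<in>KG. Dd (con k) w d / con k w) + 1 / (2 * \<gamma>) * (\<Sum>k\<in>KH. 2 * con k w * Dd (con k) w d) = 0"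
    by (intro DERIV_local_min[OF df]) (auto simp: dist_real_def)
  moreover have "1 / (2 * \<gamma>) * (\<Sum>k\<in>KH. 2 * con k w * Dd (con k) w d) = (\<Sum>k\<in>KH. con k w / \<gamma> * Dd (con k) w d)"
    using \<gamma> by (simp add: sum_distrib_left)
  moreover have "\<gamma> * (\<Sum>k\<in>KG. Dd (con k) w d / con k w) = - (\<Sum>k\<in>KG. - \<gamma> / con k w * Dd (con k) w d)"
    by (simp add: sum_distrib_left sum_negf)
  ultimately show ?thesis by simp
qed

text \<open>The first-order condition says that the cost gradient with its barrier and penalty terms
  vanishes on the tangent space of the dynamics; hence it is a combination of the gradients in
  \<open>KE\<close>, and the negated coefficients are the multipliers.\<close>

lemma barrier_locmin_stationary:
  assumes \<gamma>: "\<gamma> > 0" and min: "barrier_locmin P \<theta> \<gamma> \<xi>"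
  shows "barrier_stationary (Jset T) KE KH KG cost con \<gamma> (coords T \<xi> \<theta>)"
proof -
  define w where "w = coords T \<xi> \<theta>"
  have feas: "barrier_feas P \<theta> \<xi>" using min by (simp add: barrier_locmin_def)
  define a where "a = (\<lambda>j. pd j cost w + (\<Sum>k\<in>KH. con k w / \<gamma> * pd j (con k) w) + (\<Sum>k\<in>KG. - \<gamma> / con k w * pd j (con k) w))"
  have "\<exists>y. \<forall>j\<in>Jset T. a j = (\<Sum>k\<in>KE. y k * pd j (con k) w)"
  proof (rule functional_in_span)
    fix e :: "('n, 'm, 'r) idx \<Rightarrow> real"
    assume e: "\<forall>k\<in>KE. (\<Sum>i\<in>Jset T. e i * pd i (con k) w) = 0"
    define d where "d = (\<lambda>i. if i \<in> Jset T then e i else 0)"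
    have d0: "\<And>i. i \<notin> Jset T \<Longrightarrow> d i = 0" by (simp add: d_def)
    have Dc: "Dd (con k) w d = (\<Sum>i\<in>Jset T. e i * pd i (con k) w)" if "k \<in> KE \<union> KH \<union> KG" for k
      by (subst Dd_con_eq_sum_pd[OF that d0]) (auto simp: d_def)
    have Dcost: "Dd cost w d = (\<Sum>i\<in>Jset T. e i * pd i cost w)"
      by (subst Dd_eq_sum_pd[OF C3_C1[OF cost_C3], of "Jset T"]) (auto simp: d_def)
    have "Dd cost w d + (\<Sum>k\<in>KH. con k w / \<gamma> * Dd (con k) w d) + (\<Sum>k\<in>KG. - \<gamma> / con k w * Dd (con k) w d) = 0"
      unfolding w_def by (rule barrier_first_order[OF \<gamma> min d0]) (use Dc e in \<open>auto simp: w_def\<close>)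
    moreover have "(\<Sum>k\<in>KH. con k w / \<gamma> * Dd (con k) w d) = (\<Sum>i\<in>Jset T. e i * (\<Sum>k\<in>KH. con k w / \<gamma> * pd i (con k) w))"
      unfolding sum_distrib_left by (subst sum.swap) (simp add: Dc sum_distrib_left mult_ac)
    moreover have "(\<Sum>k\<in>KG. - \<gamma> / con k w * Dd (con k) w d) = (\<Sum>i\<in>Jset T. e i * (\<Sum>k\<in>KG. - \<gamma> / con k w * pd i (con k) w))"
      unfolding sum_distrib_left by (subst sum.swap) (simp add: Dc sum_distrib_left mult_ac)
    ultimately show "(\<Sum>i\<in>Jset T. e i * a i) = 0"
      by (simp add: Dcost a_def distrib_left sum.distrib)
  qed auto
  then obtain y where "\<forall>j\<in>Jset T. a j = (\<Sum>k\<in>KE. y k * pd j (con k) w)" by blast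
  then have "\<forall>j\<in>Jset T. pd j cost w + (\<Sum>k\<in>KE. - y k * pd j (con k) w)
            + (\<Sum>k\<in>KH. con k w / \<gamma> * pd j (con k) w)
            + (\<Sum>k\<in>KG. - \<gamma> / con k w * pd j (con k) w) = 0"
    by (simp add: a_def sum_negf algebra_simps)
  then show ?thesis
    using feas dyn_ok_con unfolding barrier_stationary_def
    by (auto simp: barrier_feas_coords w_def intro!: exI[of _ "\<lambda>k. - y k"])
qed

end

section \<open>The bi-level problem\<close>

lemma frequently_snd_pos: "\<exists>\<^sub>F q in nhds (x :: 'a::real_normed_vector, 0 :: real). snd q > 0"
  unfolding frequently_def
proof
  assume "\<forall>\<^sub>F q in nhds (x, 0 :: real). \<not> 0 < snd q"
  then obtain e where e: "e > 0" "\<And>q. dist q (x, 0 :: real) < e \<Longrightarrow> \<not> 0 < snd q"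
    unfolding eventually_nhds_metric by blast
  have "dist (x, e / 2) (x, 0 :: real) < e" using e(1) by (simp add: dist_Pair_Pair)
  from e(2)[OF this] e(1) show False by simp
qed

text \<open>Points with second component 0 are limits of points with positive second component, so
  continuity closes the identity up to the boundary.\<close>

lemma eventually_snd_nonneg:
  fixes f :: "'a::real_normed_vector \<times> real \<Rightarrow> real"
  assumes ev: "\<forall>\<^sub>F p in nhds p0. snd p > 0 \<longrightarrow> f p = 0" and cont: "\<forall>\<^sub>F p in nhds p0. isCont f p"
  shows "\<forall>\<^sub>F p in nhds p0. snd p \<ge> 0 \<longrightarrow> f p = 0"
proof -
  have "\<forall>\<^sub>F p in nhds p0. \<forall>\<^sub>F q in nhds p. snd q > 0 \<longrightarrow> f q = 0"
    using ev by (subst eventually_eventually)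
  with cont ev show ?thesis
  proof eventually_elim
    case (elim p)
    show ?case
    proof
      assume "snd p \<ge> 0"
      show "f p = 0"
      proof (cases "snd p = 0")
        case True
        then obtain x where p: "p = (x, 0)" by (metis prod.collapse)
        show ?thesis
          using elim(1,3) unfolding p by (intro frequently_eq_at_isCont[OF _ frequently_snd_pos])
      qed (use elim(2) \<open>snd p \<ge> 0\<close> in auto)
    qed
  qed
qed

lemma dd_has_derivative:
  assumes "(f has_derivative f') (at p)"
  shows "dd f p e = f' e"
proof -
  have "((\<lambda>s. p + s *\<^sub>R e) has_derivative (\<lambda>h. h *\<^sub>R e)) (at 0)"
    by (auto intro!: derivative_eq_intros)
  from has_derivative_compose[OF this, of f f'] assms
  have "((\<lambda>s. f (p + s *\<^sub>R e)) has_derivative (\<lambda>h. f' (h *\<^sub>R e))) (at 0)" by simp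
  then have "((\<lambda>s. f (p + s *\<^sub>R e)) has_vector_derivative f' e) (at 0)"
    using linear_scale[OF has_derivative_linear[OF assms]] by (simp add: has_vector_derivative_def)
  then show ?thesis unfolding dd_def by (rule vector_derivative_at)
qed

text \<open>\<open>D i b\<close> is a C1 extension of the derivative of coordinate \<open>i\<close>
  in direction \<open>(b, 0)\<close>, tied to that derivative only where the barrier parameter is
  positive. The map \<omega> itself is merely C1.\<close>

locale parametric_solution =
  fixes \<omega> :: "'a::euclidean_space \<times> real \<Rightarrow> 'i \<Rightarrow> real" and I :: "'i set" and \<theta>s :: 'a
    and D :: "'i \<Rightarrow> 'a \<Rightarrow> 'a \<times> real \<Rightarrow> real" and cc :: "'i \<Rightarrow> real"
  assumes finI: "finite I" and \<omega>_C1: "\<And>i. i \<in> I \<Longrightarrow> C1_at (\<lambda>p. \<omega> p i) (\<theta>s, 0)"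
    and \<omega>_const: "\<And>p i. i \<notin> I \<Longrightarrow> \<omega> p i = cc i"
    and D_C1: "\<And>i b. i \<in> I \<Longrightarrow> b \<in> Basis \<Longrightarrow> C1_at (D i b) (\<theta>s, 0)"
    and D: "\<And>i b. i \<in> I \<Longrightarrow> b \<in> Basis \<Longrightarrow> \<forall>\<^sub>F p in nhds (\<theta>s, 0). snd p > 0 \<longrightarrow> frechet_derivative (\<lambda>p. \<omega> p i) (at p) (b, 0) = D i b p"
begin

text \<open>The chain rule in \<theta> with the true derivatives of \<omega> replaced by their
  extensions \<open>D\<close>; this is what makes the gradient C1 on both sides of \<gamma> =
  0.\<close>

definition grad :: "(('i \<Rightarrow> real) \<Rightarrow> real) \<Rightarrow> 'a \<times> real \<Rightarrow> 'a" where
  "grad F p = (\<Sum>b\<in>Basis. (\<Sum>i\<in>I. pd i F (\<omega> p) * D i b p) *\<^sub>R b)"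

lemma composite_C1: "gCk flin (Suc k) F \<Longrightarrow> C1_at (\<lambda>p. F (\<omega> p)) (\<theta>s, 0)"
  by (rule C1_at_gCk[OF _ finI \<omega>_C1 \<omega>_const])

lemma grad_C1:
  assumes "gCk flin (Suc (Suc k)) F"
  shows "C1_at (\<lambda>p. grad F p \<bullet> c) (\<theta>s, 0)"
  unfolding grad_def inner_sum_left inner_scaleR_left
  by (intro C1_at_sum C1_at_mult C1_at_const composite_C1[OF gCk_pd[OF assms]] D_C1)

text \<open>For \<gamma> > 0 this is the chain rule. Both sides are continuous, so it reaches
  \<gamma> = 0, where the outer optimality conditions are formulated.\<close>

lemma frechet_eq_grad:
  assumes F: "gCk flin (Suc (Suc k)) F"
  shows "\<forall>\<^sub>F p in nhds (\<theta>s, 0). snd p \<ge> 0 \<longrightarrow> (\<forall>e. frechet_derivative (\<lambda>p. F (\<omega> p)) (at p) (e, 0) = grad F p \<bullet> e)"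
proof -
  have ev\<omega>: "\<forall>\<^sub>F p in nhds (\<theta>s, 0). \<forall>i\<in>I. C1_at (\<lambda>p. \<omega> p i) p"
    by (intro eventually_ball_finite finI ballI C1_at_eventually \<omega>_C1)
  have evF: "\<forall>\<^sub>F p in nhds (\<theta>s, 0). C1_at (\<lambda>p. F (\<omega> p)) p"
    by (intro C1_at_eventually composite_C1[OF F])
  have "\<forall>\<^sub>F p in nhds (\<theta>s, 0). \<forall>b\<in>Basis. snd p \<ge> 0 \<longrightarrow>
      frechet_derivative (\<lambda>p. F (\<omega> p)) (at p) (b, 0) - (\<Sum>i\<in>I. pd i F (\<omega> p) * D i b p) = 0"
  proof (intro eventually_ball_finite ballI eventually_snd_nonneg)
    fix b :: 'a assume b: "b \<in> Basis"
    have "\<forall>\<^sub>F p in nhds (\<theta>s, 0). \<forall>i\<in>I. snd p > 0 \<longrightarrow> frechet_derivative (\<lambda>p. \<omega> p i) (at p) (b, 0) = D i b p"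
      using D b by (intro eventually_ball_finite finI ballI) auto
    with ev\<omega> show "\<forall>\<^sub>F p in nhds (\<theta>s, 0). snd p > 0 \<longrightarrow>
      frechet_derivative (\<lambda>p. F (\<omega> p)) (at p) (b, 0) - (\<Sum>i\<in>I. pd i F (\<omega> p) * D i b p) = 0"
    proof eventually_elim
      case (elim p)
      have "((\<lambda>p. F (\<omega> p)) has_derivative (\<lambda>e. \<Sum>i\<in>I. pd i F (\<omega> p) * frechet_derivative (\<lambda>p. \<omega> p i) (at p) e)) (at p)"
        by (rule gCk_chain'[OF F finI _ \<omega>_const]) (use elim(1) C1_at_has_derivative in blast)
      from frechet_derivative_at[OF this, symmetric] elim(2) show ?case by simp
    qed
    have "\<forall>\<^sub>F p in nhds (\<theta>s, 0). C1_at (\<lambda>p. \<Sum>i\<in>I. pd i F (\<omega> p) * D i b p) p"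
      by (intro C1_at_eventually C1_at_sum C1_at_mult composite_C1[OF gCk_pd[OF F]] D_C1 b)
    with evF show "\<forall>\<^sub>F p in nhds (\<theta>s, 0). isCont (\<lambda>p. frechet_derivative (\<lambda>p. F (\<omega> p)) (at p) (b, 0) - (\<Sum>i\<in>I. pd i F (\<omega> p) * D i b p)) p"
      by eventually_elim (rule continuous_diff[OF C1_at_isCont_frechet C1_at_isCont])
  qed auto
  with evF show ?thesis
  proof eventually_elim
    case (elim p)
    show ?case
    proof (intro impI allI)
      fix e :: 'a assume p: "snd p \<ge> 0"
      have "bounded_linear (\<lambda>e. (e :: 'a, 0 :: real))"
        by (intro bounded_linear_Pair bounded_linear_ident bounded_linear_zero)
      then have "bounded_linear (\<lambda>e. frechet_derivative (\<lambda>p. F (\<omega> p)) (at p) (e, 0))"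
        by (rule bounded_linear_compose[OF has_derivative_bounded_linear[OF C1_at_has_derivative[OF elim(1)]]])
      from bounded_linear_eq_inner[OF this, of e]
      have "frechet_derivative (\<lambda>p. F (\<omega> p)) (at p) (e, 0) = (\<Sum>b\<in>Basis. frechet_derivative (\<lambda>p. F (\<omega> p)) (at p) (b, 0) *\<^sub>R b) \<bullet> e" by simp
      also have "(\<Sum>b\<in>Basis. frechet_derivative (\<lambda>p. F (\<omega> p)) (at p) (b, 0) *\<^sub>R b) = grad F p"
        unfolding grad_def by (intro sum.cong refl) (use elim(2) p in auto)
      finally show "frechet_derivative (\<lambda>p. F (\<omega> p)) (at p) (e, 0) = grad F p \<bullet> e" .
    qed
  qed
qed

lemma section_has_grad:
  assumes F: "gCk flin (Suc (Suc k)) F"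
  shows "\<forall>\<^sub>F p in nhds (\<theta>s, 0). snd p \<ge> 0 \<longrightarrow> ((\<lambda>\<theta>. F (\<omega> (\<theta>, snd p))) has_derivative (\<lambda>e. grad F p \<bullet> e)) (at (fst p))"
proof -
  have "\<forall>\<^sub>F p in nhds (\<theta>s, 0). C1_at (\<lambda>p. F (\<omega> p)) p"
    by (intro C1_at_eventually composite_C1[OF F])
  with frechet_eq_grad[OF F] show ?thesis
  proof eventually_elim
    case (elim p)
    obtain x \<gamma> where p: "p = (x, \<gamma>)" by (cases p)
    show ?case
    proof
      assume "snd p \<ge> 0"
      then have "frechet_derivative (\<lambda>\<theta>. F (\<omega> (\<theta>, \<gamma>))) (at x) = (\<lambda>e. grad F p \<bullet> e)"
        using C1_at_section(2)[of "\<lambda>p. F (\<omega> p)" x \<gamma>] elim by (auto simp: p)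
      with C1_at_has_derivative[OF C1_at_section(1)[of "\<lambda>p. F (\<omega> p)" x \<gamma>]] elim(2)
      show "((\<lambda>\<theta>. F (\<omega> (\<theta>, snd p))) has_derivative (\<lambda>e. grad F p \<bullet> e)) (at (fst p))" by (simp add: p)
    qed
  qed
qed

text \<open>The outer problem is stated in terms of the exact solution map, which agrees with \<open>\<omega>\<close>
  at \<open>\<gamma> = 0\<close>.\<close>

lemma log_barrier_composite:
  assumes F0: "gCk flin 2 F0" and F: "\<And>i. i < l \<Longrightarrow> gCk flin 2 (F i)"
    and Phi: "\<forall>\<^sub>F \<theta> in nhds \<theta>s. Phi \<theta> = F0 (\<omega> (\<theta>, 0))"
    and Psi: "\<And>i. i < l \<Longrightarrow> \<forall>\<^sub>F \<theta> in nhds \<theta>s. Psi i \<theta> = F i (\<omega> (\<theta>, 0))"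
    and sosc: "(\<forall>y. dd (\<lambda>\<theta>. Phi \<theta> + (\<Sum>i<l. u i * Psi i \<theta>)) \<theta>s y = 0) \<and>
        (\<forall>i<l. u i * Psi i \<theta>s = 0 \<and> Psi i \<theta>s \<le> 0 \<and> u i \<ge> 0) \<and>
        (\<forall>y. y \<noteq> 0 \<and>
             (\<forall>i<l. u i > 0 \<longrightarrow> dd (Psi i) \<theta>s y = 0) \<and>
             (\<forall>i<l. Psi i \<theta>s = 0 \<and> u i = 0 \<longrightarrow> dd (Psi i) \<theta>s y \<le> 0)
           \<longrightarrow> dd (\<lambda>\<theta>. dd (\<lambda>\<theta>. Phi \<theta> + (\<Sum>i<l. u i * Psi i \<theta>)) \<theta> y) \<theta>s y > 0) \<and>
        (\<forall>i<l. Psi i \<theta>s = 0 \<longrightarrow> u i > 0)"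
    and licq: "\<And>a. (\<forall>y. (\<Sum>i\<in>{i. i < l \<and> Psi i \<theta>s = 0}. a i * dd (Psi i) \<theta>s y) = 0)
       \<Longrightarrow> (\<forall>i<l. Psi i \<theta>s = 0 \<longrightarrow> a i = 0)"
  shows "log_barrier (\<lambda>p. F0 (\<omega> p)) (\<lambda>i p. F i (\<omega> p)) l (grad F0) (\<lambda>i. grad (F i)) \<theta>s u"
proof -
  have F0': "gCk flin (Suc (Suc 0)) F0" and F': "\<And>i. i < l \<Longrightarrow> gCk flin (Suc (Suc 0)) (F i)"
    using F0 F by (simp_all add: numeral_2_eq_2 del: gCk.simps)
  let ?p0 = "(\<theta>s, 0 :: real)"
  define Lag where "Lag = (\<lambda>\<theta>. Phi \<theta> + (\<Sum>i<l. u i * Psi i \<theta>))"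
  define gradL where "gradL = (\<lambda>p. grad F0 p + (\<Sum>i<l. u i *\<^sub>R grad (F i) p))"
  have tend: "((\<lambda>\<theta>. (\<theta>, 0 :: real)) \<longlongrightarrow> ?p0) (nhds \<theta>s)"
    by (intro tendsto_intros filterlim_ident)
  \<comment> \<open>Derivatives depend only on germs, so functions agreeing near the point may be
    exchanged; agreement of \<open>Phi\<close> and \<open>Psi\<close> with the composites is only
    local.\<close>
  have transfer: "(g has_derivative g') (at \<theta>) \<Longrightarrow> \<forall>\<^sub>F \<theta> in nhds \<theta>. f \<theta> = g \<theta> \<Longrightarrow> (f has_derivative g') (at \<theta>)" for f g :: "'a \<Rightarrow> real" and g' \<theta>
  proof -
    assume g: "(g has_derivative g') (at \<theta>)" and ev: "\<forall>\<^sub>F \<theta> in nhds \<theta>. f \<theta> = g \<theta>"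
    obtain S where S: "open S" "\<theta> \<in> S" "\<And>x. x \<in> S \<Longrightarrow> f x = g x"
      using ev unfolding eventually_nhds by blast
    show "(f has_derivative g') (at \<theta>)"
      by (rule has_derivative_transform_within_open[OF g S(1,2)]) (simp add: S(3))
  qed
  have dPsi: "((Psi i) has_derivative (\<lambda>e. grad (F i) ?p0 \<bullet> e)) (at \<theta>s)" if "i < l" for i
    using eventually_nhds_x_imp_x[OF section_has_grad[OF F'[OF that]]] by (intro transfer[OF _ Psi[OF that]]) auto
  have "\<forall>\<^sub>F \<theta> in nhds \<theta>s. ((\<lambda>\<theta>. F0 (\<omega> (\<theta>, 0))) has_derivative (\<lambda>e. grad F0 (\<theta>, 0) \<bullet> e)) (at \<theta>)"
    using eventually_compose_filterlim[OF section_has_grad[OF F0'] tend] by simp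
  moreover have "\<forall>\<^sub>F \<theta> in nhds \<theta>s. \<forall>i\<in>{..<l}. ((\<lambda>\<theta>. F i (\<omega> (\<theta>, 0))) has_derivative (\<lambda>e. grad (F i) (\<theta>, 0) \<bullet> e)) (at \<theta>)"
    using eventually_compose_filterlim[OF section_has_grad[OF F'] tend] by (intro eventually_ball_finite ballI) auto
  moreover have "\<forall>\<^sub>F \<theta> in nhds \<theta>s. \<forall>\<^sub>F \<theta> in nhds \<theta>. Lag \<theta> = F0 (\<omega> (\<theta>, 0)) + (\<Sum>i<l. u i * F i (\<omega> (\<theta>, 0)))"
  proof (subst eventually_eventually)
    have "\<forall>\<^sub>F \<theta> in nhds \<theta>s. \<forall>i\<in>{..<l}. Psi i \<theta> = F i (\<omega> (\<theta>, 0))"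
      using Psi by (intro eventually_ball_finite ballI) auto
    with Phi show "\<forall>\<^sub>F \<theta> in nhds \<theta>s. Lag \<theta> = F0 (\<omega> (\<theta>, 0)) + (\<Sum>i<l. u i * F i (\<omega> (\<theta>, 0)))"
      by eventually_elim (simp add: Lag_def)
  qed
  ultimately have dLag: "\<forall>\<^sub>F \<theta> in nhds \<theta>s. (Lag has_derivative (\<lambda>e. gradL (\<theta>, 0) \<bullet> e)) (at \<theta>)"
  proof eventually_elim
    case (elim \<theta>)
    have "((\<lambda>\<theta>. F0 (\<omega> (\<theta>, 0)) + (\<Sum>i<l. u i * F i (\<omega> (\<theta>, 0)))) has_derivative
       (\<lambda>e. grad F0 (\<theta>, 0) \<bullet> e + (\<Sum>i<l. u i * (grad (F i) (\<theta>, 0) \<bullet> e)))) (at \<theta>)"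
      using elim(1,2) by (intro has_derivative_add has_derivative_sum has_derivative_mult_right) auto
    then have "((\<lambda>\<theta>. F0 (\<omega> (\<theta>, 0)) + (\<Sum>i<l. u i * F i (\<omega> (\<theta>, 0)))) has_derivative (\<lambda>e. gradL (\<theta>, 0) \<bullet> e)) (at \<theta>)"
      by (simp add: gradL_def inner_add_left inner_sum_left)
    then show ?case by (rule transfer[OF _ elim(3)])
  qed
  have gradL0: "gradL ?p0 = 0"
  proof -
    have "gradL ?p0 \<bullet> y = 0" for y
      using dd_has_derivative[OF eventually_nhds_x_imp_x[OF dLag], of y] sosc by (simp add: Lag_def)
    then show ?thesis using inner_eq_zero_iff by blast
  qed
  \<comment> \<open>Second derivatives of the outer Lagrangian exist because its first derivatives
    are given by \<open>gradL\<close>, whose components are C1.\<close>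
  have hess: "dd (\<lambda>\<theta>. dd Lag \<theta> y) \<theta>s y = frechet_derivative (\<lambda>p. grad F0 p \<bullet> y) (at ?p0) (y, 0)
        + (\<Sum>i<l. u i * frechet_derivative (\<lambda>p. grad (F i) p \<bullet> y) (at ?p0) (y, 0))" for y
  proof -
    have s: "((\<lambda>\<theta>. grad G (\<theta>, 0) \<bullet> y) has_derivative (\<lambda>e. frechet_derivative (\<lambda>p. grad G p \<bullet> y) (at ?p0) (e, 0))) (at \<theta>s)"
      if "gCk flin (Suc (Suc 0)) G" for G
    proof -
      have "frechet_derivative (\<lambda>\<theta>. grad G (\<theta>, 0) \<bullet> y) (at \<theta>s) = (\<lambda>e. frechet_derivative (\<lambda>p. grad G p \<bullet> y) (at ?p0) (e, 0))"
        by (rule ext) (rule C1_at_section(2)[OF grad_C1[OF that, of y]])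
      with C1_at_has_derivative[OF C1_at_section(1)[OF grad_C1[OF that, of y]]] show ?thesis by simp
    qed
    have "((\<lambda>\<theta>. grad F0 (\<theta>, 0) \<bullet> y + (\<Sum>i<l. u i * (grad (F i) (\<theta>, 0) \<bullet> y))) has_derivative
       (\<lambda>e. frechet_derivative (\<lambda>p. grad F0 p \<bullet> y) (at ?p0) (e, 0) +
          (\<Sum>i<l. u i * frechet_derivative (\<lambda>p. grad (F i) p \<bullet> y) (at ?p0) (e, 0)))) (at \<theta>s)"
      by (intro has_derivative_add has_derivative_sum has_derivative_mult_right s F0' F') auto
    then have "((\<lambda>\<theta>. dd Lag \<theta> y) has_derivative
       (\<lambda>e. frechet_derivative (\<lambda>p. grad F0 p \<bullet> y) (at ?p0) (e, 0) +
          (\<Sum>i<l. u i * frechet_derivative (\<lambda>p. grad (F i) p \<bullet> y) (at ?p0) (e, 0)))) (at \<theta>s)"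
    proof (rule transfer)
      show "\<forall>\<^sub>F \<theta> in nhds \<theta>s. dd Lag \<theta> y = grad F0 (\<theta>, 0) \<bullet> y + (\<Sum>i<l. u i * (grad (F i) (\<theta>, 0) \<bullet> y))"
        using dLag by eventually_elim (simp add: dd_has_derivative gradL_def inner_add_left inner_sum_left)
    qed
    from dd_has_derivative[OF this, of y] show ?thesis .
  qed
  have Psi0: "Psi i \<theta>s = F i (\<omega> ?p0)" if "i < l" for i
    using eventually_nhds_x_imp_x[OF Psi[OF that]] .
  have active: "{i. i < l \<and> F i (\<omega> ?p0) = 0} = {i. i < l \<and> Psi i \<theta>s = 0}"
    using Psi0 by auto
  have dPsi': "dd (Psi i) \<theta>s y = grad (F i) ?p0 \<bullet> y" if "i < l" for i y
    by (rule dd_has_derivative[OF dPsi[OF that]])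
  show ?thesis
  proof
    show "C1_at (\<lambda>p. grad F0 p \<bullet> b) ?p0" for b by (rule grad_C1[OF F0'])
    show "C1_at (\<lambda>p. grad (F i) p \<bullet> b) ?p0" if "i < l" for i b by (rule grad_C1[OF F'[OF that]])
    show "C1_at (\<lambda>p. F i (\<omega> p)) ?p0" if "i < l" for i by (rule composite_C1[OF F'[OF that]])
    show "\<forall>\<^sub>F p in nhds ?p0. 0 < snd p \<longrightarrow> ((\<lambda>\<theta>. F0 (\<omega> (\<theta>, snd p))) has_derivative (\<lambda>e. grad F0 p \<bullet> e)) (at (fst p))"
      using section_has_grad[OF F0'] by eventually_elim auto
    show "\<forall>\<^sub>F p in nhds ?p0. 0 < snd p \<longrightarrow> ((\<lambda>\<theta>. F i (\<omega> (\<theta>, snd p))) has_derivative (\<lambda>e. grad (F i) p \<bullet> e)) (at (fst p))" if "i < l" for i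
      using section_has_grad[OF F'[OF that]] by eventually_elim auto
    show "frechet_derivative (\<lambda>p. F i (\<omega> p)) (at ?p0) (e, 0) = grad (F i) ?p0 \<bullet> e" if "i < l" for i e
      using eventually_nhds_x_imp_x[OF frechet_eq_grad[OF F'[OF that]]] by simp
    show "grad F0 ?p0 + (\<Sum>i<l. u i *\<^sub>R grad (F i) ?p0) = 0" using gradL0 by (simp add: gradL_def)
    show "u i * F i (\<omega> ?p0) = 0" "F i (\<omega> ?p0) \<le> 0" if "i < l" for i
      using sosc Psi0[OF that] that by auto
    show "u i > 0" if "i < l" "F i (\<omega> ?p0) = 0" for i
      using sosc Psi0[OF that(1)] that by auto
    show "\<forall>i\<in>{i. i < l \<and> F i (\<omega> ?p0) = 0}. a i = 0" if "(\<Sum>i\<in>{i. i < l \<and> F i (\<omega> ?p0) = 0}. a i *\<^sub>R grad (F i) ?p0) = 0" for a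
    proof -
      have "(\<Sum>i\<in>{i. i < l \<and> Psi i \<theta>s = 0}. a i * dd (Psi i) \<theta>s y) = (\<Sum>i\<in>{i. i < l \<and> F i (\<omega> ?p0) = 0}. a i *\<^sub>R grad (F i) ?p0) \<bullet> y" for y
        unfolding active inner_sum_left by (intro sum.cong) (auto simp: dPsi')
      then show ?thesis using licq[of a] that Psi0 by auto
    qed
    show "frechet_derivative (\<lambda>p. grad F0 p \<bullet> y) (at ?p0) (y, 0)
        + (\<Sum>i<l. u i * frechet_derivative (\<lambda>p. grad (F i) p \<bullet> y) (at ?p0) (y, 0)) > 0"
      if y: "y \<noteq> 0" "\<forall>i\<in>{i. i < l \<and> F i (\<omega> ?p0) = 0}. grad (F i) ?p0 \<bullet> y = 0" for y
    proof -
      \<comment> \<open>A positive multiplier forces the constraint to be active by complementarity,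
        so orthogonality to the active gradients applies.\<close>
      have "dd (Psi i) \<theta>s y = 0" if "i < l" "u i > 0" for i
        using sosc y(2) that Psi0[of i] by (auto simp: dPsi')
      moreover have "dd (Psi i) \<theta>s y \<le> 0" if "i < l" "Psi i \<theta>s = 0 \<and> u i = 0" for i
        using sosc that by auto
      ultimately have "dd (\<lambda>\<theta>. dd Lag \<theta> y) \<theta>s y > 0"
        using sosc y(1) unfolding Lag_def by blast
      then show ?thesis by (simp only: hess)
    qed
  qed
qed

end

section \<open>The barrier trajectory as a parametric solution\<close>

context smooth_ocp
begin

text \<open>Barrier minimizers satisfy the stationarity required by \<open>perturbed_nlp\<close>,
  with \<open>snd\<close> as barrier parameter and \<theta> as program parameter; one extension of
  the derivative is obtained for each direction \<open>(b, 0)\<close>.\<close>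

lemma barrier_solution_parametric:
  fixes xib :: "real^'r \<Rightarrow> real \<Rightarrow> ('n, 'm) traj" and \<xi>s :: "('n, 'm) traj"
  assumes inner: "inner_conds P \<theta>s \<xi>s" and \<delta>: "\<delta> > 0"
    and bar: "\<And>\<theta> \<gamma>. \<theta> \<in> ball \<theta>s \<delta> \<Longrightarrow> 0 < \<gamma> \<Longrightarrow> \<gamma> < \<delta> \<Longrightarrow> barrier_isolated_min P \<theta> \<gamma> (xib \<theta> \<gamma>)"
    and eq: "traj_eq T (xib \<theta>s 0) \<xi>s"
    and C1x: "\<And>t. t \<le> T \<Longrightarrow> C1_on (ball (\<theta>s, 0) \<delta>) (\<lambda>p. fst (xib (fst p) (snd p)) t)"
    and C1u: "\<And>t. t < T \<Longrightarrow> C1_on (ball (\<theta>s, 0) \<delta>) (\<lambda>p. snd (xib (fst p) (snd p)) t)"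
  obtains D where "parametric_solution (\<lambda>p. coords T (xib (fst p) (snd p)) (fst p)) (Jset T \<union> Tset) \<theta>s D (\<lambda>_. 0)"
proof -
  define \<omega> where "\<omega> = (\<lambda>p. coords T (xib (fst p) (snd p)) (fst p))"
  have ax: "x \<bullet> axis j 1 = x $ j" for x :: "real^'k::finite" and j by (simp add: inner_axis)
  have p0: "(\<theta>s, 0 :: real) \<in> ball (\<theta>s, 0) \<delta>" using \<delta> by simp
  have w0: "\<omega> (\<theta>s, 0) = coords T \<xi>s \<theta>s"
  proof
    fix i :: "('n, 'm, 'r) idx"
    show "\<omega> (\<theta>s, 0) i = coords T \<xi>s \<theta>s i"
      using eq by (cases i) (auto simp: \<omega>_def coords_def traj_eq_def)
  qed
  have blT: "bounded_linear (\<lambda>p :: (real^'r) \<times> real. fst p $ k)" for k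
    by (intro bounded_linear_compose[OF bounded_linear_vec_nth bounded_linear_fst])
  have \<omega>T: "(\<lambda>p. \<omega> p (IT k)) = (\<lambda>p. fst p $ k)" for k by (simp add: \<omega>_def coords_def)
  have fT: "frechet_derivative (\<lambda>p. \<omega> p (IT k)) (at p) = (\<lambda>e. fst e $ k)" for k p
    unfolding \<omega>T by (rule frechet_derivative_at[OF bounded_linear_imp_has_derivative[OF blT], symmetric])
  have \<omega>C1: "C1_at (\<lambda>p. \<omega> p i) (\<theta>s, 0)" if "i \<in> Jset T \<union> Tset" for i
  proof (cases i)
    case (IX t j)
    then show ?thesis
      using C1_on_imp_C1_at[OF C1x open_ball p0, of t "axis j 1"] that by (simp add: \<omega>_def coords_def ax)
  next
    case (IU t j)
    then show ?thesis
      using C1_on_imp_C1_at[OF C1u open_ball p0, of t "axis j 1"] that by (simp add: \<omega>_def coords_def ax)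
  next
    case (IT k)
    then show ?thesis using C1_at_linear[OF blT] by (simp add: \<omega>T)
  qed
  obtain y where y: "strict_KKT (Jset T) KE KH KG cost con (\<omega> (\<theta>s, 0)) y"
    unfolding w0 by (rule inner_conds_strict_KKT[OF inner])
  have fsnd: "frechet_derivative (snd :: (real^'r) \<times> real \<Rightarrow> real) (at p) = snd" for p
    by (rule frechet_derivative_at[OF bounded_linear_imp_has_derivative[OF bounded_linear_snd], symmetric])
  have near: "\<forall>\<^sub>F p in nhds (\<theta>s, 0 :: real). p \<in> ball \<theta>s \<delta> \<times> {..<\<delta>}"
    using \<delta> by (intro eventually_nhds_in_open open_Times) auto
  interpret perturbed_nlp "Jset T" Tset KE KH KG cost con \<omega> snd "(\<theta>s, 0)" y "\<lambda>_. 0"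
  proof
    show "\<forall>\<^sub>F p in nhds (\<theta>s, 0). 0 < snd p \<longrightarrow> barrier_stationary (Jset T) KE KH KG cost con (snd p) (\<omega> p)"
      using near
    proof eventually_elim
      case (elim p)
      then show ?case
        using bar[of "fst p" "snd p"] barrier_locmin_stationary[of "snd p" "fst p" "xib (fst p) (snd p)"]
        by (auto simp: barrier_isolated_min_def \<omega>_def)
    qed
    show "C1_at (\<lambda>p. frechet_derivative (\<lambda>p. \<omega> p i) (at p) e) (\<theta>s, 0)" if "i \<in> Tset" for i e
      using that by (auto simp: Tset_def fT)
    show "\<omega> p i = 0" if "i \<notin> Jset T \<union> Tset" for p i
      unfolding \<omega>_def by (rule coords_outside[OF that])
    show "C1_at (snd :: (real^'r) \<times> real \<Rightarrow> real) (\<theta>s, 0)" by (rule C1_at_linear[OF bounded_linear_snd])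
    show "C1_at (\<lambda>p :: (real^'r) \<times> real. frechet_derivative snd (at p) e) (\<theta>s, 0)" for e by (simp add: fsnd)
    show "\<exists>\<^sub>F p in nhds (\<theta>s, 0 :: real). 0 < snd p" by (rule frequently_snd_pos)
  qed (use y \<omega>C1 cost_C3 con_C3 in \<open>simp_all only: finite_K disj_K finite_idx snd_conv\<close>)
  have "\<forall>b. \<exists>D. (\<forall>i\<in>Jset T. C1_at (D i) (\<theta>s, 0)) \<and> (\<forall>\<^sub>F p in nhds (\<theta>s, 0). snd p > 0 \<longrightarrow> (\<forall>i\<in>Jset T. frechet_derivative (\<lambda>p. \<omega> p i) (at p) (b, 0) = D i p))"
  proof
    fix b show "\<exists>D. (\<forall>i\<in>Jset T. C1_at (D i) (\<theta>s, 0)) \<and> (\<forall>\<^sub>F p in nhds (\<theta>s, 0). snd p > 0 \<longrightarrow> (\<forall>i\<in>Jset T. frechet_derivative (\<lambda>p. \<omega> p i) (at p) (b, 0) = D i p))"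
      by (rule solution_derivative_C1[of "(b, 0)"]) blast
  qed
  from choice[OF this] obtain D where D: "\<And>b i. i \<in> Jset T \<Longrightarrow> C1_at (D b i) (\<theta>s, 0)"
    "\<And>b. \<forall>\<^sub>F p in nhds (\<theta>s, 0). snd p > 0 \<longrightarrow> (\<forall>i\<in>Jset T. frechet_derivative (\<lambda>p. \<omega> p i) (at p) (b, 0) = D b i p)" by blast
  \<comment> \<open>Parameter coordinates are linear in \<open>p\<close>, with constant derivative
    \<open>b $ k\<close>; the remaining coordinates use the chosen extensions.\<close>
  define D' where "D' = (\<lambda>i b. case i of IT k \<Rightarrow> (\<lambda>_. b $ k) | _ \<Rightarrow> D b i)"
  have "parametric_solution \<omega> (Jset T \<union> Tset) \<theta>s D' (\<lambda>_. 0)"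
  proof
    show "finite (Jset T \<union> Tset :: ('n, 'm, 'r) idx set)" by simp
    show "C1_at (\<lambda>p. \<omega> p i) (\<theta>s, 0)" if "i \<in> Jset T \<union> Tset" for i using that by (rule \<omega>C1)
    show "\<omega> p i = 0" if "i \<notin> Jset T \<union> Tset" for p i
      unfolding \<omega>_def by (rule coords_outside[OF that])
    show "C1_at (D' i b) (\<theta>s, 0)" if "i \<in> Jset T \<union> Tset" for i b
      using that D(1) by (cases i) (auto simp: D'_def)
    show "\<forall>\<^sub>F p in nhds (\<theta>s, 0). 0 < snd p \<longrightarrow> frechet_derivative (\<lambda>p. \<omega> p i) (at p) (b, 0) = D' i b p"
      if "i \<in> Jset T \<union> Tset" for i b
    proof (cases i)
      case (IT k)
      then show ?thesis by (simp add: fT D'_def)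
    qed (use that D(2)[of b] in \<open>auto simp: D'_def elim!: eventually_mono\<close>)
  qed
  then show ?thesis using that unfolding \<omega>_def by blast
qed

end

theorem theorem3:
  fixes P :: "('n::finite, 'm::finite, 'r::finite) ocp"
    and loss :: "('n,'m) traj \<Rightarrow> real^'r \<Rightarrow> real"
    and R :: "nat \<Rightarrow> ('n,'m) traj \<Rightarrow> real^'r \<Rightarrow> real"
    and l :: nat
    and \<theta>s :: "real^'r"
    and xi :: "real^'r \<Rightarrow> ('n,'m) traj"
    and xib :: "real^'r \<Rightarrow> real \<Rightarrow> ('n,'m) traj"
  assumes smooth_inner: "ocp_C3 P"
    and smooth_loss: "gCk tline 2 (\<lambda>(\<xi>,\<theta>). loss \<xi> \<theta>)"
    and smooth_R: "\<forall>i<l. gCk tline 2 (\<lambda>(\<xi>,\<theta>). R i \<xi> \<theta>)"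
    and loss_traj: "\<forall>\<xi> \<eta> \<theta>. traj_eq (hor P) \<xi> \<eta> \<longrightarrow> loss \<xi> \<theta> = loss \<eta> \<theta>"
    and R_traj: "\<forall>i<l. \<forall>\<xi> \<eta> \<theta>. traj_eq (hor P) \<xi> \<eta> \<longrightarrow> R i \<xi> \<theta> = R i \<eta> \<theta>"
    and xi_def: "\<exists>\<delta>>0. (\<forall>\<theta>\<in>ball \<theta>s \<delta>. inner_conds P \<theta> (xi \<theta>)) \<and>
                       (\<forall>t\<le>hor P. C1_on (ball \<theta>s \<delta>) (\<lambda>\<theta>. fst (xi \<theta>) t)) \<and>
                       (\<forall>t<hor P. C1_on (ball \<theta>s \<delta>) (\<lambda>\<theta>. snd (xi \<theta>) t))"
    and xib_def: "\<exists>\<delta>>0. (\<forall>\<theta>\<in>ball \<theta>s \<delta>. \<forall>\<gamma>. 0 < \<gamma> \<and> \<gamma> < \<delta> \<longrightarrow> barrier_isolated_min P \<theta> \<gamma> (xib \<theta> \<gamma>)) \<and>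
                        (\<forall>\<theta>\<in>ball \<theta>s \<delta>. traj_eq (hor P) (xib \<theta> 0) (xi \<theta>)) \<and>
                        (\<forall>t\<le>hor P. C1_on (ball (\<theta>s, 0) \<delta>) (\<lambda>p. fst (xib (fst p) (snd p)) t)) \<and>
                        (\<forall>t<hor P. C1_on (ball (\<theta>s, 0) \<delta>) (\<lambda>p. snd (xib (fst p) (snd p)) t))"
    and outer_sosc: "outer_SOSC_SC (\<lambda>\<theta>. loss (xi \<theta>) \<theta>) (\<lambda>i \<theta>. R i (xi \<theta>) \<theta>) l \<theta>s"
    and outer_licq: "outer_LICQ (\<lambda>i \<theta>. R i (xi \<theta>) \<theta>) l \<theta>s"
  shows "\<exists>\<epsilon>0>0. \<exists>\<gamma>0>0. \<exists>th :: real \<Rightarrow> real \<Rightarrow> real^'r.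
     (\<forall>\<epsilon> \<gamma>. 0 < \<epsilon> \<and> \<epsilon> < \<epsilon>0 \<and> 0 < \<gamma> \<and> \<gamma> < \<gamma>0 \<longrightarrow>
        isolated_local_min_on
          (\<lambda>\<theta>. loss (xib \<theta> \<gamma>) \<theta> - \<epsilon> * (\<Sum>i<l. ln (- R i (xib \<theta> \<gamma>) \<theta>)))
          {\<theta>. \<forall>i<l. R i (xib \<theta> \<gamma>) \<theta> < 0}
          (th \<epsilon> \<gamma>) \<and>
        (\<forall>i<l. R i (xib (th \<epsilon> \<gamma>) \<gamma>) (th \<epsilon> \<gamma>) < 0) \<and>
        (\<exists>\<rho>>0. \<forall>\<theta>\<in>ball (th \<epsilon> \<gamma>) \<rho>. \<forall>i<l. R i (xib \<theta> \<gamma>) \<theta> < 0)) \<and>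
     C1_on ({0<..<\<epsilon>0} \<times> {0<..<\<gamma>0}) (\<lambda>p. th (fst p) (snd p)) \<and>
     ((\<lambda>p. th (fst p) (snd p)) \<longlongrightarrow> \<theta>s) (at (0, 0) within ({0<..<\<epsilon>0} \<times> {0<..<\<gamma>0}))"
proof -
  interpret smooth_ocp P by standard (rule smooth_inner)
  have inner: "inner_conds P \<theta>s (xi \<theta>s)" using xi_def by force
  obtain \<delta> where \<delta>: "\<delta> > 0"
    and bar: "\<And>\<theta> \<gamma>. \<theta> \<in> ball \<theta>s \<delta> \<Longrightarrow> 0 < \<gamma> \<Longrightarrow> \<gamma> < \<delta> \<Longrightarrow> barrier_isolated_min P \<theta> \<gamma> (xib \<theta> \<gamma>)"
    and eq: "\<And>\<theta>. \<theta> \<in> ball \<theta>s \<delta> \<Longrightarrow> traj_eq T (xib \<theta> 0) (xi \<theta>)"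
    and C1x: "\<And>t. t \<le> T \<Longrightarrow> C1_on (ball (\<theta>s, 0) \<delta>) (\<lambda>p. fst (xib (fst p) (snd p)) t)"
    and C1u: "\<And>t. t < T \<Longrightarrow> C1_on (ball (\<theta>s, 0) \<delta>) (\<lambda>p. snd (xib (fst p) (snd p)) t)"
    using xib_def by blast
  define \<omega> where "\<omega> = (\<lambda>p. coords T (xib (fst p) (snd p)) (fst p))"
  have "\<theta>s \<in> ball \<theta>s \<delta>" using \<delta> by simp
  then obtain D where "parametric_solution \<omega> (Jset T \<union> Tset) \<theta>s D (\<lambda>_. 0)"
    using barrier_solution_parametric[OF inner \<delta> bar eq C1x C1u] unfolding \<omega>_def by blast
  then interpret parametric_solution \<omega> "Jset T \<union> Tset" \<theta>s D "\<lambda>_. 0" .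
  \<comment> \<open>Loss and task constraints are read off coordinates. Because they depend only on
    the relevant stages, setting all other coordinates to 0 does not change their values along the
    barrier trajectory.\<close>
  define F0 where "F0 = (\<lambda>w. loss (sx w, su w) (sth w))"
  define F where "F = (\<lambda>i w. R i (sx w, su w) (sth w))"
  have F0: "gCk flin 2 F0" and F: "\<And>i. i < l \<Longrightarrow> gCk flin 2 (F i)"
    unfolding F0_def F_def using smooth_loss smooth_R by (auto intro: gCk_traj simp del: gCk.simps)
  have te: "traj_eq T (sx (\<omega> (\<theta>, \<gamma>)), su (\<omega> (\<theta>, \<gamma>))) (xib \<theta> \<gamma>)" for \<theta> \<gamma>
    by (simp add: traj_eq_def \<omega>_def)
  have F0\<omega>: "F0 (\<omega> (\<theta>, \<gamma>)) = loss (xib \<theta> \<gamma>) \<theta>" for \<theta> \<gamma>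
  proof -
    have "loss (sx (\<omega> (\<theta>, \<gamma>)), su (\<omega> (\<theta>, \<gamma>))) \<theta> = loss (xib \<theta> \<gamma>) \<theta>" using loss_traj te by blast
    moreover have "sth (\<omega> (\<theta>, \<gamma>)) = \<theta>" by (simp add: \<omega>_def)
    ultimately show ?thesis by (simp add: F0_def)
  qed
  have F\<omega>: "F i (\<omega> (\<theta>, \<gamma>)) = R i (xib \<theta> \<gamma>) \<theta>" if "i < l" for i \<theta> \<gamma>
  proof -
    have "R i (sx (\<omega> (\<theta>, \<gamma>)), su (\<omega> (\<theta>, \<gamma>))) \<theta> = R i (xib \<theta> \<gamma>) \<theta>" using R_traj te that by blast
    moreover have "sth (\<omega> (\<theta>, \<gamma>)) = \<theta>" by (simp add: \<omega>_def)
    ultimately show ?thesis by (simp add: F_def)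
  qed
  have near: "\<forall>\<^sub>F \<theta> in nhds \<theta>s. \<theta> \<in> ball \<theta>s \<delta>"
    using \<delta> by (intro eventually_nhds_in_open) auto
  obtain u where u: "(\<forall>y. dd (\<lambda>\<theta>. loss (xi \<theta>) \<theta> + (\<Sum>i<l. u i * R i (xi \<theta>) \<theta>)) \<theta>s y = 0) \<and>
        (\<forall>i<l. u i * R i (xi \<theta>s) \<theta>s = 0 \<and> R i (xi \<theta>s) \<theta>s \<le> 0 \<and> u i \<ge> 0) \<and>
        (\<forall>y. y \<noteq> 0 \<and>
             (\<forall>i<l. u i > 0 \<longrightarrow> dd (\<lambda>\<theta>. R i (xi \<theta>) \<theta>) \<theta>s y = 0) \<and>
             (\<forall>i<l. R i (xi \<theta>s) \<theta>s = 0 \<and> u i = 0 \<longrightarrow> dd (\<lambda>\<theta>. R i (xi \<theta>) \<theta>) \<theta>s y \<le> 0)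
           \<longrightarrow> dd (\<lambda>\<theta>. dd (\<lambda>\<theta>. loss (xi \<theta>) \<theta> + (\<Sum>i<l. u i * R i (xi \<theta>) \<theta>)) \<theta> y) \<theta>s y > 0) \<and>
        (\<forall>i<l. R i (xi \<theta>s) \<theta>s = 0 \<longrightarrow> u i > 0)"
    using outer_sosc unfolding outer_SOSC_SC_def Let_def by blast
  have "log_barrier (\<lambda>p. F0 (\<omega> p)) (\<lambda>i p. F i (\<omega> p)) l (grad F0) (\<lambda>i. grad (F i)) \<theta>s u"
  proof (rule log_barrier_composite[OF F0 F _ _ u])
    show "\<forall>\<^sub>F \<theta> in nhds \<theta>s. loss (xi \<theta>) \<theta> = F0 (\<omega> (\<theta>, 0))"
      using near by eventually_elim (use eq loss_traj in \<open>metis F0\<omega>\<close>)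
    show "\<forall>\<^sub>F \<theta> in nhds \<theta>s. R i (xi \<theta>) \<theta> = F i (\<omega> (\<theta>, 0))" if "i < l" for i
      using near by eventually_elim (use eq R_traj that in \<open>metis F\<omega>\<close>)
    show "\<forall>i<l. R i (xi \<theta>s) \<theta>s = 0 \<longrightarrow> a i = 0"
      if "\<forall>y. (\<Sum>i | i < l \<and> R i (xi \<theta>s) \<theta>s = 0. a i * dd (\<lambda>\<theta>. R i (xi \<theta>) \<theta>) \<theta>s y) = 0" for a
      using outer_licq that unfolding outer_LICQ_def by blast
  qed
  then interpret log_barrier "\<lambda>p. F0 (\<omega> p)" "\<lambda>i p. F i (\<omega> p)" l "grad F0" "\<lambda>i. grad (F i)" \<theta>s u .
  show ?thesis using barrier_minimizers by (simp add: F0\<omega> F\<omega> cong: conj_cong)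
qed

end
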